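(* There exists an absolute constant $c_{\rm abs}>0$ such that for every $1<p\leq 2$, every $n\in\mathbb{N}$ and every $f:\Omega_n\to\mathbb{C}$, $$\left\|\left(\sum_{j=1}^n|D_jf|^2\right)^{1/2}\right\|_{L_p(\Omega_n)} \leq c_{\rm abs}\,(p-1)^{-2}\,\|\Delta^{1/p}f\|_{L_p(\Omega_n)}.$$
   Context: For $n\in\mathbb{N}=\{1,2,\dots\}$ let $[n]=\{1,\dots,n\}$ and let $\Omega_n=\{-1,1\}^n$ carry the uniform probability measure $\mu_n$; $L_p(\Omega_n)$ is the usual space of complex-valued functions with norm taken with respect to $\mu_n$. For $x\in\Omega_n$, $x^{(j)}$ is $x$ with $x_j$ replaced by $-x_j$, and $(D_jf)(x)=\frac{f(x)-f(x^{(j)})}{2}$. For $A\subseteq[n]$, $w_A(x)=\prod_{j\in A}x_j$ and $\widehat f(A)=\int_{\Omega_n} f\,w_A\,d\mu_n$. $\Delta=\sum_{j=1}^nD_j$, so that $\Delta w_A=|A|w_A$, and for $z\in\mathbb{C}$, $\Delta^zf=\sum_{\emptyset\neq A\subseteq[n]}|A|^z\widehat f(A)w_A$. An absolute constant does not depend on $p$, $n$, $f$. *)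

theory Defs
  imports "HOL-Probability.Probability"
begin

(* Points of the cube are functions on nat supported on {1..n}; outside {1..n} they take
   the fixed value undefined, so the set has exactly 2 ^ n elements. *)
definition cube :: "nat \<Rightarrow> (nat \<Rightarrow> real) set" where
  "cube n = {1..n} \<rightarrow>\<^sub>E {-1, 1}"

definition cube_measure :: "nat \<Rightarrow> (nat \<Rightarrow> real) measure" where
  "cube_measure n = uniform_count_measure (cube n)"

definition Lp_norm :: "real \<Rightarrow> 'a measure \<Rightarrow> ('a \<Rightarrow> 'b::real_normed_vector) \<Rightarrow> real" where
  "Lp_norm p M f = (\<integral>x. norm (f x) powr p \<partial>M) powr (1 / p)"

definition flip :: "nat \<Rightarrow> (nat \<Rightarrow> real) \<Rightarrow> nat \<Rightarrow> real" where
  "flip j x = x(j := - x j)"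

definition partial_diff :: "nat \<Rightarrow> ((nat \<Rightarrow> real) \<Rightarrow> complex) \<Rightarrow> (nat \<Rightarrow> real) \<Rightarrow> complex" where
  "partial_diff j f x = (f x - f (flip j x)) / 2"

definition walsh :: "nat set \<Rightarrow> (nat \<Rightarrow> real) \<Rightarrow> complex" where
  "walsh A x = complex_of_real (\<Prod>j\<in>A. x j)"

definition fourier_coeff :: "nat \<Rightarrow> ((nat \<Rightarrow> real) \<Rightarrow> complex) \<Rightarrow> nat set \<Rightarrow> complex" where
  "fourier_coeff n f A = (\<integral>x. f x * walsh A x \<partial>cube_measure n)"

definition laplacian_powr ::
  "nat \<Rightarrow> complex \<Rightarrow> ((nat \<Rightarrow> real) \<Rightarrow> complex) \<Rightarrow> (nat \<Rightarrow> real) \<Rightarrow> complex" where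
  "laplacian_powr n z f x =
     (\<Sum>A\<in>Pow {1..n} - {{}}. of_nat (card A) powr z * fourier_coeff n f A * walsh A x)"

end

theory Submission
  imports Defs
begin

text \<open>
  The idea. Put \<open>g = Delta powr (1 / p) f\<close>, let \<open>h\<close> be a vector field that norms the gradient of \<open>f\<close> in the dual space \<open>Lq\<close>, and
  let \<open>U\<close>, \<open>V\<close> be the Poisson extensions \<open>exp (- t * sqrt Delta)\<close> of \<open>g\<close> and \<open>h\<close>. Comparing eigenvalues, the pairing of the gradient \<open>D f\<close> with \<open>h\<close> is, up to
  the sign and a constant bounded below, the integral over \<open>t > 0\<close> of \<open>t powr (2 / p)\<close> times the pairing of \<open>D U\<close> with \<open>dV/dt\<close>
  (\<open>mean_pairing\<close>, \<open>pairing_limit\<close>). It remains to bound this integral by a multiple of \<open>1 / (p - 1) ^ 2\<close> when \<open>g\<close> and \<open>h\<close> are normalised.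

  The bound comes from a Bellman function. Let \<open>W\<close> be the Poisson extension of the majorant \<open>G = 1 + |g| + |h| powr (q - 1)\<close>. The semigroup is
  positive, being subordinated to the heat semigroup, so \<open>|U| \<le> W\<close>, and Jensen's inequality gives \<open>|V| \<le> W powr (p - 1)\<close>
  since \<open>p - 1 \<le> 1\<close>. In this convex region the function
  \<open>W powr (p - 2) * |U| ^ 2 + W powr (2 - p) * |V| ^ 2 + 10 / (p - 1) * W powr p\<close> is convex, with a quantitative lower bound for its Hessian.
  As all three extensions satisfy \<open>f'' = Delta f\<close>, the mean of this function is convex in time, and \<open>t\<close> times its second derivative has an integral
  of size \<open>1 / (p - 1)\<close>. This controls \<open>W powr (2 - p) * |dV/dt| ^ 2\<close> and, edge by edge, the squared differences of \<open>U\<close> and \<open>W\<close>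
  with the weight \<open>max W W' powr (p - 2)\<close>, where \<open>W'\<close> is the value at the other end of the edge (\<open>dissipation_integral\<close>).

  The absence of a chain rule shows on the edges with \<open>W' > 2 * W\<close>, where that weight is much smaller than at the base point. There the
  dissipation of \<open>W\<close> alone is large enough to control the gradient of \<open>U\<close> in the power \<open>p\<close> instead of \<open>2\<close> (\<open>large_le\<close>). Homogeneity then requires
  the weight \<open>t powr (2 / p)\<close>, that is, the power \<open>1 / p\<close> of the Laplacian, and the integral of \<open>|t * dV/dt| powr q\<close> against \<open>dt / t\<close> on the
  dual side; the latter is bounded by interpolation between \<open>L2\<close> and \<open>Linf\<close> (\<open>interpolation_L2_Linf\<close>). On the other edges the Cauchy-Schwarz inequality suffices for
  \<open>t \<le> 1\<close>, and for \<open>t \<ge> 1\<close> the spectral gap does; the decay rate in \<open>Lq\<close> is only of size \<open>p - 1\<close>, which produces the factor \<open>1 / (p - 1) ^ 2\<close>.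
\<close>

section \<open>Fourier analysis on the cube\<close>

text \<open>
  The operators and the gradient have real coefficients, so everything is done for
  finite families of real functions with the Euclidean norm in the family index; a complex function
  is the family of its real and imaginary parts.
\<close>
definition real_walsh :: "nat set \<Rightarrow> (nat \<Rightarrow> real) \<Rightarrow> real" where
  "real_walsh A x = (\<Prod>j\<in>A. x j)"

definition mean :: "nat \<Rightarrow> ((nat \<Rightarrow> real) \<Rightarrow> real) \<Rightarrow> real" where
  "mean n f = (\<Sum>x\<in>cube n. f x) / 2 ^ n"

definition walsh_coeff :: "nat \<Rightarrow> ((nat \<Rightarrow> real) \<Rightarrow> real) \<Rightarrow> nat set \<Rightarrow> real" where
  "walsh_coeff n f A = mean n (\<lambda>x. f x * real_walsh A x)"

definition multiplier :: "nat \<Rightarrow> (nat \<Rightarrow> real) \<Rightarrow> ((nat \<Rightarrow> real) \<Rightarrow> real) \<Rightarrow> (nat \<Rightarrow> real) \<Rightarrow> real" where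
  "multiplier n m f x = (\<Sum>A\<in>Pow {1..n}. m (card A) * walsh_coeff n f A * real_walsh A x)"

definition walsh_kernel :: "nat \<Rightarrow> (nat \<Rightarrow> real) \<Rightarrow> (nat \<Rightarrow> real) \<Rightarrow> (nat \<Rightarrow> real) \<Rightarrow> real" where
  "walsh_kernel n m x y = (\<Sum>A\<in>Pow {1..n}. m (card A) * real_walsh A x * real_walsh A y) / 2 ^ n"

definition half_diff :: "nat \<Rightarrow> ((nat \<Rightarrow> real) \<Rightarrow> real) \<Rightarrow> (nat \<Rightarrow> real) \<Rightarrow> real" where
  "half_diff j f x = (f x - f (flip j x)) / 2"

lemma finite_cube [simp]: "finite (cube n)"
  by (auto simp: cube_def intro!: finite_PiE)

lemma card_cube: "card (cube n) = 2 ^ n"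
  by (simp add: cube_def card_PiE numeral_2_eq_2)

lemma cube_values: "x \<in> cube n \<Longrightarrow> j \<in> {1..n} \<Longrightarrow> x j = 1 \<or> x j = -1"
  by (auto simp: cube_def PiE_def Pi_def)

lemma flip_in_cube: "x \<in> cube n \<Longrightarrow> j \<in> {1..n} \<Longrightarrow> flip j x \<in> cube n"
  by (force simp: cube_def flip_def PiE_def Pi_def extensional_def)

lemma flip_flip [simp]: "flip j (flip j x) = x"
  by (auto simp: flip_def)

lemma sum_flip:
  assumes "j \<in> {1..n}"
  shows "(\<Sum>x\<in>cube n. f (flip j x)) = (\<Sum>x\<in>cube n. f x)"
  by (rule sum.reindex_bij_witness[of _ "flip j" "flip j"]) (use assms flip_in_cube in auto)

lemma mean_flip: "j \<in> {1..n} \<Longrightarrow> mean n (\<lambda>x. f (flip j x)) = mean n f"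
  by (simp add: mean_def sum_flip)

lemma mean_add: "mean n (\<lambda>x. f x + g x) = mean n f + mean n g"
  by (simp add: mean_def sum.distrib add_divide_distrib)

lemma mean_diff: "mean n (\<lambda>x. f x - g x) = mean n f - mean n g"
  by (simp add: mean_def sum_subtractf diff_divide_distrib)

lemma mean_cmult: "mean n (\<lambda>x. c * f x) = c * mean n f"
  by (simp add: mean_def sum_distrib_left)

lemma mean_sum: "mean n (\<lambda>x. \<Sum>i\<in>I. f i x) = (\<Sum>i\<in>I. mean n (f i))"
  unfolding mean_def by (subst sum.swap) (simp add: sum_divide_distrib)

lemma mean_const: "mean n (\<lambda>x. c) = c"
  by (simp add: mean_def card_cube)

lemma mean_cong: "(\<And>x. x \<in> cube n \<Longrightarrow> f x = g x) \<Longrightarrow> mean n f = mean n g"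
  by (simp add: mean_def)

lemma mean_mono: "(\<And>x. x \<in> cube n \<Longrightarrow> f x \<le> g x) \<Longrightarrow> mean n f \<le> mean n g"
  by (simp add: mean_def divide_right_mono sum_mono)

lemma mean_nonneg: "(\<And>x. x \<in> cube n \<Longrightarrow> 0 \<le> f x) \<Longrightarrow> 0 \<le> mean n f"
  by (simp add: mean_def sum_nonneg)

lemma walsh_flip:
  assumes "finite A"
  shows "real_walsh A (flip j x) = (if j \<in> A then - real_walsh A x else real_walsh A x)"
proof (cases "j \<in> A")
  case True
  then show ?thesis using assms
    by (simp add: real_walsh_def prod.remove[OF assms True] flip_def)
next
  case False
  then show ?thesis
    by (auto simp: real_walsh_def flip_def intro!: prod.cong)
qed

lemma half_diff_walsh:
  "finite A \<Longrightarrow> half_diff j (real_walsh A) x = (if j \<in> A then real_walsh A x else 0)"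
  by (simp add: half_diff_def walsh_flip)

lemma walsh_square:
  assumes "A \<subseteq> {1..n}" "x \<in> cube n"
  shows "real_walsh A x * real_walsh A x = 1"
proof -
  have "x j * x j = 1" if "j \<in> A" for j
  proof -
    have "x j = 1 \<or> x j = -1" using cube_values[of x n j] that assms by blast
    then show ?thesis by auto
  qed
  then show ?thesis by (simp add: real_walsh_def flip: prod.distrib)
qed

lemma walsh_orthogonal:
  assumes "A \<subseteq> {1..n}" "B \<subseteq> {1..n}"
  shows "mean n (\<lambda>x. real_walsh A x * real_walsh B x) = (if A = B then 1 else 0)"
proof (cases "A = B")
  case True
  have "mean n (\<lambda>x. real_walsh A x * real_walsh B x) = mean n (\<lambda>x. 1)"
    using True assms by (intro mean_cong) (simp add: walsh_square)
  then show ?thesis using True by (simp add: mean_const)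
next
  case False
  have fin: "finite A" "finite B" using assms finite_subset by auto
  from False obtain j where j: "j \<in> A \<longleftrightarrow> j \<notin> B" by blast
  then have jn: "j \<in> {1..n}" using assms by auto
  have "mean n (\<lambda>x. real_walsh A x * real_walsh B x)
      = mean n (\<lambda>x. real_walsh A (flip j x) * real_walsh B (flip j x))"
    using mean_flip[OF jn, of "\<lambda>x. real_walsh A x * real_walsh B x"] by simp
  also have "\<dots> = mean n (\<lambda>x. (-1) * (real_walsh A x * real_walsh B x))"
    using j fin by (intro mean_cong) (auto simp: walsh_flip)
  also have "\<dots> = - mean n (\<lambda>x. real_walsh A x * real_walsh B x)"
    by (subst mean_cmult) simp
  finally show ?thesis using False by simp
qed

text \<open>
  The symbol \<open>r ^ k\<close> is the noise operator, and its kernel is a product over the coordinates. This is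
  where positivity comes from: all factors are nonnegative for \<open>0 \<le> r \<le> 1\<close>.
\<close>
lemma kernel_geometric:
  "walsh_kernel n (\<lambda>k. r ^ k) x y = (\<Prod>j\<in>{1..n}. (1 + r * x j * y j) / 2)"
proof -
  have "(\<Sum>A\<in>Pow {1..n}. r ^ card A * real_walsh A x * real_walsh A y) =
        (\<Sum>A\<in>Pow {1..n}. (\<Prod>j\<in>A. r * x j * y j) * (\<Prod>j\<in>{1..n}-A. 1))"
    by (intro sum.cong refl) (simp add: real_walsh_def prod.distrib)
  also have "\<dots> = (\<Prod>j\<in>{1..n}. r * x j * y j + 1)"
    by (rule prod_add[symmetric]) simp
  finally show ?thesis
    by (simp add: walsh_kernel_def prod_dividef add.commute)
qed

lemma kernel_one:
  assumes "x \<in> cube n" "y \<in> cube n"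
  shows "walsh_kernel n (\<lambda>k. 1) x y = (if x = y then 1 else 0)"
proof -
  have k: "walsh_kernel n (\<lambda>k. 1) x y = (\<Prod>j\<in>{1..n}. (1 + x j * y j) / 2)"
    using kernel_geometric[of n 1 x y] by simp
  show ?thesis
  proof (cases "x = y")
    case True
    have "(1 + x j * y j) / 2 = 1" if "j \<in> {1..n}" for j
      using cube_values[OF assms(1) that] True by auto
    then show ?thesis using True k by simp
  next
    case False
    then obtain j where j: "j \<in> {1..n}" "x j \<noteq> y j"
      using assms unfolding cube_def by (metis PiE_ext)
    then have "(1 + x j * y j) / 2 = 0"
      using cube_values[OF assms(1) j(1)] cube_values[OF assms(2) j(1)] by auto
    then show ?thesis using False k j(1) by (auto intro!: prod_zero)
  qed
qed

lemma multiplier_kernel: "multiplier n m f x = (\<Sum>y\<in>cube n. walsh_kernel n m x y * f y)"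
proof -
  have "(\<Sum>y\<in>cube n. walsh_kernel n m x y * f y) =
    (\<Sum>y\<in>cube n. \<Sum>A\<in>Pow {1..n}. m (card A) * real_walsh A x * real_walsh A y * f y / 2^n)"
    by (simp add: walsh_kernel_def sum_distrib_right sum_divide_distrib)
  also have "\<dots> = (\<Sum>A\<in>Pow {1..n}. \<Sum>y\<in>cube n. m (card A) * real_walsh A x * real_walsh A y * f y / 2^n)"
    by (rule sum.swap)
  also have "\<dots> = multiplier n m f x"
    unfolding multiplier_def walsh_coeff_def mean_def
    by (intro sum.cong refl) (simp add: sum_distrib_left sum_distrib_right sum_divide_distrib mult_ac)
  finally show ?thesis ..
qed

text \<open>
  Fourier inversion: the kernel of the symbol \<open>1\<close> is the identity matrix.
\<close>
lemma walsh_expansion: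
  assumes "x \<in> cube n"
  shows "(\<Sum>A\<in>Pow {1..n}. walsh_coeff n f A * real_walsh A x) = f x"
proof -
  have "(\<Sum>A\<in>Pow {1..n}. walsh_coeff n f A * real_walsh A x) = multiplier n (\<lambda>k. 1) f x"
    by (simp add: multiplier_def)
  also have "\<dots> = (\<Sum>y\<in>cube n. if x = y then f y else 0)"
    unfolding multiplier_kernel using assms by (intro sum.cong refl) (simp add: kernel_one)
  finally show ?thesis using assms by simp
qed

lemma walsh_coeff_multiplier:
  assumes "A \<subseteq> {1..n}"
  shows "walsh_coeff n (multiplier n m f) A = m (card A) * walsh_coeff n f A"
proof -
  have "walsh_coeff n (multiplier n m f) A =
    mean n (\<lambda>x. \<Sum>B\<in>Pow {1..n}. m (card B) * walsh_coeff n f B * (real_walsh B x * real_walsh A x))"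
    unfolding walsh_coeff_def[of n "multiplier n m f"] multiplier_def
    by (simp only: sum_distrib_right mult.assoc)
  also have "\<dots> = (\<Sum>B\<in>Pow {1..n}. m (card B) * walsh_coeff n f B * (if B = A then 1 else 0))"
    unfolding mean_sum mean_cmult using assms by (intro sum.cong refl) (simp add: walsh_orthogonal)
  also have "\<dots> = (\<Sum>B\<in>Pow {1..n}. if B = A then m (card B) * walsh_coeff n f B else 0)"
    by (intro sum.cong refl) simp
  also have "\<dots> = m (card A) * walsh_coeff n f A"
    using assms by (subst sum.delta) auto
  finally show ?thesis .
qed

lemma parseval: "mean n (\<lambda>x. f x * g x) = (\<Sum>A\<in>Pow {1..n}. walsh_coeff n f A * walsh_coeff n g A)"
proof -
  have "mean n (\<lambda>x. f x * g x) =
    mean n (\<lambda>x. (\<Sum>A\<in>Pow {1..n}. walsh_coeff n f A * real_walsh A x) * g x)"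
    by (intro mean_cong) (simp only: walsh_expansion)
  also have "\<dots> = mean n (\<lambda>x. \<Sum>A\<in>Pow {1..n}. walsh_coeff n f A * (g x * real_walsh A x))"
    by (intro mean_cong) (simp add: sum_distrib_left sum_distrib_right mult_ac)
  also have "\<dots> = (\<Sum>A\<in>Pow {1..n}. walsh_coeff n f A * walsh_coeff n g A)"
    by (simp add: mean_sum mean_cmult walsh_coeff_def)
  finally show ?thesis .
qed

lemma walsh_coeff_half_diff:
  assumes "A \<subseteq> {1..n}" "j \<in> {1..n}"
  shows "walsh_coeff n (half_diff j f) A = (if j \<in> A then walsh_coeff n f A else 0)"
proof -
  have fin: "finite A" using assms finite_subset by auto
  have *: "mean n (\<lambda>x. f (flip j x) * real_walsh A x) = mean n (\<lambda>x. f x * real_walsh A (flip j x))"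
    using mean_flip[OF assms(2), of "\<lambda>x. f (flip j x) * real_walsh A x"] by simp
  have "walsh_coeff n (half_diff j f) A = mean n (\<lambda>x. (1/2) * (f x * real_walsh A x - f (flip j x) * real_walsh A x))"
    unfolding walsh_coeff_def half_diff_def by (intro mean_cong) (simp add: field_simps)
  also have "\<dots> = (1/2) * (walsh_coeff n f A - mean n (\<lambda>x. f x * real_walsh A (flip j x)))"
    unfolding mean_cmult mean_diff by (simp add: * walsh_coeff_def)
  also have "mean n (\<lambda>x. f x * real_walsh A (flip j x)) = (if j \<in> A then - walsh_coeff n f A else walsh_coeff n f A)"
    using fin mean_cmult[of n "-1" "\<lambda>x. f x * real_walsh A x"] by (simp add: walsh_flip walsh_coeff_def)
  finally show ?thesis by (simp split: if_splits)
qed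

lemma multiplier_add: "multiplier n m (\<lambda>x. f x + g x) x = multiplier n m f x + multiplier n m g x"
  by (simp add: multiplier_kernel algebra_simps sum.distrib)

lemma multiplier_diff: "multiplier n m (\<lambda>x. f x - g x) x = multiplier n m f x - multiplier n m g x"
  by (simp add: multiplier_kernel algebra_simps sum_subtractf)

text \<open>
  The Laplacian multiplies \<open>walsh A\<close> by \<open>card A\<close>, because exactly the indices in \<open>A\<close> contribute.
\<close>
lemma sum_half_diff_multiplier:
  assumes "x \<in> cube n"
  shows "(\<Sum>j=1..n. half_diff j (multiplier n m f) x) = multiplier n (\<lambda>k. real k * m k) f x"
proof -
  have 1: "half_diff j (multiplier n m f) x =
     (\<Sum>A\<in>Pow {1..n}. m (card A) * walsh_coeff n f A * (if j \<in> A then real_walsh A x else 0))" for j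
  proof -
    have "half_diff j (multiplier n m f) x = (\<Sum>A\<in>Pow {1..n}. m (card A) * walsh_coeff n f A * half_diff j (real_walsh A) x)"
      by (simp add: half_diff_def multiplier_def sum_divide_distrib algebra_simps flip: sum_subtractf)
    also have "\<dots> = (\<Sum>A\<in>Pow {1..n}. m (card A) * walsh_coeff n f A * (if j \<in> A then real_walsh A x else 0))"
      by (intro sum.cong refl, subst half_diff_walsh) (auto intro: finite_subset)
    finally show ?thesis .
  qed
  have "(\<Sum>j=1..n. half_diff j (multiplier n m f) x) =
     (\<Sum>A\<in>Pow {1..n}. \<Sum>j=1..n. m (card A) * walsh_coeff n f A * (if j \<in> A then real_walsh A x else 0))"
    unfolding 1 by (rule sum.swap)
  also have "\<dots> = (\<Sum>A\<in>Pow {1..n}. real (card A) * m (card A) * walsh_coeff n f A * real_walsh A x)"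
  proof (intro sum.cong refl)
    fix A assume A: "A \<in> Pow {1..n}"
    have "(\<Sum>j=1..n. if j \<in> A then real_walsh A x else 0) = (\<Sum>j\<in>{1..n} \<inter> A. real_walsh A x)"
      by (rule sum.inter_restrict[symmetric]) simp
    also have "{1..n} \<inter> A = A" using A by auto
    finally show "(\<Sum>j=1..n. m (card A) * walsh_coeff n f A * (if j \<in> A then real_walsh A x else 0)) =
      real (card A) * m (card A) * walsh_coeff n f A * real_walsh A x"
      by (simp flip: sum_distrib_left)
  qed
  finally show ?thesis by (simp add: multiplier_def)
qed

section \<open>The subordination integrals\<close>

text \<open>
  The factor \<open>exp (- r ^ 2)\<close> is, up to normalisation, the density of the one-sided stable law of index \<open>1/2\<close> in
  the variable \<open>r\<close> with \<open>s = t ^ 2 / (4 * r ^ 2)\<close>. For \<open>b = t * sqrt k / 2\<close> the other factor is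
  \<open>exp (- s * k)\<close>, the symbol of the heat semigroup at time \<open>s\<close>.
\<close>
definition sub_density :: "real \<Rightarrow> real \<Rightarrow> real" where
  "sub_density b r = exp (- r\<^sup>2 - b\<^sup>2 / r\<^sup>2)"

lemma sub_density_pos: "0 < sub_density b r"
  by (simp add: sub_density_def)

lemma gauss_line:
  "(\<lambda>y::real. exp (- y\<^sup>2)) absolutely_integrable_on UNIV"
  "integral UNIV (\<lambda>y::real. exp (- y\<^sup>2)) = sqrt pi"
  "(\<lambda>y::real. exp (- y\<^sup>2) * y\<^sup>2) absolutely_integrable_on UNIV"
  "integral UNIV (\<lambda>y::real. exp (- y\<^sup>2) * y\<^sup>2) = sqrt pi / 2"
proof -
  have 1: "has_bochner_integral lborel (\<lambda>x::real. exp (- x\<^sup>2)) (sqrt pi)"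
    using has_bochner_integral_even_function[OF gaussian_moment_0] by simp
  have 2: "has_bochner_integral lborel (\<lambda>x::real. exp (- x\<^sup>2) * x\<^sup>2) (sqrt pi / 2)"
    using has_bochner_integral_even_function[OF gaussian_moment_even_pos[where k=1]]
    by (simp add: fact_numeral)
  show "(\<lambda>y::real. exp (- y\<^sup>2)) absolutely_integrable_on UNIV"
    "(\<lambda>y::real. exp (- y\<^sup>2) * y\<^sup>2) absolutely_integrable_on UNIV"
    unfolding set_integrable_def
    using 1 2 by (auto simp: has_bochner_integral_iff integrable_completion)
  show "integral UNIV (\<lambda>y::real. exp (- y\<^sup>2)) = sqrt pi"
    using has_integral_integral_lborel[of "\<lambda>x::real. exp (- x\<^sup>2)"] 1
    by (auto simp: has_bochner_integral_iff intro!: integral_unique)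
  show "integral UNIV (\<lambda>y::real. exp (- y\<^sup>2) * y\<^sup>2) = sqrt pi / 2"
    using has_integral_integral_lborel[of "\<lambda>x::real. exp (- x\<^sup>2) * x\<^sup>2"] 2
    by (simp only: has_bochner_integral_iff) (rule integral_unique, simp)
qed

text \<open>
  The map \<open>r \<mapsto> r - b / r\<close> is a bijection from the positive half-line to the line. Together with the involution
  \<open>r \<mapsto> b / r\<close> it reduces the two integrals of \<open>sub_density\<close> below to Gaussian moments.
\<close>
lemma substitution_difference:
  fixes b :: real and f :: "real \<Rightarrow> real"
  assumes b: "b > 0" and f: "f absolutely_integrable_on UNIV"
  shows "(\<lambda>r. (1 + b / r\<^sup>2) * f (r - b / r)) absolutely_integrable_on {0<..}"
    and "integral {0<..} (\<lambda>r. (1 + b / r\<^sup>2) * f (r - b / r)) = integral UNIV f"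
proof -
  let ?g = "\<lambda>r. r - b / r"
  have inj: "inj_on ?g {0<..}"
  proof (rule inj_onI)
    fix x y assume xy: "x \<in> {0<..}" "y \<in> {0<..}" "?g x = ?g y"
    then have "(x - y) * (1 + b / (x * y)) = 0" by (simp add: field_simps)
    moreover have "1 + b / (x * y) > 0" using xy b by (simp add: add_pos_pos)
    ultimately show "x = y" by simp
  qed
  have im: "?g ` {0<..} = UNIV"
  proof -
    have "y \<in> ?g ` {0<..}" for y
    proof
      let ?x = "(y + sqrt (y\<^sup>2 + 4 * b)) / 2"
      have "\<bar>y\<bar> < sqrt (y\<^sup>2 + 4 * b)"
        using b by (intro real_less_rsqrt) auto
      then show pos: "?x \<in> {0<..}" by auto
      have "sqrt (y\<^sup>2 + 4 * b) ^ 2 = y\<^sup>2 + 4 * b" using b by (simp add: add_nonneg_nonneg)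
      then have "?x * ?x - b = y * ?x" by (simp add: field_simps power2_eq_square)
      then show "y = ?g ?x" using pos by (simp add: field_simps del: divide_const_simps)
    qed
    then show ?thesis by auto
  qed
  have der: "(?g has_field_derivative (1 + b / x\<^sup>2)) (at x within {0<..})" if "x \<in> {0<..}" for x
    using that by (auto intro!: derivative_eq_intros simp: power2_eq_square)
  have abs: "\<bar>1 + b / r\<^sup>2\<bar> = 1 + b / r\<^sup>2" for r using b by (simp add: add_nonneg_nonneg)
  show "(\<lambda>r. (1 + b / r\<^sup>2) * f (r - b / r)) absolutely_integrable_on {0<..}"
    and "integral {0<..} (\<lambda>r. (1 + b / r\<^sup>2) * f (r - b / r)) = integral UNIV f"
    using has_absolute_integral_change_of_variables_1'[OF _ der inj, of f "integral UNIV f"] f im abs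
    by auto
qed

lemma substitution_inverse:
  fixes b :: real and f :: "real \<Rightarrow> real"
  assumes b: "b > 0" and f: "f absolutely_integrable_on {0<..}"
  shows "(\<lambda>r. b / r\<^sup>2 * f (b / r)) absolutely_integrable_on {0<..}"
    and "integral {0<..} (\<lambda>r. b / r\<^sup>2 * f (b / r)) = integral {0<..} f"
proof -
  let ?g = "\<lambda>r. b / r"
  have inj: "inj_on ?g {0<..}" using b by (auto intro!: inj_onI)
  have im: "?g ` {0<..} = {0<..}"
  proof -
    have "y \<in> ?g ` {0<..}" if "y > 0" for y
      using that b by (intro image_eqI[of _ _ "b / y"]) auto
    then show ?thesis using b by auto
  qed
  have der: "(?g has_field_derivative (- (b / x\<^sup>2))) (at x within {0<..})" if "x \<in> {0<..}" for x
    using that by (auto intro!: derivative_eq_intros simp: power2_eq_square)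
  have abs: "\<bar>- (b / r\<^sup>2)\<bar> = b / r\<^sup>2" for r using b by simp
  show "(\<lambda>r. b / r\<^sup>2 * f (b / r)) absolutely_integrable_on {0<..}"
    and "integral {0<..} (\<lambda>r. b / r\<^sup>2 * f (b / r)) = integral {0<..} f"
    using has_absolute_integral_change_of_variables_1'[OF _ der inj, of f "integral {0<..} f"] f
    unfolding im abs by auto
qed

lemma abs_int_restrict: "f absolutely_integrable_on UNIV \<Longrightarrow> f absolutely_integrable_on {0<..}" for f :: "real \<Rightarrow> real"
  by (rule set_integrable_subset) auto

lemma abs_int_has_integral:
  "f absolutely_integrable_on S \<Longrightarrow> integral S f = c \<Longrightarrow> (f has_integral c) S" for f :: "real \<Rightarrow> real"
  using set_lebesgue_integral_eq_integral(1) integrable_integral by blast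

lemma sub_density_le: "sub_density b r \<le> exp (- r\<^sup>2)"
  by (simp add: sub_density_def)

lemma sub_density_integrable:
  "sub_density b absolutely_integrable_on {0<..}"
  "(\<lambda>r. r\<^sup>2 * sub_density b r) absolutely_integrable_on {0<..}"
proof -
  have m: "sub_density b \<in> borel_measurable borel" "(\<lambda>r. r\<^sup>2 * sub_density b r) \<in> borel_measurable borel"
    unfolding sub_density_def by measurable
  have m': "sub_density b \<in> borel_measurable (lebesgue_on {0<..})" "(\<lambda>r. r\<^sup>2 * sub_density b r) \<in> borel_measurable (lebesgue_on {0<..})"
    using m by (auto intro!: measurable_restrict_space1 measurable_completion)
  have S: "{0<..} \<in> sets (lebesgue :: real measure)" by auto
  show "sub_density b absolutely_integrable_on {0<..}"
  proof (rule measurable_bounded_by_integrable_imp_absolutely_integrable[OF m'(1) S])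
    show "(\<lambda>y::real. exp (- y\<^sup>2)) integrable_on {0<..}"
      using abs_int_restrict[OF gauss_line(1)] by (rule set_lebesgue_integral_eq_integral)
    show "norm (sub_density b r) \<le> exp (- r\<^sup>2)" for r
      using sub_density_le[of b r] sub_density_pos[of b r] by simp
  qed
  show "(\<lambda>r. r\<^sup>2 * sub_density b r) absolutely_integrable_on {0<..}"
  proof (rule measurable_bounded_by_integrable_imp_absolutely_integrable[OF m'(2) S])
    show "(\<lambda>y::real. exp (- y\<^sup>2) * y\<^sup>2) integrable_on {0<..}"
      using abs_int_restrict[OF gauss_line(3)] by (rule set_lebesgue_integral_eq_integral)
    show "norm (r\<^sup>2 * sub_density b r) \<le> exp (- r\<^sup>2) * r\<^sup>2" for r
      using mult_right_mono[OF sub_density_le[of b r], of "r\<^sup>2"] sub_density_pos[of b r] by (simp add: mult.commute)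
  qed
qed

lemma sub_density_mult:
  assumes "r > 0" "b \<ge> 0"
  shows "exp (- (r - b / r)\<^sup>2) = exp (2 * b) * sub_density b r"
proof -
  have "- (r - b / r)\<^sup>2 = 2 * b + (- r\<^sup>2 - b\<^sup>2 / r\<^sup>2)"
    using assms by (simp add: field_simps power2_eq_square)
  then show ?thesis by (simp add: sub_density_def flip: exp_add)
qed

lemma sub_density_inverse:
  assumes "r > 0" "b > 0"
  shows "sub_density b (b / r) = sub_density b r"
  using assms by (simp add: sub_density_def power_divide algebra_simps)

text \<open>
  Since \<open>exp (- (r - b / r) ^ 2) = exp (2 * b) * sub_density b r\<close>, substituting \<open>r - b / r\<close> in the zeroth and the second
  Gaussian moment gives two linear relations; the terms with negative powers of \<open>r\<close> are turned into terms
  with positive powers by the involution, under which \<open>sub_density b\<close> is invariant. The case \<open>b = 0\<close> is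
  Gaussian already.
\<close>
lemma integral_sub_density:
  assumes b0: "b \<ge> 0"
  shows "integral {0<..} (sub_density b) = sqrt pi / 2 * exp (- 2 * b)" (is ?A)
    and "integral {0<..} (\<lambda>r. (2 * r\<^sup>2 - 1) * sub_density b r) = sqrt pi / 2 * (2 * b * exp (- 2 * b))" (is ?B)
proof -
  let ?E = "sub_density b" and ?I = "integral {0<..} (sub_density b)"
    and ?R = "integral {0<..} (\<lambda>r. r\<^sup>2 * sub_density b r)"
  note integrable = set_lebesgue_integral_eq_integral(1)
  note E = integrable[OF sub_density_integrable(1)[of b]] integrable[OF sub_density_integrable(2)[of b]]
  have "?A \<and> ?R = (1/2 + b) * ?I"
  proof (cases "b = 0")
    case True
    have e: "?E r = exp (- r\<^sup>2)" for r using True by (simp add: sub_density_def)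
    have half: "integral {0<..} f = c"
      if "has_bochner_integral lborel (\<lambda>x. indicator {0..} x *\<^sub>R f x) c" for f :: "real \<Rightarrow> real" and c
    proof -
      have "((\<lambda>x. indicator {0..} x *\<^sub>R f x) has_integral c) UNIV"
        using has_integral_integral_lborel that by (auto simp: has_bochner_integral_iff)
      moreover have "(\<lambda>x. indicator {0..} x *\<^sub>R f x) = (\<lambda>x. if x \<in> {0..} then f x else 0)"
        by (auto simp: indicator_def)
      ultimately have "(f has_integral c) {0..}"
        by (simp only: has_integral_restrict_UNIV)
      moreover have "negligible {x \<in> {0..} - {0<..}. f x \<noteq> 0}"
        by (rule negligible_subset[of "{0}"]) auto
      moreover have "negligible {x \<in> {0<..} - {0..}. f x \<noteq> 0}"
        by (rule negligible_subset[of "{0}"]) auto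
      ultimately have "(f has_integral c) {0<..}"
        using has_integral_spike_set_eq by blast
      then show ?thesis by (rule integral_unique)
    qed
    have "?I = sqrt pi / 2" unfolding e
      using gaussian_moment_0 by (rule half)
    moreover have "?R = sqrt pi / 4" unfolding e mult.commute[of "_\<^sup>2"]
      using gaussian_moment_even_pos[where k=1] by (intro half) (simp add: fact_numeral)
    ultimately show ?thesis using True by simp
  next
    case False
    then have b: "b > 0" using b0 by simp
    have E': "((\<lambda>r. b / r\<^sup>2 * ?E r) has_integral ?I) {0<..}"
    proof -
      have "((\<lambda>r. b / r\<^sup>2 * ?E (b / r)) has_integral ?I) {0<..}"
        by (rule abs_int_has_integral[OF substitution_inverse[OF b sub_density_integrable(1)]])
      then show ?thesis
        by (rule has_integral_eq[rotated]) (simp add: sub_density_inverse b)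
    qed
    have R': "((\<lambda>r. b ^ 3 / r ^ 4 * ?E r) has_integral ?R) {0<..}"
    proof -
      have "((\<lambda>r. b / r\<^sup>2 * ((b / r)\<^sup>2 * ?E (b / r))) has_integral ?R) {0<..}"
        by (rule abs_int_has_integral[OF substitution_inverse[OF b sub_density_integrable(2)]])
      then show ?thesis
        by (rule has_integral_eq[rotated]) (simp add: sub_density_inverse b power_divide power2_eq_square power3_eq_cube power4_eq_xxxx)
    qed
    have I0: "(?E has_integral ?I) {0<..}" "((\<lambda>r. r\<^sup>2 * ?E r) has_integral ?R) {0<..}"
      using E by (auto intro: integrable_integral)
    have "((\<lambda>r. (1 + b / r\<^sup>2) * exp (- (r - b / r)\<^sup>2)) has_integral sqrt pi) {0<..}"
      using substitution_difference[OF b gauss_line(1)] gauss_line(2) by (intro abs_int_has_integral) simp_all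
    then have "((\<lambda>r. exp (2 * b) * ?E r + exp (2 * b) * (b / r\<^sup>2 * ?E r)) has_integral sqrt pi) {0<..}"
      by (rule has_integral_eq[rotated]) (use b in \<open>simp add: sub_density_mult algebra_simps\<close>)
    moreover have "((\<lambda>r. exp (2 * b) * ?E r + exp (2 * b) * (b / r\<^sup>2 * ?E r)) has_integral
       (exp (2 * b) * ?I + exp (2 * b) * ?I)) {0<..}"
      by (intro has_integral_add has_integral_mult_right I0 E')
    ultimately have "sqrt pi = exp (2 * b) * ?I + exp (2 * b) * ?I" by (rule has_integral_unique)
    then have *: "2 * exp (2 * b) * ?I = sqrt pi" by simp
    have "((\<lambda>r. (1 + b / r\<^sup>2) * (exp (- (r - b / r)\<^sup>2) * (r - b / r)\<^sup>2)) has_integral sqrt pi / 2) {0<..}"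
      using substitution_difference[OF b gauss_line(3)] gauss_line(4) by (intro abs_int_has_integral) simp_all
    then have "((\<lambda>r. exp (2 * b) * (r\<^sup>2 * ?E r) + exp (2 * b) * (b ^ 3 / r ^ 4 * ?E r)
         - exp (2 * b) * b * ?E r - exp (2 * b) * b * (b / r\<^sup>2 * ?E r)) has_integral sqrt pi / 2) {0<..}"
    proof (rule has_integral_eq[rotated])
      fix r :: real assume r: "r \<in> {0<..}"
      have "(1 + b / r\<^sup>2) * (r - b / r)\<^sup>2 = r\<^sup>2 + b ^ 3 / r ^ 4 - b - b * (b / r\<^sup>2)"
        using r by (simp add: divide_simps) (simp add: algebra_simps eval_nat_numeral)
      then have "(1 + b / r\<^sup>2) * (exp (- (r - b / r)\<^sup>2) * (r - b / r)\<^sup>2) =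
         exp (2 * b) * ?E r * (r\<^sup>2 + b ^ 3 / r ^ 4 - b - b * (b / r\<^sup>2))"
        using r b by (simp only: sub_density_mult greaterThan_iff order.strict_implies_order mult_ac)
      also have "\<dots> = exp (2 * b) * (r\<^sup>2 * ?E r) + exp (2 * b) * (b ^ 3 / r ^ 4 * ?E r)
         - exp (2 * b) * b * ?E r - exp (2 * b) * b * (b / r\<^sup>2 * ?E r)"
        by (simp add: algebra_simps)
      finally show "(1 + b / r\<^sup>2) * (exp (- (r - b / r)\<^sup>2) * (r - b / r)\<^sup>2) =
         exp (2 * b) * (r\<^sup>2 * ?E r) + exp (2 * b) * (b ^ 3 / r ^ 4 * ?E r)
         - exp (2 * b) * b * ?E r - exp (2 * b) * b * (b / r\<^sup>2 * ?E r)" .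
    qed
    moreover have "((\<lambda>r. exp (2 * b) * (r\<^sup>2 * ?E r) + exp (2 * b) * (b ^ 3 / r ^ 4 * ?E r)
         - exp (2 * b) * b * ?E r - exp (2 * b) * b * (b / r\<^sup>2 * ?E r)) has_integral
       (exp (2 * b) * ?R + exp (2 * b) * ?R - exp (2 * b) * b * ?I - exp (2 * b) * b * ?I)) {0<..}"
      by (intro has_integral_add has_integral_diff has_integral_mult_right I0 E' R')
    ultimately have "sqrt pi / 2 = exp (2 * b) * ?R + exp (2 * b) * ?R - exp (2 * b) * b * ?I - exp (2 * b) * b * ?I"
      by (rule has_integral_unique)
    with * have "exp (2 * b) * ?R + exp (2 * b) * ?R - exp (2 * b) * b * ?I - exp (2 * b) * b * ?I = exp (2 * b) * ?I"
      by linarith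
    then have "exp (2 * b) * ?R = exp (2 * b) * ((1/2 + b) * ?I)" by (simp add: algebra_simps)
    then have "?R = (1/2 + b) * ?I" by simp
    moreover have ?A using * by (simp add: exp_minus field_simps)
    ultimately show ?thesis by (rule conjI[rotated])
  qed
  then have H: "?A" "?R = (1/2 + b) * ?I" by auto
  show ?A by (rule H)
  show ?B
  proof -
    have "((\<lambda>r. 2 * (r\<^sup>2 * ?E r) - ?E r) has_integral (2 * ?R - ?I)) {0<..}"
      by (intro has_integral_diff has_integral_mult_right integrable_integral E)
    then have "integral {0<..} (\<lambda>r. (2 * r\<^sup>2 - 1) * ?E r) = 2 * ?R - ?I"
      by (intro integral_unique) (simp add: algebra_simps)
    also have "\<dots> = 2 * b * ?I" using H by (simp add: algebra_simps)
    finally show ?B using H by simp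
  qed
qed

section \<open>The Poisson semigroup on the cube\<close>

text \<open>
  Symbols of the Poisson semigroup \<open>exp (- t * sqrt Delta)\<close> and of minus its derivative in \<open>t\<close>.
\<close>
definition poisson :: "real \<Rightarrow> nat \<Rightarrow> real" where
  "poisson t k = exp (- t * sqrt (real k))"

definition poisson_deriv :: "real \<Rightarrow> nat \<Rightarrow> real" where
  "poisson_deriv t k = sqrt (real k) * exp (- t * sqrt (real k))"

lemma kernel_add: "walsh_kernel n (\<lambda>k. a k + b k) x y = walsh_kernel n a x y + walsh_kernel n b x y"
  by (simp add: walsh_kernel_def algebra_simps sum.distrib add_divide_distrib)

text \<open>
  Subordination: a symbol that is a positive mixture of the geometric symbols \<open>k \<mapsto> d ^ k\<close>, \<open>0 \<le> d \<le> 1\<close>, has a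
  nonnegative kernel.
\<close>
lemma kernel_mixture_nonneg:
  assumes int: "\<And>k. ((\<lambda>r. w r * sub_density (t * sqrt (real k) / 2) r) has_integral m k) {0<..}"
    and w: "\<And>r. r > 0 \<Longrightarrow> 0 \<le> w r"
    and xy: "x \<in> cube n" "y \<in> cube n"
  shows "0 \<le> walsh_kernel n m x y"
proof -
  define d where "d r = exp (- (t\<^sup>2 / 4) / r\<^sup>2)" for r
  have sub: "sub_density (t * sqrt (real k) / 2) r = exp (- r\<^sup>2) * d r ^ k" for k r
    by (simp add: sub_density_def d_def power_mult_distrib power_divide mult_ac flip: exp_of_nat_mult exp_add)
  have "((\<lambda>r. walsh_kernel n (\<lambda>k. w r * sub_density (t * sqrt (real k) / 2) r) x y) has_integral walsh_kernel n m x y) {0<..}"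
    unfolding walsh_kernel_def by (intro has_integral_divide has_integral_sum has_integral_mult_left int) simp
  moreover have "walsh_kernel n (\<lambda>k. w r * sub_density (t * sqrt (real k) / 2) r) x y \<ge> 0" if "r \<in> {0<..}" for r
  proof -
    have "walsh_kernel n (\<lambda>k. w r * sub_density (t * sqrt (real k) / 2) r) x y =
      w r * exp (- r\<^sup>2) * walsh_kernel n (\<lambda>k. d r ^ k) x y"
      unfolding sub walsh_kernel_def by (simp add: sum_distrib_left mult_ac)
    moreover have "walsh_kernel n (\<lambda>k. d r ^ k) x y \<ge> 0"
      unfolding kernel_geometric
    proof (rule prod_nonneg)
      fix j assume j: "j \<in> {1..n}"
      have "d r \<le> 1" "d r \<ge> 0" by (auto simp: d_def)
      then show "0 \<le> (1 + d r * x j * y j) / 2"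
        using cube_values[OF xy(1) j] cube_values[OF xy(2) j] by auto
    qed
    ultimately show ?thesis using w that by simp
  qed
  ultimately show ?thesis by (rule has_integral_nonneg)
qed

lemma sub_density_has_integral:
  assumes "b \<ge> 0"
  shows "((\<lambda>r. 2 / sqrt pi * sub_density b r) has_integral exp (- 2 * b)) {0<..}"
    and "((\<lambda>r. 2 / sqrt pi * (2 * r\<^sup>2) * sub_density b r) has_integral (2 * b * exp (- 2 * b) + exp (- 2 * b))) {0<..}"
proof -
  note I = integral_sub_density[OF assms]
  note E = sub_density_integrable[of b, THEN set_lebesgue_integral_eq_integral(1)]
  have 1: "(sub_density b has_integral (sqrt pi / 2 * exp (- 2 * b))) {0<..}"
    using integrable_integral[OF E(1)] I(1) by simp
  have "((\<lambda>r. 2 * (r\<^sup>2 * sub_density b r) - sub_density b r) has_integral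
     (integral {0<..} (\<lambda>r. 2 * (r\<^sup>2 * sub_density b r) - sub_density b r))) {0<..}"
    by (intro integrable_integral integrable_diff integrable_on_mult_right E)
  then have 2: "((\<lambda>r. (2 * r\<^sup>2 - 1) * sub_density b r) has_integral (sqrt pi / 2 * (2 * b * exp (- 2 * b)))) {0<..}"
    using I(2) by (simp add: algebra_simps)
  show "((\<lambda>r. 2 / sqrt pi * sub_density b r) has_integral exp (- 2 * b)) {0<..}"
    using has_integral_mult_right[OF 1, of "2 / sqrt pi"] by simp
  show "((\<lambda>r. 2 / sqrt pi * (2 * r\<^sup>2) * sub_density b r) has_integral (2 * b * exp (- 2 * b) + exp (- 2 * b))) {0<..}"
    using has_integral_mult_right[OF has_integral_add[OF 2 1], of "2 / sqrt pi"]
    by (simp add: algebra_simps)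
qed

lemma poisson_kernel_nonneg:
  assumes "t \<ge> 0" "x \<in> cube n" "y \<in> cube n"
  shows "0 \<le> walsh_kernel n (poisson t) x y"
proof (rule kernel_mixture_nonneg[where w = "\<lambda>r. 2 / sqrt pi" and t = t])
  show "((\<lambda>r. 2 / sqrt pi * sub_density (t * sqrt (real k) / 2) r) has_integral poisson t k) {0<..}" for k
    using sub_density_has_integral(1)[of "t * sqrt (real k) / 2"] assms by (simp add: poisson_def)
qed (use assms in auto)

text \<open>
  The derivative symbol is the mixture with the signed weight \<open>2 * r ^ 2 - 1\<close>; adding one Poisson symbol
  makes the weight positive.
\<close>
lemma poisson_deriv_kernel_lower:
  assumes "t \<ge> 0" "x \<in> cube n" "y \<in> cube n"
  shows "0 \<le> walsh_kernel n (\<lambda>k. t * poisson_deriv t k + poisson t k) x y"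
proof (rule kernel_mixture_nonneg[where w = "\<lambda>r. 2 / sqrt pi * (2 * r\<^sup>2)" and t = t])
  show "((\<lambda>r. 2 / sqrt pi * (2 * r\<^sup>2) * sub_density (t * sqrt (real k) / 2) r) has_integral t * poisson_deriv t k + poisson t k) {0<..}" for k
    using sub_density_has_integral(2)[of "t * sqrt (real k) / 2"] assms by (simp add: poisson_def poisson_deriv_def mult_ac)
qed (use assms in auto)

lemma mean_multiplier: "mean n (multiplier n m f) = m 0 * mean n f"
  using walsh_coeff_multiplier[of "{}" n m f] by (simp add: walsh_coeff_def real_walsh_def)

lemma walsh_coeff_const: "A \<subseteq> {1..n} \<Longrightarrow> walsh_coeff n (\<lambda>x. c) A = (if A = {} then c else 0)"
  using walsh_orthogonal[of "{}" n A] by (simp add: walsh_coeff_def mean_cmult real_walsh_def)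

lemma multiplier_const: "multiplier n m (\<lambda>x. c) x = m 0 * c"
proof -
  have "multiplier n m (\<lambda>x. c) x = (\<Sum>A\<in>Pow {1..n}. if A = {} then m 0 * c else 0)"
    unfolding multiplier_def by (intro sum.cong refl) (auto simp: walsh_coeff_const real_walsh_def)
  then show ?thesis by (simp add: sum.delta)
qed

lemma sum_kernel: "(\<Sum>y\<in>cube n. walsh_kernel n m x y) = m 0"
  using multiplier_const[of n m 1 x] by (simp add: multiplier_kernel)

lemma poisson_0 [simp]: "poisson t 0 = 1" "poisson_deriv t 0 = 0"
  by (simp_all add: poisson_def poisson_deriv_def)

text \<open>
  By the preceding lemma the negative part of the kernel is at most one Poisson kernel, so its absolute
  value is at most the derivative kernel plus two Poisson kernels, with row sum \<open>0 + 2\<close>.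
\<close>
lemma sum_abs_poisson_deriv_kernel:
  assumes "t \<ge> 0" "x \<in> cube n"
  shows "(\<Sum>y\<in>cube n. \<bar>walsh_kernel n (\<lambda>k. t * poisson_deriv t k) x y\<bar>) \<le> 2"
proof -
  have "(\<Sum>y\<in>cube n. \<bar>walsh_kernel n (\<lambda>k. t * poisson_deriv t k) x y\<bar>) \<le>
     (\<Sum>y\<in>cube n. walsh_kernel n (\<lambda>k. t * poisson_deriv t k) x y + (walsh_kernel n (poisson t) x y + walsh_kernel n (poisson t) x y))"
  proof (rule sum_mono)
    fix y assume "y \<in> cube n"
    then show "\<bar>walsh_kernel n (\<lambda>k. t * poisson_deriv t k) x y\<bar> \<le>
       walsh_kernel n (\<lambda>k. t * poisson_deriv t k) x y + (walsh_kernel n (poisson t) x y + walsh_kernel n (poisson t) x y)"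
      using poisson_deriv_kernel_lower[OF assms, of y] poisson_kernel_nonneg[OF assms, of y]
      unfolding kernel_add by linarith
  qed
  also have "\<dots> = 2" by (simp only: sum.distrib sum_kernel) simp
  finally show ?thesis .
qed

lemma L2_set_sum_le:
  "finite S \<Longrightarrow> L2_set (\<lambda>i. \<Sum>y\<in>S. k y * h i y) I \<le> (\<Sum>y\<in>S. \<bar>k y\<bar> * L2_set (\<lambda>i. h i y) I)"
proof (induction S rule: finite_induct)
  case (insert y S)
  have "L2_set (\<lambda>i. k y * h i y) I = \<bar>k y\<bar> * L2_set (\<lambda>i. h i y) I"
    unfolding L2_set_def by (simp add: power_mult_distrib real_sqrt_mult flip: sum_distrib_left)
  then show ?case using insert L2_set_triangle_ineq[of "\<lambda>i. k y * h i y" "\<lambda>i. \<Sum>y\<in>S. k y * h i y" I] by simp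
qed (simp add: L2_set_def)

lemma poisson_mono:
  assumes "t \<ge> 0" "x \<in> cube n" "\<And>y. y \<in> cube n \<Longrightarrow> f y \<le> g y"
  shows "multiplier n (poisson t) f x \<le> multiplier n (poisson t) g x"
  unfolding multiplier_kernel
  by (intro sum_mono mult_left_mono assms poisson_kernel_nonneg)

lemma poisson_L2_set_le:
  assumes "t \<ge> 0" "x \<in> cube n"
  shows "L2_set (\<lambda>i. multiplier n (poisson t) (h i) x) I \<le> multiplier n (poisson t) (\<lambda>y. L2_set (\<lambda>i. h i y) I) x"
  unfolding multiplier_kernel
  by (rule order.trans[OF L2_set_sum_le]) (use poisson_kernel_nonneg[OF assms] in simp_all)

lemma poisson_deriv_L2_set_le:
  assumes "t \<ge> 0" "x \<in> cube n" and B: "\<And>y. y \<in> cube n \<Longrightarrow> L2_set (\<lambda>i. h i y) I \<le> B"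
  shows "t * L2_set (\<lambda>i. multiplier n (poisson_deriv t) (h i) x) I \<le> 2 * B"
proof -
  have B0: "B \<ge> 0" using B[OF assms(2)] L2_set_nonneg[of "\<lambda>i. h i x" I] by linarith
  have "t * L2_set (\<lambda>i. multiplier n (poisson_deriv t) (h i) x) I =
        L2_set (\<lambda>i. multiplier n (\<lambda>k. t * poisson_deriv t k) (h i) x) I"
    unfolding L2_set_def multiplier_def using assms(1)
    by (simp add: power_mult_distrib real_sqrt_mult mult.assoc flip: sum_distrib_left)
  also have "\<dots> \<le> (\<Sum>y\<in>cube n. \<bar>walsh_kernel n (\<lambda>k. t * poisson_deriv t k) x y\<bar> * L2_set (\<lambda>i. h i y) I)"
    unfolding multiplier_kernel by (rule L2_set_sum_le) simp
  also have "\<dots> \<le> (\<Sum>y\<in>cube n. \<bar>walsh_kernel n (\<lambda>k. t * poisson_deriv t k) x y\<bar> * B)"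
    by (intro sum_mono mult_left_mono B) auto
  also have "\<dots> \<le> 2 * B"
    using mult_right_mono[OF sum_abs_poisson_deriv_kernel[OF assms(1,2)] B0] by (simp add: sum_distrib_right)
  finally show ?thesis .
qed

lemma powr_above_tangent:
  assumes "p \<ge> 1" "w > 0" "y > (0::real)"
  shows "w powr p + p * w powr (p - 1) * (y - w) \<le> y powr p"
proof -
  have "y powr p - w powr p \<ge> (p * w powr (p - 1)) * (y - w)"
    by (rule convex_on_imp_above_tangent[OF powr_convex[OF assms(1)]])
       (use assms in \<open>auto simp: interior_open intro!: derivative_eq_intros\<close>)
  then show ?thesis by simp
qed

lemma powr_below_tangent:
  assumes "0 \<le> a" "a \<le> 1" "w > 0" "y > (0::real)"
  shows "y powr a \<le> w powr a + a * w powr (a - 1) * (y - w)"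
proof -
  have "y powr a * w powr (1 - a) \<le> a * y + (1 - a) * w"
    by (rule Youngs_inequality_0) (use assms in auto)
  then have "y powr a * w powr (1 - a) * w powr (a - 1) \<le> (a * y + (1 - a) * w) * w powr (a - 1)"
    by (rule mult_right_mono) simp
  moreover have "w powr (1 - a) * w powr (a - 1) = 1" "w * w powr (a - 1) = w powr a"
    using assms by (auto simp: powr_mult_base simp flip: powr_add)
  ultimately show ?thesis by (simp add: algebra_simps)
qed

lemma poisson_ge_1:
  assumes "t \<ge> 0" "x \<in> cube n" "\<And>y. y \<in> cube n \<Longrightarrow> 1 \<le> G y"
  shows "1 \<le> multiplier n (poisson t) G x"
  using poisson_mono[of t x n "\<lambda>x. 1" G] assms by (simp add: multiplier_const)

lemma multiplier_cmult: "multiplier n m (\<lambda>x. c * f x) x = c * multiplier n m f x"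
  by (simp add: multiplier_kernel algebra_simps sum_distrib_left)

text \<open>
  Both forms of Jensen's inequality average the tangent line at the mean value; the bound \<open>1 \<le> G\<close> keeps
  that value in the domain where the powers are differentiable.
\<close>
lemma poisson_jensen_concave:
  assumes "t \<ge> 0" "x \<in> cube n" "\<And>y. y \<in> cube n \<Longrightarrow> 1 \<le> G y" "0 \<le> a" "a \<le> 1"
  shows "multiplier n (poisson t) (\<lambda>y. G y powr a) x \<le> multiplier n (poisson t) G x powr a"
proof -
  define w where "w = multiplier n (poisson t) G x"
  have w: "w \<ge> 1" unfolding w_def by (rule poisson_ge_1) (use assms in auto)
  have "multiplier n (poisson t) (\<lambda>y. G y powr a) x \<le>
    multiplier n (poisson t) (\<lambda>y. w powr a + a * w powr (a - 1) * (G y - w)) x"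
    by (intro poisson_mono powr_below_tangent) (use assms w in \<open>force+\<close>)
  also have "\<dots> = w powr a"
    by (simp add: multiplier_add multiplier_diff multiplier_cmult multiplier_const w_def)
  finally show ?thesis by (simp add: w_def)
qed

lemma poisson_jensen_convex:
  assumes "t \<ge> 0" "x \<in> cube n" "\<And>y. y \<in> cube n \<Longrightarrow> 1 \<le> G y" "p \<ge> 1"
  shows "multiplier n (poisson t) G x powr p \<le> multiplier n (poisson t) (\<lambda>y. G y powr p) x"
proof -
  define w where "w = multiplier n (poisson t) G x"
  have w: "w \<ge> 1" unfolding w_def by (rule poisson_ge_1) (use assms in auto)
  have "w powr p = multiplier n (poisson t) (\<lambda>y. w powr p + p * w powr (p - 1) * (G y - w)) x"
    by (simp add: multiplier_add multiplier_diff multiplier_cmult multiplier_const w_def)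
  also have "\<dots> \<le> multiplier n (poisson t) (\<lambda>y. G y powr p) x"
    by (intro poisson_mono powr_above_tangent) (use assms w in \<open>force+\<close>)
  finally show ?thesis by (simp add: w_def)
qed

lemma mean_poisson_powr_le:
  assumes "t \<ge> 0" "\<And>y. y \<in> cube n \<Longrightarrow> 1 \<le> G y" "p \<ge> 1"
  shows "mean n (\<lambda>x. multiplier n (poisson t) G x powr p) \<le> mean n (\<lambda>x. G x powr p)"
proof -
  have "mean n (\<lambda>x. multiplier n (poisson t) G x powr p) \<le> mean n (multiplier n (poisson t) (\<lambda>y. G y powr p))"
    by (intro mean_mono poisson_jensen_convex) (use assms in auto)
  then show ?thesis by (simp add: mean_multiplier)
qed

section \<open>The Bellman function\<close>

text \<open>
  The Bellman function of the pairing, with \<open>a = |u| ^ 2\<close> and \<open>b = |v| ^ 2\<close>. The first two summands produce the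
  two weighted square functions \<open>w powr (p - 2) * |du| ^ 2\<close> and \<open>w powr (2 - p) * |dv| ^ 2\<close>, whose weights cancel in
  the Cauchy-Schwarz inequality. The last summand absorbs the mixed terms; its coefficient
  \<open>10 / (p - 1)\<close> compensates that \<open>w powr p\<close> has second derivative of size \<open>p - 1\<close>.
\<close>
definition bellman :: "real \<Rightarrow> real \<Rightarrow> real \<Rightarrow> real \<Rightarrow> real" where
  "bellman p w a b = w powr (p - 2) * a + w powr (2 - p) * b + 10 / (p - 1) * w powr p"

definition bellman_w :: "real \<Rightarrow> real \<Rightarrow> real \<Rightarrow> real \<Rightarrow> real" where
  "bellman_w p w a b = (p - 2) * w powr (p - 3) * a + (2 - p) * w powr (1 - p) * b
     + 10 / (p - 1) * p * w powr (p - 1)"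

definition bellman_ww :: "real \<Rightarrow> real \<Rightarrow> real \<Rightarrow> real \<Rightarrow> real" where
  "bellman_ww p w a b = (p - 2) * (p - 3) * w powr (p - 4) * a + (2 - p) * (1 - p) * w powr (- p) * b
     + 10 * p * w powr (p - 2)"

lemma has_derivative_bellman:
  assumes "w t > 0"
    and [derivative_intros]: "(w has_field_derivative w') (at t)" "(a has_field_derivative a') (at t)" "(b has_field_derivative b') (at t)"
  shows "((\<lambda>t. bellman p (w t) (a t) (b t)) has_field_derivative
    (bellman_w p (w t) (a t) (b t) * w' + w t powr (p - 2) * a' + w t powr (2 - p) * b')) (at t)"
  unfolding bellman_def bellman_w_def
  by (rule derivative_eq_intros refl assms(1))+ (simp add: algebra_simps)

lemma has_derivative_bellman_w:
  assumes "w t > 0" "p \<noteq> 1"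
    and [derivative_intros]: "(w has_field_derivative w') (at t)" "(a has_field_derivative a') (at t)" "(b has_field_derivative b') (at t)"
  shows "((\<lambda>t. bellman_w p (w t) (a t) (b t)) has_field_derivative
    (bellman_ww p (w t) (a t) (b t) * w' + (p - 2) * w t powr (p - 3) * a' + (2 - p) * w t powr (1 - p) * b')) (at t)"
proof -
  have 1: "10 / (p - 1) * p * ((p - 1) * w t powr (p - 1 - 1) * w') = 10 * p * w t powr (p - 2) * w'"
    using assms(2) by (simp add: field_simps)
  show ?thesis
    unfolding bellman_w_def bellman_ww_def
    by (rule derivative_eq_intros refl assms(1))+
       (use 1 in \<open>simp add: algebra_simps\<close>)
qed

text \<open>
  The quadratic form of the second derivative along a curve \<open>(w, u, v)\<close>, on the region \<open>|u| \<le> w\<close>,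
  \<open>|v| \<le> w powr (p - 1)\<close>. Here \<open>X\<close> and \<open>Y\<close> stand for the inner products of \<open>u\<close> with \<open>du\<close> and of \<open>v\<close> with \<open>dv\<close>, and
  \<open>E\<close>, \<open>F\<close> for \<open>|du| ^ 2\<close>, \<open>|dv| ^ 2\<close>. In the region each mixed term costs one copy of its square term and \<open>4 * w powr (p - 2) * d ^ 2\<close>, and
  the concave contribution of \<open>b\<close> costs at most \<open>w powr (p - 2) * d ^ 2\<close>; the total \<open>9\<close> is below \<open>10\<close>.
\<close>
lemma bellman_hessian:
  assumes p: "1 < p" "p \<le> 2" and w: "w > 0" and A: "0 \<le> a" "a \<le> w\<^sup>2" and B: "0 \<le> b" "b \<le> (w powr (p - 1))\<^sup>2"
    and X: "X\<^sup>2 \<le> a * E" "0 \<le> E" and Y: "Y\<^sup>2 \<le> b * F" "0 \<le> F"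
  shows "w powr (p - 2) * (E + d\<^sup>2) + w powr (2 - p) * F \<le>
    bellman_ww p w a b * d\<^sup>2 + 4 * (p - 2) * w powr (p - 3) * d * X + 4 * (2 - p) * w powr (1 - p) * d * Y
    + 2 * w powr (p - 2) * E + 2 * w powr (2 - p) * F"
proof -
  define c where "c = w powr (p - 2)"
  have c: "c > 0" using w by (simp add: c_def)
  have pw: "w powr (2 - p) = 1 / c" "w powr (p - 3) = c / w" "w powr (1 - p) = 1 / (c * w)"
    "w powr (- p) = 1 / (c * w\<^sup>2)" "w powr (p - 4) = c / w\<^sup>2" "w powr (p - 1) = c * w"
  proof -
    have e: "w powr (x + y) = w powr x * w powr y" for x y by (rule powr_add)
    have n: "w powr (-x) = 1 / w powr x" for x by (simp add: powr_minus_divide)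
    have w1: "w powr 1 = w" "w powr 2 = w\<^sup>2" using w by (simp_all add: powr_numeral)
    show p1: "w powr (p - 1) = c * w" using e[of "p - 2" 1] w1 by (simp add: c_def)
    show "w powr (2 - p) = 1 / c" using n[of "p - 2"] by (simp add: c_def)
    show "w powr (p - 3) = c / w" using e[of "p - 2" "-1"] n[of 1] w1 by (simp add: c_def)
    show "w powr (p - 4) = c / w\<^sup>2" using e[of "p - 2" "-2"] n[of 2] w1 by (simp add: c_def)
    show "w powr (1 - p) = 1 / (c * w)" using n[of "p - 1"] p1 by simp
    have "w powr p = c * w\<^sup>2" using e[of "p - 2" 2] w1 by (simp add: c_def)
    then show "w powr (- p) = 1 / (c * w\<^sup>2)" using n[of p] by simp
  qed
  define x y where "x = X / w" and "y = Y / (c * w)"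
  have x: "x\<^sup>2 \<le> E"
  proof -
    have "X\<^sup>2 \<le> w\<^sup>2 * E" using X A by (meson mult_right_mono order_trans)
    then show ?thesis using w by (simp add: x_def power_divide divide_le_eq mult.commute)
  qed
  have y: "y\<^sup>2 \<le> F"
  proof -
    have "Y\<^sup>2 \<le> (c * w)\<^sup>2 * F" using Y B pw(6) by (metis mult_right_mono order_trans)
    then show ?thesis using w c by (simp add: y_def power_divide divide_le_eq mult.commute)
  qed
  have q: "2 - p \<ge> 0" "2 - p \<le> 1" "p - 1 \<ge> 0" using p by auto
  have q': "(2 - p) * z \<le> \<bar>z\<bar>" for z
  proof -
    have "(2 - p) * z \<le> (2 - p) * \<bar>z\<bar>" by (intro mult_left_mono q) simp
    also have "\<dots> \<le> 1 * \<bar>z\<bar>" by (intro mult_right_mono q) simp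
    finally show ?thesis by simp
  qed
  have t1: "4 * (p - 2) * (c / w) * d * X \<ge> - c * E - 4 * c * d\<^sup>2"
  proof -
    have "4 * (2 - p) * (d * x) \<le> 4 * \<bar>d * x\<bar>"
      using q'[of "d * x"] by linarith
    also have "\<dots> \<le> x\<^sup>2 + 4 * d\<^sup>2"
      using zero_le_power2[of "\<bar>x\<bar> - 2 * \<bar>d\<bar>"] by (simp add: power2_diff abs_mult power_mult_distrib mult_ac)
    also have "\<dots> \<le> E + 4 * d\<^sup>2" using x by simp
    finally have "c * (4 * (2 - p) * (d * x)) \<le> c * (E + 4 * d\<^sup>2)" using c by simp
    then show ?thesis using w by (simp add: x_def algebra_simps)
  qed
  have t2: "4 * (2 - p) * (1 / (c * w)) * d * Y \<ge> - F / c - 4 * c * d\<^sup>2"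
  proof -
    have "4 * (2 - p) * (- (d * y)) \<le> 4 * \<bar>d * y\<bar>"
      using mult_left_mono[OF q'[of "- (d * y)"], of 4] by (simp only: mult.assoc abs_minus_cancel)
    also have "\<dots> \<le> y\<^sup>2 / c + 4 * c * d\<^sup>2"
    proof -
      have "0 \<le> (\<bar>y\<bar> - 2 * c * \<bar>d\<bar>)\<^sup>2 / c" using c by simp
      then show ?thesis using c by (simp add: power2_eq_square field_simps abs_mult)
    qed
    also have "\<dots> \<le> F / c + 4 * c * d\<^sup>2" using y c by (simp add: divide_right_mono)
    finally show ?thesis using w c by (simp add: y_def field_simps)
  qed
  have t3: "(2 - p) * (1 - p) * (1 / (c * w\<^sup>2)) * b * d\<^sup>2 \<ge> - c * d\<^sup>2"
  proof -
    have "(2 - p) * (p - 1) * b \<le> 1 * (c * w)\<^sup>2"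
      using q B pw(6) by (intro mult_mono) (auto simp: mult_le_one)
    then have "(2 - p) * (p - 1) * b / (c * w\<^sup>2) \<le> c"
      using c w by (simp add: divide_le_eq power2_eq_square mult_ac)
    then have "(2 - p) * (p - 1) * b / (c * w\<^sup>2) * d\<^sup>2 \<le> c * d\<^sup>2" by (rule mult_right_mono) simp
    moreover have "(2 - p) * (1 - p) * (1 / (c * w\<^sup>2)) * b * d\<^sup>2 = - ((2 - p) * (p - 1) * b / (c * w\<^sup>2) * d\<^sup>2)"
      using c w by (simp add: field_simps)
    ultimately show ?thesis by simp
  qed
  have t4: "(p - 2) * (p - 3) * (c / w\<^sup>2) * a * d\<^sup>2 \<ge> 0"
  proof -
    have "(p - 2) * (p - 3) \<ge> 0" using p by (intro mult_nonpos_nonpos) auto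
    then show ?thesis using c A by simp
  qed
  have t5: "10 * p * c * d\<^sup>2 \<ge> 10 * c * d\<^sup>2" using p c by (intro mult_right_mono) auto
  have cd: "c * d\<^sup>2 \<ge> 0" using c by simp
  have combine: "e + m + f \<le> (r4 + r3 + r5) + r1 + r2 + 2 * e + 2 * f"
    if "r1 \<ge> - e - 4 * m" "r2 \<ge> - f - 4 * m" "r3 \<ge> - m" "r4 \<ge> 0" "r5 \<ge> 10 * m" "m \<ge> 0" for e m f r1 r2 r3 r4 r5 :: real
    using that by linarith
  have ww: "bellman_ww p w a b * d\<^sup>2 = (p - 2) * (p - 3) * (c / w\<^sup>2) * a * d\<^sup>2
     + (2 - p) * (1 - p) * (1 / (c * w\<^sup>2)) * b * d\<^sup>2 + 10 * p * c * d\<^sup>2"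
    unfolding bellman_ww_def pw c_def[symmetric] by (simp only: distrib_right)
  have lhs: "c * (E + d\<^sup>2) + 1 / c * F = c * E + c * d\<^sup>2 + F / c" and rhs: "2 * c * E = 2 * (c * E)" "2 * (1 / c) * F = 2 * (F / c)"
    by (simp_all add: algebra_simps)
  show ?thesis unfolding pw c_def[symmetric] ww lhs rhs
    by (rule combine) (use t1 t2 t3 t4 t5 cd in \<open>simp_all add: mult.assoc\<close>)
qed

lemma bellman_curve_second:
  assumes p: "1 < p" "p \<le> 2" and w: "w > 0"
    and A: "L2_set u I \<le> w" and B: "L2_set v J \<le> w powr (p - 1)"
  shows "w powr (p - 2) * ((\<Sum>i\<in>I. (du i)\<^sup>2) + d\<^sup>2) + w powr (2 - p) * (\<Sum>j\<in>J. (dv j)\<^sup>2) \<le>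
     bellman_ww p w (\<Sum>i\<in>I. (u i)\<^sup>2) (\<Sum>j\<in>J. (v j)\<^sup>2) * d\<^sup>2
     + 2 * (p - 2) * w powr (p - 3) * d * (\<Sum>i\<in>I. 2 * (u i * du i))
     + 2 * (2 - p) * w powr (1 - p) * d * (\<Sum>j\<in>J. 2 * (v j * dv j))
     + w powr (p - 2) * (\<Sum>i\<in>I. 2 * (du i)\<^sup>2) + w powr (2 - p) * (\<Sum>j\<in>J. 2 * (dv j)\<^sup>2)"
proof -
  have sq: "(\<Sum>i\<in>I. (u i)\<^sup>2) \<le> w\<^sup>2" "(\<Sum>j\<in>J. (v j)\<^sup>2) \<le> (w powr (p - 1))\<^sup>2"
    using A B w unfolding L2_set_def by (simp_all add: sqrt_le_D real_sqrt_le_iff sqrt_le_D)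
  have "w powr (p - 2) * ((\<Sum>i\<in>I. (du i)\<^sup>2) + d\<^sup>2) + w powr (2 - p) * (\<Sum>j\<in>J. (dv j)\<^sup>2) \<le>
     bellman_ww p w (\<Sum>i\<in>I. (u i)\<^sup>2) (\<Sum>j\<in>J. (v j)\<^sup>2) * d\<^sup>2
     + 4 * (p - 2) * w powr (p - 3) * d * (\<Sum>i\<in>I. u i * du i)
     + 4 * (2 - p) * w powr (1 - p) * d * (\<Sum>j\<in>J. v j * dv j)
     + 2 * w powr (p - 2) * (\<Sum>i\<in>I. (du i)\<^sup>2) + 2 * w powr (2 - p) * (\<Sum>j\<in>J. (dv j)\<^sup>2)"
    by (rule bellman_hessian) (use p w sq in \<open>auto intro!: sum_nonneg Cauchy_Schwarz_ineq_sum\<close>)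
  then show ?thesis unfolding sum_distrib_left[symmetric] by (simp add: algebra_simps)
qed

lemma sum_squares_segment_derivative:
  fixes u du :: "'i \<Rightarrow> real"
  shows "((\<lambda>s. \<Sum>i\<in>I. (u i + s * du i)\<^sup>2) has_field_derivative (\<Sum>i\<in>I. 2 * ((u i + s * du i) * du i))) (at s)"
  by (auto intro!: derivative_eq_intros sum.cong simp: mult_ac)

text \<open>
  On the cube there is no chain rule in space. Its substitute is convexity over finite jumps: the region is
  convex (because \<open>p - 1 \<le> 1\<close>), so Taylor's formula on the segment between two states applies, and along the
  segment \<open>w\<close> stays below the maximum of its end values. This is why jumps are weighted with the maximum.
\<close>
lemma bellman_jump:
  assumes p: "1 < p" "p \<le> 2" and w: "w0 > 0" "w1 > 0"
    and u: "L2_set u0 I \<le> w0" "L2_set u1 I \<le> w1"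
    and v: "L2_set v0 J \<le> w0 powr (p - 1)" "L2_set v1 J \<le> w1 powr (p - 1)"
  shows "bellman p w0 (\<Sum>i\<in>I. (u0 i)\<^sup>2) (\<Sum>j\<in>J. (v0 j)\<^sup>2)
      + bellman_w p w0 (\<Sum>i\<in>I. (u0 i)\<^sup>2) (\<Sum>j\<in>J. (v0 j)\<^sup>2) * (w1 - w0)
      + w0 powr (p - 2) * (\<Sum>i\<in>I. 2 * (u0 i * (u1 i - u0 i))) + w0 powr (2 - p) * (\<Sum>j\<in>J. 2 * (v0 j * (v1 j - v0 j)))
      + 1 / 2 * (max w0 w1 powr (p - 2) * ((\<Sum>i\<in>I. (u1 i - u0 i)\<^sup>2) + (w1 - w0)\<^sup>2))
    \<le> bellman p w1 (\<Sum>i\<in>I. (u1 i)\<^sup>2) (\<Sum>j\<in>J. (v1 j)\<^sup>2)"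
proof -
  define du dv d where "du i = u1 i - u0 i" and "dv j = v1 j - v0 j" and "d = w1 - w0" for i j
  define W where "W s = w0 + s * d" for s
  define a b where "a s = (\<Sum>i\<in>I. (u0 i + s * du i)\<^sup>2)" and "b s = (\<Sum>j\<in>J. (v0 j + s * dv j)\<^sup>2)" for s
  define a' b' where "a' s = (\<Sum>i\<in>I. 2 * ((u0 i + s * du i) * du i))" and "b' s = (\<Sum>j\<in>J. 2 * ((v0 j + s * dv j) * dv j))" for s
  define a'' b'' where "a'' = (\<Sum>i\<in>I. 2 * (du i)\<^sup>2)" and "b'' = (\<Sum>j\<in>J. 2 * (dv j)\<^sup>2)"
  have Wpos: "W s > 0" if "0 \<le> s" "s \<le> 1" for s
  proof -
    have "W s = (1 - s) * w0 + s * w1" by (simp add: W_def d_def algebra_simps)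
    moreover have "(1 - s) * w0 + s * w1 > 0"
      using that w by (cases "s = 1") (auto intro!: add_pos_nonneg)
    ultimately show ?thesis by simp
  qed
  have dW: "(W has_field_derivative d) (at s)" for s
    unfolding W_def by (auto intro!: derivative_eq_intros)
  have da: "(a has_field_derivative a' s) (at s)" and db: "(b has_field_derivative b' s) (at s)" for s
    unfolding a_def b_def a'_def b'_def by (rule sum_squares_segment_derivative)+
  have da': "(a' has_field_derivative a'') (at s)" and db': "(b' has_field_derivative b'') (at s)" for s
    unfolding a'_def b'_def a''_def b''_def
    by (auto intro!: derivative_eq_intros sum.cong simp: power2_eq_square)
  define f0 where "f0 s = bellman p (W s) (a s) (b s)" for s
  define f1 where "f1 s = bellman_w p (W s) (a s) (b s) * d + W s powr (p - 2) * a' s + W s powr (2 - p) * b' s" for s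
  define f2 where "f2 s = (bellman_ww p (W s) (a s) (b s) * d + (p - 2) * W s powr (p - 3) * a' s + (2 - p) * W s powr (1 - p) * b' s) * d
      + ((p - 2) * W s powr (p - 3) * d * a' s + W s powr (p - 2) * a'') + ((2 - p) * W s powr (1 - p) * d * b' s + W s powr (2 - p) * b'')" for s
  have d0: "(f0 has_field_derivative f1 s) (at s)" if "0 \<le> s" "s \<le> 1" for s
    unfolding f0_def f1_def by (rule has_derivative_bellman[OF Wpos[OF that] dW da db])
  have d1: "(f1 has_field_derivative f2 s) (at s)" if "0 \<le> s" "s \<le> 1" for s
    unfolding f1_def f2_def
    using p by (auto intro!: derivative_eq_intros has_derivative_bellman_w[OF Wpos[OF that] _ dW da db] dW da' db'
         Wpos[OF that])
  define diff where "diff = (\<lambda>m::nat. if m = 0 then f0 else if m = 1 then f1 else f2)"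
  have "\<exists>t. 0 < t \<and> t < 1 \<and> f0 1 = (\<Sum>m<2. diff m 0 / fact m * 1 ^ m) + diff 2 t / fact 2 * 1 ^ 2"
    by (rule Maclaurin) (auto simp: diff_def d0 d1 less_2_cases_iff)
  then obtain s where s: "0 < s" "s < 1" and eq: "f0 1 = f0 0 + f1 0 + f2 s / 2"
    by (auto simp: diff_def numeral_2_eq_2)
  have seg: "L2_set (\<lambda>i. x i + s * (y i - x i)) K \<le> (1 - s) * L2_set x K + s * L2_set y K" for x y :: "'z \<Rightarrow> real" and K
  proof -
    have "L2_set (\<lambda>i. x i + s * (y i - x i)) K = L2_set (\<lambda>i. (1 - s) * x i + s * y i) K"
      by (rule L2_set_cong) (simp_all add: algebra_simps)
    also have "\<dots> \<le> L2_set (\<lambda>i. (1 - s) * x i) K + L2_set (\<lambda>i. s * y i) K"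
      by (rule L2_set_triangle_ineq)
    also have "\<dots> = (1 - s) * L2_set x K + s * L2_set y K"
      using s by (simp add: L2_set_right_distrib)
    finally show ?thesis .
  qed
  have Ws: "W s = (1 - s) * w0 + s * w1" by (simp add: W_def d_def algebra_simps)
  have Wp: "W s > 0" by (rule Wpos) (use s in auto)
  have us: "L2_set (\<lambda>i. u0 i + s * du i) I \<le> W s"
    unfolding du_def Ws
    using seg[of u0 u1 I] u s by (smt (verit) mult_left_mono)
  have vs: "L2_set (\<lambda>j. v0 j + s * dv j) J \<le> W s powr (p - 1)"
  proof -
    let ?k = "(p - 1) * W s powr (p - 1 - 1)"
    have t: "w powr (p - 1) \<le> W s powr (p - 1) + ?k * (w - W s)" if "w > 0" for w
      by (rule powr_below_tangent) (use p that Wp in auto)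
    have "L2_set (\<lambda>j. v0 j + s * dv j) J \<le> (1 - s) * w0 powr (p - 1) + s * w1 powr (p - 1)"
      unfolding dv_def using seg[of v0 v1 J] v s by (smt (verit) mult_left_mono)
    also have "\<dots> \<le> (1 - s) * (W s powr (p - 1) + ?k * (w0 - W s)) + s * (W s powr (p - 1) + ?k * (w1 - W s))"
      using s w by (intro add_mono mult_left_mono t) auto
    also have "\<dots> = W s powr (p - 1) + ?k * ((1 - s) * w0 + s * w1 - W s)" by (simp add: algebra_simps)
    finally show ?thesis using Ws by simp
  qed
  have "W s powr (p - 2) * ((\<Sum>i\<in>I. (du i)\<^sup>2) + d\<^sup>2) + W s powr (2 - p) * (\<Sum>j\<in>J. (dv j)\<^sup>2) \<le> f2 s"
    using bellman_curve_second[OF p Wp us vs, of du d dv]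
    unfolding f2_def a_def b_def a'_def b'_def a''_def b''_def by (simp add: algebra_simps power2_eq_square)
  moreover have "W s powr (2 - p) * (\<Sum>j\<in>J. (dv j)\<^sup>2) \<ge> 0" by (intro mult_nonneg_nonneg sum_nonneg) auto
  moreover have "max w0 w1 powr (p - 2) * ((\<Sum>i\<in>I. (du i)\<^sup>2) + d\<^sup>2) \<le> W s powr (p - 2) * ((\<Sum>i\<in>I. (du i)\<^sup>2) + d\<^sup>2)"
  proof (rule mult_right_mono)
    have "W s \<le> (1 - s) * max w0 w1 + s * max w0 w1" unfolding Ws using s by (intro add_mono mult_left_mono) auto
    also have "\<dots> = max w0 w1" by (simp add: algebra_simps)
    finally show "max w0 w1 powr (p - 2) \<le> W s powr (p - 2)"
      using p Wp by (intro powr_mono2') auto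
  qed (auto intro!: add_nonneg_nonneg sum_nonneg)
  ultimately have "max w0 w1 powr (p - 2) * ((\<Sum>i\<in>I. (du i)\<^sup>2) + d\<^sup>2) \<le> f2 s" by linarith
  then have "f0 0 + f1 0 + 1 / 2 * (max w0 w1 powr (p - 2) * ((\<Sum>i\<in>I. (du i)\<^sup>2) + d\<^sup>2)) \<le> f0 1"
    unfolding eq by simp
  then show ?thesis
    by (simp add: f0_def f1_def W_def a_def b_def a'_def b'_def du_def dv_def d_def add.assoc)
qed

section \<open>Dissipation along the Poisson flow\<close>

lemma multiplier_poisson_derivative:
  "((\<lambda>t. multiplier n (poisson t) f x) has_field_derivative - multiplier n (poisson_deriv t) f x) (at t)"
  unfolding multiplier_def poisson_def poisson_deriv_def
  by (auto intro!: derivative_eq_intros simp: sum_negf[symmetric] intro!: sum.cong)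

lemma multiplier_poisson_second_derivative:
  "((\<lambda>t. - multiplier n (poisson_deriv t) f x) has_field_derivative multiplier n (\<lambda>k. real k * poisson t k) f x) (at t)"
  unfolding multiplier_def poisson_def poisson_deriv_def
  by (auto intro!: derivative_eq_intros simp: sum_negf[symmetric] intro!: sum.cong)

text \<open>
  The function \<open>G\<close> dominates both families at time \<open>0\<close>, with the power \<open>p - 1\<close> for \<open>h\<close>. By positivity and by
  Jensen's inequality for the concave power \<open>p - 1\<close> the Poisson extensions \<open>U\<close>, \<open>V\<close>, \<open>W\<close> satisfy the same
  inequalities at all times, so that the flow never leaves the region where the Bellman function is convex.
  The bound \<open>1 \<le> G\<close> keeps it away from the singularity at \<open>w = 0\<close>.
\<close>
locale poisson_flow =
  fixes n :: nat and p :: real and G :: "(nat \<Rightarrow> real) \<Rightarrow> real"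
    and I :: "'i set" and g :: "'i \<Rightarrow> (nat \<Rightarrow> real) \<Rightarrow> real"
    and J :: "'j set" and h :: "'j \<Rightarrow> (nat \<Rightarrow> real) \<Rightarrow> real"
  assumes p: "1 < p" "p \<le> 2"
    and fin: "finite I" "finite J"
    and one_le_G: "\<And>x. x \<in> cube n \<Longrightarrow> 1 \<le> G x"
    and g_le_G: "\<And>x. x \<in> cube n \<Longrightarrow> L2_set (\<lambda>i. g i x) I \<le> G x"
    and h_le_G: "\<And>x. x \<in> cube n \<Longrightarrow> L2_set (\<lambda>j. h j x) J \<le> G x powr (p - 1)"
begin

definition W :: "real \<Rightarrow> (nat \<Rightarrow> real) \<Rightarrow> real" where "W t = multiplier n (poisson t) G"
definition U :: "real \<Rightarrow> 'i \<Rightarrow> (nat \<Rightarrow> real) \<Rightarrow> real" where "U t i = multiplier n (poisson t) (g i)"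
definition V :: "real \<Rightarrow> 'j \<Rightarrow> (nat \<Rightarrow> real) \<Rightarrow> real" where "V t j = multiplier n (poisson t) (h j)"
definition dW :: "real \<Rightarrow> (nat \<Rightarrow> real) \<Rightarrow> real" where "dW t = (\<lambda>x. - multiplier n (poisson_deriv t) G x)"
definition dU :: "real \<Rightarrow> 'i \<Rightarrow> (nat \<Rightarrow> real) \<Rightarrow> real" where "dU t i = (\<lambda>x. - multiplier n (poisson_deriv t) (g i) x)"
definition dV :: "real \<Rightarrow> 'j \<Rightarrow> (nat \<Rightarrow> real) \<Rightarrow> real" where "dV t j = (\<lambda>x. - multiplier n (poisson_deriv t) (h j) x)"

lemma W_ge_1: "t \<ge> 0 \<Longrightarrow> x \<in> cube n \<Longrightarrow> 1 \<le> W t x"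
  unfolding W_def by (rule poisson_ge_1) (auto intro: one_le_G)

lemma U_le_W: "t \<ge> 0 \<Longrightarrow> x \<in> cube n \<Longrightarrow> L2_set (\<lambda>i. U t i x) I \<le> W t x"
  unfolding U_def W_def
  by (rule order.trans[OF poisson_L2_set_le poisson_mono]) (auto intro: g_le_G)

lemma V_le_W: "t \<ge> 0 \<Longrightarrow> x \<in> cube n \<Longrightarrow> L2_set (\<lambda>j. V t j x) J \<le> W t x powr (p - 1)"
proof -
  assume t: "t \<ge> 0" and x: "x \<in> cube n"
  have "L2_set (\<lambda>j. V t j x) J \<le> multiplier n (poisson t) (\<lambda>y. L2_set (\<lambda>j. h j y) J) x"
    unfolding V_def by (rule poisson_L2_set_le[OF t x])
  also have "\<dots> \<le> multiplier n (poisson t) (\<lambda>y. G y powr (p - 1)) x"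
    by (rule poisson_mono[OF t x h_le_G])
  also have "\<dots> \<le> W t x powr (p - 1)"
    unfolding W_def by (rule poisson_jensen_concave[OF t x one_le_G]) (use p in auto)
  finally show ?thesis .
qed

definition jumps :: "real \<Rightarrow> (nat \<Rightarrow> real) \<Rightarrow> real" where
  "jumps t x = (\<Sum>k=1..n. max (W t x) (W t (flip k x)) powr (p - 2) *
       ((\<Sum>i\<in>I. (half_diff k (U t i) x)\<^sup>2) + (half_diff k (W t) x)\<^sup>2))"

definition dissipation :: "real \<Rightarrow> (nat \<Rightarrow> real) \<Rightarrow> real" where
  "dissipation t x = W t x powr (2 - p) * (\<Sum>j\<in>J. (dV t j x)\<^sup>2) + jumps t x"

definition sqU :: "real \<Rightarrow> (nat \<Rightarrow> real) \<Rightarrow> real" where "sqU t x = (\<Sum>i\<in>I. (U t i x)\<^sup>2)"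
definition sqV :: "real \<Rightarrow> (nat \<Rightarrow> real) \<Rightarrow> real" where "sqV t x = (\<Sum>j\<in>J. (V t j x)\<^sup>2)"
definition energy :: "real \<Rightarrow> real" where
  "energy t = mean n (\<lambda>x. bellman p (W t x) (sqU t x) (sqV t x))"

definition dsqU :: "real \<Rightarrow> (nat \<Rightarrow> real) \<Rightarrow> real" where "dsqU t x = (\<Sum>i\<in>I. 2 * (U t i x * dU t i x))"
definition dsqV :: "real \<Rightarrow> (nat \<Rightarrow> real) \<Rightarrow> real" where "dsqV t x = (\<Sum>j\<in>J. 2 * (V t j x * dV t j x))"
definition ddW :: "real \<Rightarrow> (nat \<Rightarrow> real) \<Rightarrow> real" where "ddW t = (\<lambda>x. multiplier n (\<lambda>k. real k * poisson t k) G x)"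
definition ddU :: "real \<Rightarrow> 'i \<Rightarrow> (nat \<Rightarrow> real) \<Rightarrow> real" where "ddU t i = (\<lambda>x. multiplier n (\<lambda>k. real k * poisson t k) (g i) x)"
definition ddV :: "real \<Rightarrow> 'j \<Rightarrow> (nat \<Rightarrow> real) \<Rightarrow> real" where "ddV t j = (\<lambda>x. multiplier n (\<lambda>k. real k * poisson t k) (h j) x)"
definition ddsqU :: "real \<Rightarrow> (nat \<Rightarrow> real) \<Rightarrow> real" where "ddsqU t x = (\<Sum>i\<in>I. 2 * (dU t i x)\<^sup>2 + 2 * (U t i x * ddU t i x))"
definition ddsqV :: "real \<Rightarrow> (nat \<Rightarrow> real) \<Rightarrow> real" where "ddsqV t x = (\<Sum>j\<in>J. 2 * (dV t j x)\<^sup>2 + 2 * (V t j x * ddV t j x))"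

lemma flow_derivatives:
  "((\<lambda>t. W t x) has_field_derivative dW t x) (at t)"
  "((\<lambda>t. U t i x) has_field_derivative dU t i x) (at t)"
  "((\<lambda>t. V t j x) has_field_derivative dV t j x) (at t)"
  "((\<lambda>t. dW t x) has_field_derivative ddW t x) (at t)"
  "((\<lambda>t. dU t i x) has_field_derivative ddU t i x) (at t)"
  "((\<lambda>t. dV t j x) has_field_derivative ddV t j x) (at t)"
  unfolding W_def U_def V_def dW_def dU_def dV_def ddW_def ddU_def ddV_def
  by (rule multiplier_poisson_derivative multiplier_poisson_second_derivative)+

lemma flow_square_derivatives:
  "((\<lambda>t. sqU t x) has_field_derivative dsqU t x) (at t)"
  "((\<lambda>t. sqV t x) has_field_derivative dsqV t x) (at t)"
  "((\<lambda>t. dsqU t x) has_field_derivative ddsqU t x) (at t)"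
  "((\<lambda>t. dsqV t x) has_field_derivative ddsqV t x) (at t)"
  unfolding sqU_def sqV_def dsqU_def dsqV_def ddsqU_def ddsqV_def
  by (auto intro!: derivative_eq_intros flow_derivatives sum.cong simp: power2_eq_square algebra_simps)

definition energy_slope :: "real \<Rightarrow> (nat \<Rightarrow> real) \<Rightarrow> real" where
  "energy_slope t x = bellman_w p (W t x) (sqU t x) (sqV t x) * dW t x + W t x powr (p - 2) * dsqU t x + W t x powr (2 - p) * dsqV t x"

definition energy_curvature :: "real \<Rightarrow> (nat \<Rightarrow> real) \<Rightarrow> real" where
  "energy_curvature t x = (bellman_ww p (W t x) (sqU t x) (sqV t x) * dW t x + (p - 2) * W t x powr (p - 3) * dsqU t x + (2 - p) * W t x powr (1 - p) * dsqV t x) * dW t x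
     + bellman_w p (W t x) (sqU t x) (sqV t x) * ddW t x
     + ((p - 2) * W t x powr (p - 3) * dW t x * dsqU t x + W t x powr (p - 2) * ddsqU t x)
     + ((2 - p) * W t x powr (1 - p) * dW t x * dsqV t x + W t x powr (2 - p) * ddsqV t x)"

lemma W_pos: "t \<ge> 0 \<Longrightarrow> x \<in> cube n \<Longrightarrow> 0 < W t x"
  using W_ge_1[of t x] by linarith

lemma deriv_energy_density:
  assumes "t \<ge> 0" "x \<in> cube n"
  shows "((\<lambda>t. bellman p (W t x) (sqU t x) (sqV t x)) has_field_derivative energy_slope t x) (at t)"
    and "((\<lambda>t. energy_slope t x) has_field_derivative energy_curvature t x) (at t)"
proof -
  show "((\<lambda>t. bellman p (W t x) (sqU t x) (sqV t x)) has_field_derivative energy_slope t x) (at t)"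
    unfolding energy_slope_def by (rule has_derivative_bellman[OF W_pos[OF assms] flow_derivatives(1) flow_square_derivatives(1,2)])
  show "((\<lambda>t. energy_slope t x) has_field_derivative energy_curvature t x) (at t)"
    unfolding energy_slope_def energy_curvature_def using p
    by (auto intro!: derivative_eq_intros has_derivative_bellman_w[OF W_pos[OF assms] _ flow_derivatives(1) flow_square_derivatives(1,2)]
        flow_derivatives flow_square_derivatives W_pos[OF assms])
qed

lemma mean_derivative:
  assumes "\<And>x. x \<in> cube n \<Longrightarrow> ((\<lambda>t. f t x) has_field_derivative f' x) (at t)"
  shows "((\<lambda>t. mean n (f t)) has_field_derivative mean n f') (at t)"
  unfolding mean_def by (intro DERIV_cdivide DERIV_sum) (rule assms)

lemma deriv_energy:
  assumes "t \<ge> 0"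
  shows "(energy has_field_derivative mean n (energy_slope t)) (at t)"
    and "((\<lambda>t. mean n (energy_slope t)) has_field_derivative mean n (energy_curvature t)) (at t)"
  unfolding energy_def
  by (rule mean_derivative deriv_energy_density[OF assms] | assumption)+

lemma flow_laplacian:
  assumes "x \<in> cube n"
  shows "ddW t x = (\<Sum>k=1..n. half_diff k (W t) x)"
    and "ddU t i x = (\<Sum>k=1..n. half_diff k (U t i) x)"
    and "ddV t j x = (\<Sum>k=1..n. half_diff k (V t j) x)"
  unfolding ddW_def ddU_def ddV_def W_def U_def V_def
  by (simp_all only: sum_half_diff_multiplier[OF assms])

text \<open>
  The terms with second time derivatives. As \<open>U\<close>, \<open>V\<close>, \<open>W\<close> solve \<open>f'' = Delta f\<close> in time, they equal
  the gradient of the Bellman function applied to spatial differences, which \<open>bellman_jump\<close> bounds from below edge by edge.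
\<close>
lemma gradient_laplacian_bound:
  assumes t: "t \<ge> 0" and x: "x \<in> cube n"
  shows "(\<Sum>k=1..n. (bellman p (W t x) (sqU t x) (sqV t x)
       - bellman p (W t (flip k x)) (sqU t (flip k x)) (sqV t (flip k x))) / 2) + jumps t x
     \<le> bellman_w p (W t x) (sqU t x) (sqV t x) * ddW t x + W t x powr (p - 2) * (\<Sum>i\<in>I. 2 * (U t i x * ddU t i x))
       + W t x powr (2 - p) * (\<Sum>j\<in>J. 2 * (V t j x * ddV t j x))" (is "?L \<le> ?R")
proof -
  have R: "?R = (\<Sum>k=1..n. bellman_w p (W t x) (sqU t x) (sqV t x) * half_diff k (W t) x
      + W t x powr (p - 2) * (\<Sum>i\<in>I. 2 * (U t i x * half_diff k (U t i) x))
      + W t x powr (2 - p) * (\<Sum>j\<in>J. 2 * (V t j x * half_diff k (V t j) x)))"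
    unfolding flow_laplacian[OF x] sum.distrib
    unfolding sum_distrib_left sum.swap[of _ _ "{1..n}"] ..
  have L: "?L = (\<Sum>k=1..n. (bellman p (W t x) (sqU t x) (sqV t x)
       - bellman p (W t (flip k x)) (sqU t (flip k x)) (sqV t (flip k x))) / 2 +
      max (W t x) (W t (flip k x)) powr (p - 2) * ((\<Sum>i\<in>I. (half_diff k (U t i) x)\<^sup>2) + (half_diff k (W t) x)\<^sup>2))"
    unfolding sum.distrib jumps_def ..
  have "(bellman p (W t x) (sqU t x) (sqV t x)
       - bellman p (W t (flip k x)) (sqU t (flip k x)) (sqV t (flip k x))) / 2 +
      max (W t x) (W t (flip k x)) powr (p - 2) * ((\<Sum>i\<in>I. (half_diff k (U t i) x)\<^sup>2) + (half_diff k (W t) x)\<^sup>2)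
    \<le> bellman_w p (W t x) (sqU t x) (sqV t x) * half_diff k (W t) x
      + W t x powr (p - 2) * (\<Sum>i\<in>I. 2 * (U t i x * half_diff k (U t i) x))
      + W t x powr (2 - p) * (\<Sum>j\<in>J. 2 * (V t j x * half_diff k (V t j) x))"
    if k: "k \<in> {1..n}" for k
  proof -
    let ?y = "flip k x"
    have y: "?y \<in> cube n" by (rule flip_in_cube[OF x k])
    have d: "f x - f ?y = 2 * half_diff k f x" "f ?y - f x = - 2 * half_diff k f x" for f by (simp_all add: half_diff_def)
    have s: "(\<Sum>i\<in>K. 2 * (f i x * (f i ?y - f i x))) = - 2 * (\<Sum>i\<in>K. 2 * (f i x * half_diff k (f i) x))"
      "(\<Sum>i\<in>K. (f i ?y - f i x)\<^sup>2) = 4 * (\<Sum>i\<in>K. (half_diff k (f i) x)\<^sup>2)" for K and f :: "'z \<Rightarrow> (nat \<Rightarrow> real) \<Rightarrow> real"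
      unfolding d sum_distrib_left by (auto intro!: sum.cong simp: power2_eq_square)
    have "bellman p (W t x) (sqU t x) (sqV t x) + bellman_w p (W t x) (sqU t x) (sqV t x) * (W t ?y - W t x)
      + W t x powr (p - 2) * (\<Sum>i\<in>I. 2 * (U t i x * (U t i ?y - U t i x)))
      + W t x powr (2 - p) * (\<Sum>j\<in>J. 2 * (V t j x * (V t j ?y - V t j x)))
      + 1 / 2 * (max (W t x) (W t ?y) powr (p - 2) * ((\<Sum>i\<in>I. (U t i ?y - U t i x)\<^sup>2) + (W t ?y - W t x)\<^sup>2))
      \<le> bellman p (W t ?y) (sqU t ?y) (sqV t ?y)"
      unfolding sqU_def sqV_def
      by (rule bellman_jump[OF p W_pos[OF t x] W_pos[OF t y] U_le_W[OF t x] U_le_W[OF t y] V_le_W[OF t x] V_le_W[OF t y]])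
    then show ?thesis unfolding s unfolding d by (simp add: algebra_simps power2_eq_square diff_divide_distrib)
  qed
  then show ?thesis unfolding L R by (rule sum_mono)
qed

text \<open>
  The first-order differences over the edges have mean zero, because flipping a coordinate preserves the measure.
\<close>
lemma dissipation_le_curvature:
  assumes t: "t \<ge> 0"
  shows "mean n (dissipation t) \<le> mean n (energy_curvature t)"
proof -
  define F where "F x = bellman p (W t x) (sqU t x) (sqV t x)" for x
  have "dissipation t x + (\<Sum>k=1..n. (F x - F (flip k x)) / 2) \<le> energy_curvature t x" if x: "x \<in> cube n" for x
  proof -
    have "W t x powr (p - 2) * ((\<Sum>i\<in>I. (dU t i x)\<^sup>2) + (dW t x)\<^sup>2) + W t x powr (2 - p) * (\<Sum>j\<in>J. (dV t j x)\<^sup>2) \<le>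
     bellman_ww p (W t x) (sqU t x) (sqV t x) * (dW t x)\<^sup>2
     + 2 * (p - 2) * W t x powr (p - 3) * dW t x * dsqU t x
     + 2 * (2 - p) * W t x powr (1 - p) * dW t x * dsqV t x
     + W t x powr (p - 2) * (\<Sum>i\<in>I. 2 * (dU t i x)\<^sup>2) + W t x powr (2 - p) * (\<Sum>j\<in>J. 2 * (dV t j x)\<^sup>2)"
      unfolding sqU_def sqV_def dsqU_def dsqV_def
      by (rule bellman_curve_second[OF p W_pos[OF t x] U_le_W[OF t x] V_le_W[OF t x]])
    moreover have "W t x powr (p - 2) * ((\<Sum>i\<in>I. (dU t i x)\<^sup>2) + (dW t x)\<^sup>2) \<ge> 0"
      by (intro mult_nonneg_nonneg add_nonneg_nonneg sum_nonneg) auto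
    moreover note gradient_laplacian_bound[OF t x, folded F_def]
    moreover have "energy_curvature t x = bellman_ww p (W t x) (sqU t x) (sqV t x) * (dW t x)\<^sup>2
     + 2 * (p - 2) * W t x powr (p - 3) * dW t x * dsqU t x
     + 2 * (2 - p) * W t x powr (1 - p) * dW t x * dsqV t x
     + W t x powr (p - 2) * (\<Sum>i\<in>I. 2 * (dU t i x)\<^sup>2) + W t x powr (2 - p) * (\<Sum>j\<in>J. 2 * (dV t j x)\<^sup>2)
     + (bellman_w p (W t x) (sqU t x) (sqV t x) * ddW t x + W t x powr (p - 2) * (\<Sum>i\<in>I. 2 * (U t i x * ddU t i x))
       + W t x powr (2 - p) * (\<Sum>j\<in>J. 2 * (V t j x * ddV t j x)))"
      unfolding energy_curvature_def ddsqU_def ddsqV_def sum.distrib by (simp add: algebra_simps power2_eq_square)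
    ultimately show ?thesis unfolding dissipation_def by linarith
  qed
  then have "mean n (\<lambda>x. dissipation t x + (\<Sum>k=1..n. (F x - F (flip k x)) / 2)) \<le> mean n (energy_curvature t)"
    by (rule mean_mono)
  moreover have "mean n (\<lambda>x. \<Sum>k=1..n. (F x - F (flip k x)) / 2) = 0"
  proof -
    have "mean n (\<lambda>x. (F x - F (flip k x)) / 2) = 0" if "k \<in> {1..n}" for k
      using mean_cmult[of n "1/2" "\<lambda>x. F x - F (flip k x)"] mean_flip[OF that, of F] by (simp add: mean_diff)
    then show ?thesis by (simp add: mean_sum)
  qed
  ultimately show ?thesis by (simp add: mean_add)
qed

lemma jumps_nonneg: "jumps t x \<ge> 0"
  unfolding jumps_def by (intro sum_nonneg mult_nonneg_nonneg add_nonneg_nonneg) auto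

lemma dissipation_nonneg: "dissipation t x \<ge> 0"
  unfolding dissipation_def by (intro add_nonneg_nonneg mult_nonneg_nonneg sum_nonneg jumps_nonneg) auto

lemma energy_bounds:
  assumes t: "t \<ge> 0"
  shows "0 \<le> energy t" "energy t \<le> 12 / (p - 1) * mean n (\<lambda>x. G x powr p)"
proof -
  show "0 \<le> energy t" unfolding energy_def bellman_def sqU_def sqV_def
    using p by (intro mean_nonneg add_nonneg_nonneg mult_nonneg_nonneg sum_nonneg) auto
  have "bellman p (W t x) (sqU t x) (sqV t x) \<le> 12 / (p - 1) * W t x powr p" if x: "x \<in> cube n" for x
  proof -
    have w: "W t x > 0" by (rule W_pos[OF t x])
    have "sqU t x \<le> (W t x)\<^sup>2" "sqV t x \<le> (W t x powr (p - 1))\<^sup>2"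
      using U_le_W[OF t x] V_le_W[OF t x] unfolding sqU_def sqV_def L2_set_def by (simp_all add: sqrt_le_D)
    then have "bellman p (W t x) (sqU t x) (sqV t x) \<le> W t x powr (p - 2) * (W t x)\<^sup>2
       + W t x powr (2 - p) * (W t x powr (p - 1))\<^sup>2 + 10 / (p - 1) * W t x powr p"
      unfolding bellman_def by (intro add_mono mult_left_mono) (use p in auto)
    also have "W t x powr (p - 2) * (W t x)\<^sup>2 = W t x powr p"
      using powr_add[of "W t x" "p - 2" 2] w by (simp add: powr_numeral)
    also have "W t x powr (2 - p) * (W t x powr (p - 1))\<^sup>2 = W t x powr p"
      by (simp add: power2_eq_square flip: powr_add)
    also have "W t x powr p + W t x powr p + 10 / (p - 1) * W t x powr p = (2 + 10 / (p - 1)) * W t x powr p"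
      by (simp add: algebra_simps)
    also have "\<dots> \<le> 12 / (p - 1) * W t x powr p"
    proof (rule mult_right_mono)
      have "2 \<le> 2 / (p - 1)" using p by (simp add: le_divide_eq)
      then show "2 + 10 / (p - 1) \<le> 12 / (p - 1)"
        using add_divide_distrib[of 2 10 "p - 1"] by simp
    qed simp
    finally show ?thesis .
  qed
  then have "energy t \<le> mean n (\<lambda>x. 12 / (p - 1) * W t x powr p)"
    unfolding energy_def by (rule mean_mono)
  also have "\<dots> \<le> 12 / (p - 1) * mean n (\<lambda>x. G x powr p)"
    unfolding mean_cmult W_def using p t one_le_G by (intro mult_left_mono mean_poisson_powr_le) auto
  finally show "energy t \<le> 12 / (p - 1) * mean n (\<lambda>x. G x powr p)" .
qed

text \<open>
  A convex bounded function on the half-line cannot have a positive slope anywhere.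
\<close>
lemma energy_decreasing:
  assumes T: "T \<ge> 0"
  shows "mean n (energy_slope T) \<le> 0"
proof (rule ccontr)
  assume "\<not> ?thesis"
  then have c: "mean n (energy_slope T) > 0" (is "?c > 0") by simp
  let ?M = "12 / (p - 1) * mean n (\<lambda>x. G x powr p)"
  \<comment> \<open>a time by which a slope ?c since T forces the energy above its bound ?M\<close>
  define S where "S = T + 1 + ?M / ?c"
  have M: "?M \<ge> 0" using energy_bounds[OF T] by linarith
  have "?M / ?c \<ge> 0" using M c by (intro divide_nonneg_pos)
  then have ST: "S > T" by (simp only: S_def)
  have "\<exists>z. T < z \<and> z < S \<and> energy S - energy T = (S - T) * mean n (energy_slope z)"
    by (rule MVT2) (use ST T deriv_energy in auto)
  then obtain z where z: "T < z" "z < S" and eq: "energy S - energy T = (S - T) * mean n (energy_slope z)" by blast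
  have "mean n (energy_slope T) \<le> mean n (energy_slope z)"
  proof (rule DERIV_nonneg_imp_nondecreasing[OF less_imp_le[OF z(1)]])
    fix s assume s: "T \<le> s" "s \<le> z"
    have "0 \<le> mean n (energy_curvature s)"
      using dissipation_le_curvature[of s] mean_nonneg[of n "dissipation s"] dissipation_nonneg s T by force
    then show "\<exists>y. ((\<lambda>t. mean n (energy_slope t)) has_real_derivative y) (at s) \<and> 0 \<le> y"
      using deriv_energy(2)[of s] s T by auto
  qed
  then have "(S - T) * ?c \<le> energy S - energy T" unfolding eq using ST by (intro mult_left_mono) auto
  also have "\<dots> \<le> ?M" using energy_bounds[of S] energy_bounds[of T] ST T by simp
  finally have "(S - T) * ?c \<le> ?M" .
  moreover have "(T + 1 + m / c - T) * c = c + m" if "c > 0" for m c :: real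
    using that by (simp add: field_simps)
  ultimately show False using c by (simp only: S_def)
qed

lemma W_continuous: "continuous_on S (\<lambda>t. W t x)" and U_continuous: "continuous_on S (\<lambda>t. U t i x)"
  and dV_continuous: "continuous_on S (\<lambda>t. dV t j x)"
  using flow_derivatives by (meson DERIV_continuous_on has_field_derivative_at_within)+

lemma dissipation_continuous:
  assumes "x \<in> cube n"
  shows "continuous_on {0..T} (\<lambda>t. dissipation t x)"
proof -
  have 1: "W t x \<noteq> 0" if "t \<in> {0..T}" for t
    using W_ge_1[of t x] assms that by force
  then have 2: "max (W t x) (W t y) \<noteq> 0" if "t \<in> {0..T}" for t y
    using max.coboundedI1[OF W_ge_1[of t x], of "W t y"] assms that by auto
  show ?thesis
    unfolding dissipation_def jumps_def half_diff_def
    by (intro continuous_intros W_continuous U_continuous dV_continuous ballI 1 2) auto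
qed

text \<open>
  The weight \<open>t\<close> comes from the antiderivative \<open>t * energy' - energy\<close> of \<open>t * energy''\<close>.
\<close>
theorem dissipation_integral:
  assumes T: "T \<ge> 0"
  shows "integral {0..T} (\<lambda>t. t * mean n (dissipation t)) \<le> 12 / (p - 1) * mean n (\<lambda>x. G x powr p)"
proof -
  have "((\<lambda>t. t * mean n (energy_curvature t)) has_integral (T * mean n (energy_slope T) - energy T) - (0 * mean n (energy_slope 0) - energy 0)) {0..T}"
  proof (rule fundamental_theorem_of_calculus[OF T])
    fix t assume t: "t \<in> {0..T}"
    have "((\<lambda>t. t * mean n (energy_slope t) - energy t) has_field_derivative (1 * mean n (energy_slope t) + mean n (energy_curvature t) * t) - mean n (energy_slope t)) (at t)"
      by (intro DERIV_diff DERIV_mult DERIV_ident deriv_energy) (use t in auto)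
    then show "((\<lambda>t. t * mean n (energy_slope t) - energy t) has_vector_derivative t * mean n (energy_curvature t)) (at t within {0..T})"
      by (auto simp: has_real_derivative_iff_has_vector_derivative[symmetric] mult_ac intro: has_field_derivative_at_within)
  qed
  moreover have "(\<lambda>t. t * mean n (dissipation t)) integrable_on {0..T}"
    unfolding mean_def
    by (intro integrable_continuous_real continuous_intros dissipation_continuous) auto
  ultimately have "integral {0..T} (\<lambda>t. t * mean n (dissipation t)) \<le> (T * mean n (energy_slope T) - energy T) - (0 * mean n (energy_slope 0) - energy 0)"
    by (intro has_integral_le[OF integrable_integral]) (auto intro!: mult_left_mono dissipation_le_curvature)
  moreover have "T * mean n (energy_slope T) \<le> 0" using energy_decreasing[OF T] T by (simp add: mult_nonneg_nonpos)
  ultimately show ?thesis using energy_bounds[OF T] energy_bounds[of 0] by linarith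
qed

end

section \<open>Interpolation and the derivative of the Poisson semigroup\<close>

lemma nn_integral_interval:
  fixes f :: "real \<Rightarrow> real"
  assumes "\<And>t. t \<in> S \<Longrightarrow> 0 \<le> f t" "(f has_integral I) S"
  shows "(\<integral>\<^sup>+t. ennreal (indicator S t * f t) \<partial>lborel) = ennreal I"
proof -
  have "((\<lambda>t. if t \<in> S then f t else 0) has_integral I) UNIV"
    using assms(2) by (simp only: has_integral_restrict_UNIV)
  then have "((\<lambda>t. indicator S t * f t) has_integral I) UNIV"
    by (rule has_integral_eq[rotated]) (simp add: indicator_def)
  from nn_integral_has_integral_lebesgue[OF _ this] assms(1)
  show ?thesis by (simp add: indicator_def)
qed

text \<open>
  The value of the Beta function at \<open>(q - 2, 3)\<close>, as the partial fractions that integrating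
  \<open>s powr (q - 3) * (1 - s) ^ 2\<close> termwise produces.
\<close>
definition layer_const :: "real \<Rightarrow> real" where
  "layer_const q = 1 / (q - 2) - 2 / (q - 1) + 1 / q"

lemma layer_const_pos: "q > 2 \<Longrightarrow> layer_const q > 0"
proof -
  assume q: "q > 2"
  have "1 / (q - 2) - 1 / (q - 1) = 1 / ((q - 2) * (q - 1))" "1 / (q - 1) - 1 / q = 1 / ((q - 1) * q)"
    using q by (simp_all add: diff_frac_eq)
  moreover have "1 / ((q - 1) * q) < 1 / ((q - 2) * (q - 1))"
    using q by (intro divide_strict_left_mono) (auto simp: mult.commute)
  ultimately show ?thesis by (simp add: layer_const_def)
qed

text \<open>
  A power \<open>q > 2\<close> is a superposition of truncated squares. Compared with the distribution function this has
  the advantage that the truncated part of a function enters through its \<open>L2\<close> norm.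
\<close>
lemma layer_cake:
  fixes y q :: real
  assumes q: "q > 2" and y: "y \<ge> 0"
  shows "(\<integral>\<^sup>+s. ennreal (indicator {0<..} s * (s powr (q - 3) * (max 0 (y - s))\<^sup>2)) \<partial>lborel)
    = ennreal (layer_const q * y powr q)"
proof -
  define F where "F s = y\<^sup>2 * (s powr (q - 2) / (q - 2)) - 2 * y * (s powr (q - 1) / (q - 1)) + s powr q / q" for s
  have "((\<lambda>s. s powr (q - 3) * (y - s)\<^sup>2) has_integral (F y - F 0)) {0..y}"
  proof (rule fundamental_theorem_of_calculus_interior[OF y])
    have "continuous_on {0..y} (\<lambda>s. s powr r)" if "r > 0" for r
      using that by (intro continuous_on_powr' continuous_intros) auto
    note powr_cont = this
    show "continuous_on {0..y} F" unfolding F_def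
      by (intro continuous_on_add continuous_on_diff continuous_on_mult continuous_on_divide continuous_on_const powr_cont)
         (use q in auto)
    fix s assume s: "s \<in> {0<..<y}"
    have e: "s powr (q - 2) = s powr (q - 3) * s" "s powr (q - 1) = s powr (q - 3) * s\<^sup>2"
      using s powr_add[of s "q - 3" 1] powr_add[of s "q - 3" 2] by (simp_all add: powr_numeral)
    have "(F has_field_derivative (y\<^sup>2 * s powr (q - 3) - 2 * y * s powr (q - 2) + s powr (q - 1))) (at s)"
      unfolding F_def using s q by (auto intro!: derivative_eq_intros)
    also have "y\<^sup>2 * s powr (q - 3) - 2 * y * s powr (q - 2) + s powr (q - 1) = s powr (q - 3) * (y - s)\<^sup>2"
      unfolding e by (simp add: power2_eq_square algebra_simps)
    finally show "(F has_vector_derivative s powr (q - 3) * (y - s)\<^sup>2) (at s)"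
      by (simp add: has_real_derivative_iff_has_vector_derivative)
  qed
  moreover have "F y - F 0 = layer_const q * y powr q"
  proof (cases "y = 0")
    case False
    then have "y\<^sup>2 * y powr (q - 2) = y powr q" "y * y powr (q - 1) = y powr q"
      using y powr_add[of y 2 "q - 2"] powr_add[of y 1 "q - 1"] by (simp_all add: powr_numeral)
    then show ?thesis by (simp add: F_def layer_const_def algebra_simps)
  qed (simp add: F_def)
  ultimately have "((\<lambda>s. s powr (q - 3) * (y - s)\<^sup>2) has_integral (layer_const q * y powr q)) {0..y}" by simp
  then have "(\<integral>\<^sup>+s. ennreal (indicator {0..y} s * (s powr (q - 3) * (y - s)\<^sup>2)) \<partial>lborel) = ennreal (layer_const q * y powr q)"
    by (intro nn_integral_interval) auto
  moreover have "indicator {0..y} s * (s powr (q - 3) * (y - s)\<^sup>2) =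
     indicator {0<..} s * (s powr (q - 3) * (max 0 (y - s))\<^sup>2)" for s
    by (auto simp: indicator_def max_def)
  ultimately show ?thesis by (simp only:)
qed

text \<open>
  Interpolation between \<open>L2\<close> and \<open>Linf\<close> without loss of constants. Split \<open>h\<close> at height \<open>s\<close>, keeping the
  direction: the remaining small part has norm at most \<open>s\<close> and so has its image, and the cut off part has norm \<open>max 0 (H - s)\<close>.
  Hence the excess of the image over \<open>s\<close> is controlled in \<open>L2\<close> by the excess of \<open>h\<close> over \<open>s\<close>, and
  \<open>layer_cake\<close> integrates this over \<open>s\<close>. Each level uses the \<open>L2\<close> bound \<open>\<beta>\<close> once, so \<open>\<beta>\<close> enters linearly. The free weight \<open>\<rho>\<close> in time covers a single operator (a
  constant family on the unit interval) as well as a square function.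
\<close>
lemma interpolation_L2_Linf:
  fixes n :: nat and J :: "'j set" and h :: "'j \<Rightarrow> (nat \<Rightarrow> real) \<Rightarrow> real" and \<rho> :: "real \<Rightarrow> real" and m :: "real \<Rightarrow> nat \<Rightarrow> real"
  defines "N k t x \<equiv> L2_set (\<lambda>j. multiplier n (m t) (k j) x) J"
  assumes q: "q \<ge> 2" and J: "finite J"
    and \<rho>: "\<And>t. 0 \<le> \<rho> t" "\<rho> \<in> borel_measurable borel" and m: "\<And>k. (\<lambda>t. m t k) \<in> borel_measurable borel"
    and sup: "\<And>k B t x. \<rho> t \<noteq> 0 \<Longrightarrow> x \<in> cube n \<Longrightarrow> (\<And>y. y \<in> cube n \<Longrightarrow> L2_set (\<lambda>j. k j y) J \<le> B) \<Longrightarrow> N k t x \<le> B"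
    and L2: "\<And>k. (\<integral>\<^sup>+t. ennreal (\<rho> t * (m t k)\<^sup>2) \<partial>lborel) \<le> ennreal \<beta>" and \<beta>: "\<beta> \<ge> 0"
  shows "(\<Sum>x\<in>cube n. \<integral>\<^sup>+t. ennreal (\<rho> t * N h t x powr q) \<partial>lborel)
      \<le> ennreal (\<beta> * (\<Sum>x\<in>cube n. L2_set (\<lambda>j. h j x) J powr q))"
proof -
  note [measurable] = \<rho>(2) m
  have N_meas [measurable]: "(\<lambda>t. N k t x) \<in> borel_measurable borel" for k x
    unfolding N_def L2_set_def multiplier_def by measurable
  have strong2: "(\<Sum>x\<in>cube n. \<integral>\<^sup>+t. ennreal (\<rho> t * (N k t x)\<^sup>2) \<partial>lborel)
      \<le> ennreal (\<beta> * (\<Sum>x\<in>cube n. (L2_set (\<lambda>j. k j x) J)\<^sup>2))" for k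
  proof -
    have pars: "(\<Sum>x\<in>cube n. \<Sum>j\<in>J. (f j x)\<^sup>2) = 2 ^ n * (\<Sum>j\<in>J. \<Sum>A\<in>Pow {1..n}. (walsh_coeff n (f j) A)\<^sup>2)" for f
    proof -
      have "(\<Sum>x\<in>cube n. \<Sum>j\<in>J. (f j x)\<^sup>2) = (\<Sum>j\<in>J. 2 ^ n * mean n (\<lambda>x. f j x * f j x))"
        by (subst sum.swap) (simp add: mean_def power2_eq_square)
      then show ?thesis unfolding parseval by (simp add: sum_distrib_left power2_eq_square)
    qed
    have "(\<Sum>x\<in>cube n. \<integral>\<^sup>+t. ennreal (\<rho> t * (N k t x)\<^sup>2) \<partial>lborel)
        = (\<integral>\<^sup>+t. (\<Sum>x\<in>cube n. ennreal (\<rho> t * (N k t x)\<^sup>2)) \<partial>lborel)"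
      by (rule nn_integral_sum[symmetric]) measurable
    also have "\<dots> = (\<integral>\<^sup>+t. (\<Sum>j\<in>J. \<Sum>A\<in>Pow {1..n}. ennreal (2 ^ n * (walsh_coeff n (k j) A)\<^sup>2) * ennreal (\<rho> t * (m t (card A))\<^sup>2)) \<partial>lborel)"
    proof (rule nn_integral_cong)
      fix t
      have "(\<Sum>x\<in>cube n. (N k t x)\<^sup>2) = (\<Sum>x\<in>cube n. \<Sum>j\<in>J. (multiplier n (m t) (k j) x)\<^sup>2)"
        unfolding N_def L2_set_def by (simp add: sum_nonneg)
      also have "\<dots> = 2 ^ n * (\<Sum>j\<in>J. \<Sum>A\<in>Pow {1..n}. (m t (card A) * walsh_coeff n (k j) A)\<^sup>2)"
        unfolding pars by (intro arg_cong2[where f="(*)"] sum.cong refl) (simp add: walsh_coeff_multiplier)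
      finally have "\<rho> t * (\<Sum>x\<in>cube n. (N k t x)\<^sup>2) =
         (\<Sum>j\<in>J. \<Sum>A\<in>Pow {1..n}. (2 ^ n * (walsh_coeff n (k j) A)\<^sup>2) * (\<rho> t * (m t (card A))\<^sup>2))"
        by (simp add: sum_distrib_left power_mult_distrib mult_ac)
      then show "(\<Sum>x\<in>cube n. ennreal (\<rho> t * (N k t x)\<^sup>2)) =
         (\<Sum>j\<in>J. \<Sum>A\<in>Pow {1..n}. ennreal (2 ^ n * (walsh_coeff n (k j) A)\<^sup>2) * ennreal (\<rho> t * (m t (card A))\<^sup>2))"
        using \<rho>(1) by (simp add: sum_distrib_left sum_nonneg flip: ennreal_mult)
    qed
    also have "\<dots> = (\<Sum>j\<in>J. \<Sum>A\<in>Pow {1..n}. ennreal (2 ^ n * (walsh_coeff n (k j) A)\<^sup>2) * (\<integral>\<^sup>+t. ennreal (\<rho> t * (m t (card A))\<^sup>2) \<partial>lborel))"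
      by (simp add: nn_integral_sum nn_integral_cmult)
    also have "\<dots> \<le> (\<Sum>j\<in>J. \<Sum>A\<in>Pow {1..n}. ennreal (2 ^ n * (walsh_coeff n (k j) A)\<^sup>2) * ennreal \<beta>)"
      by (intro sum_mono mult_left_mono L2) auto
    also have "\<dots> = ennreal (\<beta> * (\<Sum>x\<in>cube n. \<Sum>j\<in>J. (k j x)\<^sup>2))"
      unfolding pars using \<beta> by (simp add: sum_distrib_left sum_nonneg mult_ac flip: ennreal_mult)
    also have "(\<Sum>x\<in>cube n. \<Sum>j\<in>J. (k j x)\<^sup>2) = (\<Sum>x\<in>cube n. (L2_set (\<lambda>j. k j x) J)\<^sup>2)"
      unfolding L2_set_def by (simp add: sum_nonneg)
    finally show ?thesis .
  qed
  show ?thesis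
  proof (cases "q = 2")
    case True
    have "N k t x \<ge> 0" for k t x by (simp add: N_def)
    then have e: "N k t x powr q = (N k t x)\<^sup>2" "L2_set (\<lambda>j. k j x) J powr q = (L2_set (\<lambda>j. k j x) J)\<^sup>2" for k t x
      using True by (simp_all add: powr_numeral)
    show ?thesis unfolding e by (rule strong2)
  next
    case False
    then have q2: "q > 2" using q by simp
    define H where "H x = L2_set (\<lambda>j. h j x) J" for x
    have H0: "H x \<ge> 0" for x by (simp add: H_def)
    have trunc: "(\<Sum>x\<in>cube n. \<integral>\<^sup>+t. ennreal (\<rho> t * (max 0 (N h t x - s))\<^sup>2) \<partial>lborel)
       \<le> ennreal (\<beta> * (\<Sum>x\<in>cube n. (max 0 (H x - s))\<^sup>2))" if s: "s > 0" for s
    proof -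
      \<comment> \<open>where H vanishes, division by zero makes this 1, which is harmless as h is 0 there\<close>
      define c where "c x = max 0 (1 - s / H x)" for x
      define k where "k j x = c x * h j x" for j x
      have cs: "L2_set (\<lambda>j. r * h j x) J = \<bar>r\<bar> * H x" for r x
        unfolding H_def L2_set_def by (simp add: power_mult_distrib real_sqrt_mult flip: sum_distrib_left)
      have kn: "L2_set (\<lambda>j. k j x) J = max 0 (H x - s)" for x
      proof (cases "H x > s")
        case True
        then show ?thesis using s unfolding k_def cs by (simp add: c_def field_simps)
      next
        case False
        then have "c x = 0 \<or> H x = 0" using s H0[of x] by (auto simp: c_def max_def field_simps)
        then show ?thesis using False unfolding k_def cs by auto
      qed
      have small: "L2_set (\<lambda>j. h j x - k j x) J \<le> s" for x
      proof -
        have "L2_set (\<lambda>j. h j x - k j x) J = L2_set (\<lambda>j. (1 - c x) * h j x) J"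
          by (simp add: k_def algebra_simps)
        also have "\<dots> = \<bar>1 - c x\<bar> * H x" by (rule cs)
        also have "\<dots> \<le> s"
          using s H0[of x] by (cases "H x > s") (auto simp: c_def max_def field_simps abs_if)
        finally show ?thesis .
      qed
      have "N h t x - s \<le> N k t x" if t: "\<rho> t \<noteq> 0" and x: "x \<in> cube n" for t x
      proof -
        have "N h t x = L2_set (\<lambda>j. multiplier n (m t) (\<lambda>x. h j x - k j x) x + multiplier n (m t) (k j) x) J"
          unfolding N_def by (simp add: multiplier_diff)
        also have "\<dots> \<le> N (\<lambda>j x. h j x - k j x) t x + N k t x"
          unfolding N_def by (rule L2_set_triangle_ineq)
        also have "N (\<lambda>j x. h j x - k j x) t x \<le> s" by (rule sup[OF t x]) (rule small)
        finally show ?thesis by simp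
      qed
      then have le: "\<rho> t * (max 0 (N h t x - s))\<^sup>2 \<le> \<rho> t * (N k t x)\<^sup>2" if "x \<in> cube n" for t x
        using that \<rho>(1)[of t] by (cases "\<rho> t = 0") (auto intro!: mult_left_mono power_mono simp: N_def)
      have "(\<Sum>x\<in>cube n. \<integral>\<^sup>+t. ennreal (\<rho> t * (max 0 (N h t x - s))\<^sup>2) \<partial>lborel)
         \<le> (\<Sum>x\<in>cube n. \<integral>\<^sup>+t. ennreal (\<rho> t * (N k t x)\<^sup>2) \<partial>lborel)"
        by (intro sum_mono nn_integral_mono ennreal_leI le)
      also note strong2
      finally show ?thesis unfolding kn .
    qed
    let ?w = "\<lambda>s. indicator {0<..} s * s powr (q - 3) :: real"
    have lay: "(\<integral>\<^sup>+s. ennreal (?w s) * ennreal (r * (max 0 (y - s))\<^sup>2) \<partial>lborel) = ennreal (layer_const q) * ennreal (r * y powr q)"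
      if "r \<ge> 0" "y \<ge> 0" for r y
    proof -
      have "(\<integral>\<^sup>+s. ennreal (?w s) * ennreal (r * (max 0 (y - s))\<^sup>2) \<partial>lborel) =
        (\<integral>\<^sup>+s. ennreal r * ennreal (indicator {0<..} s * (s powr (q - 3) * (max 0 (y - s))\<^sup>2)) \<partial>lborel)"
        using that by (intro nn_integral_cong) (simp add: mult_ac flip: ennreal_mult)
      also have "\<dots> = ennreal r * ennreal (layer_const q * y powr q)"
        by (subst nn_integral_cmult) (use layer_cake[OF q2 that(2)] in simp_all)
      finally show ?thesis using that layer_const_pos[OF q2] by (simp add: mult_ac flip: ennreal_mult)
    qed
    have "ennreal (layer_const q) * (\<Sum>x\<in>cube n. \<integral>\<^sup>+t. ennreal (\<rho> t * N h t x powr q) \<partial>lborel)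
       = (\<Sum>x\<in>cube n. \<integral>\<^sup>+t. (\<integral>\<^sup>+s. ennreal (?w s) * ennreal (\<rho> t * (max 0 (N h t x - s))\<^sup>2) \<partial>lborel) \<partial>lborel)"
      by (subst lay) (simp_all add: N_def[symmetric] \<rho> sum_distrib_left nn_integral_cmult, simp add: N_def)
    also have "\<dots> = (\<Sum>x\<in>cube n. \<integral>\<^sup>+s. (\<integral>\<^sup>+t. ennreal (?w s) * ennreal (\<rho> t * (max 0 (N h t x - s))\<^sup>2) \<partial>lborel) \<partial>lborel)"
      by (intro sum.cong refl lborel_pair.Fubini') measurable
    also have "\<dots> = (\<integral>\<^sup>+s. ennreal (?w s) * (\<Sum>x\<in>cube n. \<integral>\<^sup>+t. ennreal (\<rho> t * (max 0 (N h t x - s))\<^sup>2) \<partial>lborel) \<partial>lborel)"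
      by (simp add: nn_integral_sum nn_integral_cmult sum_distrib_left)
    also have "\<dots> \<le> (\<integral>\<^sup>+s. ennreal (?w s) * ennreal (\<beta> * (\<Sum>x\<in>cube n. (max 0 (H x - s))\<^sup>2)) \<partial>lborel)"
    proof (rule nn_integral_mono)
      fix s show "ennreal (?w s) * (\<Sum>x\<in>cube n. \<integral>\<^sup>+t. ennreal (\<rho> t * (max 0 (N h t x - s))\<^sup>2) \<partial>lborel)
         \<le> ennreal (?w s) * ennreal (\<beta> * (\<Sum>x\<in>cube n. (max 0 (H x - s))\<^sup>2))"
        using trunc[of s] by (cases "s > 0") (auto intro!: mult_left_mono)
    qed
    also have "\<dots> = (\<Sum>x\<in>cube n. \<integral>\<^sup>+s. ennreal (?w s) * ennreal (\<beta> * (max 0 (H x - s))\<^sup>2) \<partial>lborel)"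
    proof -
      have "ennreal (\<beta> * (\<Sum>x\<in>cube n. (max 0 (H x - s))\<^sup>2)) = (\<Sum>x\<in>cube n. ennreal (\<beta> * (max 0 (H x - s))\<^sup>2))" for s
        using \<beta> by (simp add: sum_distrib_left sum_ennreal)
      then show ?thesis by (simp add: sum_distrib_left nn_integral_sum)
    qed
    also have "\<dots> = ennreal (layer_const q) * ennreal (\<beta> * (\<Sum>x\<in>cube n. H x powr q))"
      unfolding lay[OF \<beta> H0] using \<beta> by (simp add: sum_distrib_left flip: sum_ennreal)
    finally show ?thesis
      using layer_const_pos[OF q2] by (subst (asm) ennreal_mult_le_mult_iff) (auto simp: H_def)
  qed
qed

lemma multiplier_symbol_scale: "multiplier n (\<lambda>k. c * m k) f x = c * multiplier n m f x"
  by (simp add: multiplier_def sum_distrib_left mult_ac)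

lemma L2_set_cmult: "L2_set (\<lambda>j. c * f j) J = \<bar>c\<bar> * L2_set f J"
  unfolding L2_set_def by (simp add: power_mult_distrib real_sqrt_mult flip: sum_distrib_left)

lemma scaled_poisson_deriv_contraction:
  assumes "t \<ge> 0" "x \<in> cube n" "\<And>y. y \<in> cube n \<Longrightarrow> L2_set (\<lambda>j. k j y) J \<le> B"
  shows "L2_set (\<lambda>j. multiplier n (\<lambda>i. t / 2 * poisson_deriv t i) (k j) x) J \<le> B"
proof -
  have "t * L2_set (\<lambda>j. multiplier n (poisson_deriv t) (k j) x) J \<le> 2 * B"
    by (rule poisson_deriv_L2_set_le) (fact assms)+
  then show ?thesis using assms(1) unfolding multiplier_symbol_scale L2_set_cmult by simp
qed

text \<open>
  The first nonzero eigenvalue of the Laplacian is \<open>1\<close>, and \<open>u * exp (- t * u)\<close> decreases in \<open>u\<close> for \<open>t * u \<ge> 1\<close>.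
\<close>
lemma poisson_deriv_decay:
  assumes "t \<ge> 1"
  shows "poisson_deriv t k \<le> exp (- t)"
proof (cases "k = 0")
  case False
  define u where "u = sqrt (real k)"
  have u: "u \<ge> 1" using False by (simp add: u_def)
  have "u - 1 \<le> t * (u - 1)" using mult_right_mono[OF assms, of "u - 1"] u by simp
  then have "u \<le> 1 + t * (u - 1)" by simp
  also have "\<dots> \<le> exp (t * (u - 1))" by (rule exp_ge_add_one_self)
  finally have "u * exp (- t * u) \<le> exp (t * (u - 1)) * exp (- t * u)" by (rule mult_right_mono) simp
  also have "\<dots> = exp (- t)" by (simp add: algebra_simps flip: exp_add)
  finally show ?thesis by (simp add: poisson_deriv_def u_def)
qed (simp add: poisson_deriv_def)

text \<open>
  The operator \<open>t / 2 * poisson_deriv t\<close> is a contraction on \<open>Linf\<close> and has norm at most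
  \<open>t / 2 * exp (- t)\<close> on \<open>L2\<close>.
\<close>
lemma mean_poisson_deriv_powr_le:
  fixes h :: "'j \<Rightarrow> (nat \<Rightarrow> real) \<Rightarrow> real"
  assumes t: "t \<ge> 1" and q: "q \<ge> 2" and J: "finite J"
  shows "mean n (\<lambda>x. L2_set (\<lambda>j. multiplier n (poisson_deriv t) (h j) x) J powr q)
    \<le> (2 / t) powr (q - 2) * exp (- 2 * t) * mean n (\<lambda>x. L2_set (\<lambda>j. h j x) J powr q)"
proof -
  define D where "D x = L2_set (\<lambda>j. multiplier n (poisson_deriv t) (h j) x) J" for x
  define H where "H x = L2_set (\<lambda>j. h j x) J" for x
  define \<beta> where "\<beta> = t\<^sup>2 * exp (- 2 * t) / 4"
  have const: "(\<integral>\<^sup>+(s::real). ennreal (indicator {0..1} s * c) \<partial>lborel) = ennreal c" if "c \<ge> 0" for c :: real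
    using nn_integral_interval[of "{0..1}" "\<lambda>s. c" c] has_integral_const_real[of c 0 1] that by simp
  have "(\<Sum>x\<in>cube n. \<integral>\<^sup>+(s::real). ennreal (indicator {0..1} s * L2_set (\<lambda>j. multiplier n (\<lambda>i. t / 2 * poisson_deriv t i) (h j) x) J powr q) \<partial>lborel)
      \<le> ennreal (\<beta> * (\<Sum>x\<in>cube n. L2_set (\<lambda>j. h j x) J powr q))"
  proof (rule interpolation_L2_Linf[OF q J])
    fix k :: nat
    have "(t / 2 * poisson_deriv t k)\<^sup>2 \<le> (t / 2 * exp (- t))\<^sup>2"
      using poisson_deriv_decay[OF t, of k] t by (intro power_mono mult_left_mono) (auto simp: poisson_deriv_def)
    also have "\<dots> = \<beta>"
      using exp_double[of "- t"] by (simp add: \<beta>_def power_mult_distrib power_divide)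
    finally show "(\<integral>\<^sup>+(s::real). ennreal (indicator {0..1} s * (t / 2 * poisson_deriv t k)\<^sup>2) \<partial>lborel) \<le> ennreal \<beta>"
      by (subst const) (auto intro: ennreal_leI)
    show "L2_set (\<lambda>j. multiplier n (\<lambda>i. t / 2 * poisson_deriv t i) (k j) x) J \<le> B"
      if "x \<in> cube n" "\<And>y. y \<in> cube n \<Longrightarrow> L2_set (\<lambda>j. k j y) J \<le> B" for k :: "'j \<Rightarrow> (nat \<Rightarrow> real) \<Rightarrow> real" and x B
      using that t by (intro scaled_poisson_deriv_contraction) auto
  qed (auto simp: \<beta>_def)
  also have "(\<Sum>x\<in>cube n. \<integral>\<^sup>+(s::real). ennreal (indicator {0..1} s * L2_set (\<lambda>j. multiplier n (\<lambda>i. t / 2 * poisson_deriv t i) (h j) x) J powr q) \<partial>lborel)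
     = ennreal (\<Sum>x\<in>cube n. (t / 2 * D x) powr q)"
    unfolding multiplier_symbol_scale L2_set_cmult D_def using t by (subst const) simp_all
  finally have le: "(\<Sum>x\<in>cube n. (t / 2 * D x) powr q) \<le> \<beta> * (\<Sum>x\<in>cube n. H x powr q)"
    by (subst (asm) ennreal_le_iff) (auto simp: H_def \<beta>_def intro!: mult_nonneg_nonneg sum_nonneg)
  have "(t / 2) powr q * (\<Sum>x\<in>cube n. D x powr q) \<le> \<beta> * (\<Sum>x\<in>cube n. H x powr q)"
  proof -
    have "(t / 2 * D x) powr q = (t / 2) powr q * D x powr q" for x
      by (rule powr_mult)
    then show ?thesis using le by (simp only: sum_distrib_left)
  qed
  then have 1: "(t / 2) powr q * mean n (\<lambda>x. D x powr q) \<le> \<beta> * mean n (\<lambda>x. H x powr q)"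
    unfolding mean_def by (simp add: divide_right_mono)
  have 2: "(t / 2) powr q = (t / 2) powr (q - 2) * (t / 2)\<^sup>2"
    using t powr_add[of "t / 2" "q - 2" 2] by (simp add: powr_numeral)
  have 3: "\<beta> = (t / 2)\<^sup>2 * exp (- 2 * t)" by (simp add: \<beta>_def power_divide)
  have "(t / 2)\<^sup>2 * ((t / 2) powr (q - 2) * mean n (\<lambda>x. D x powr q)) \<le> (t / 2)\<^sup>2 * (exp (- 2 * t) * mean n (\<lambda>x. H x powr q))"
    using 1 unfolding 2 3 by (simp only: mult_ac)
  then have 4: "(t / 2) powr (q - 2) * mean n (\<lambda>x. D x powr q) \<le> exp (- 2 * t) * mean n (\<lambda>x. H x powr q)"
    using t by (subst (asm) mult_le_cancel_left_pos) auto
  have 5: "(2 / t) powr (q - 2) * (t / 2) powr (q - 2) = 1"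
    using t by (simp flip: powr_mult)
  have "mean n (\<lambda>x. D x powr q) = (2 / t) powr (q - 2) * ((t / 2) powr (q - 2) * mean n (\<lambda>x. D x powr q))"
    using 5 by (simp flip: mult.assoc)
  also have "\<dots> \<le> (2 / t) powr (q - 2) * (exp (- 2 * t) * mean n (\<lambda>x. H x powr q))"
    by (rule mult_left_mono[OF 4]) simp
  finally show ?thesis by (simp add: D_def H_def)
qed

text \<open>
  Interpolation with the scale-invariant measure \<open>dt / t\<close>, for which the square function of
  \<open>t / 2 * poisson_deriv t\<close> has the squared \<open>L2\<close> norm \<open>1 / 16\<close>.
\<close>
lemma integral_poisson_deriv_powr_le:
  fixes h :: "'j \<Rightarrow> (nat \<Rightarrow> real) \<Rightarrow> real"
  assumes T: "T \<ge> 0" and q: "q \<ge> 2" and J: "finite J"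
  shows "(\<lambda>t. t powr (q - 1) * mean n (\<lambda>x. L2_set (\<lambda>j. multiplier n (poisson_deriv t) (h j) x) J powr q)) integrable_on {0..T}" (is ?int)
   and "integral {0..T} (\<lambda>t. t powr (q - 1) * mean n (\<lambda>x. L2_set (\<lambda>j. multiplier n (poisson_deriv t) (h j) x) J powr q))
    \<le> 2 powr q / 16 * mean n (\<lambda>x. L2_set (\<lambda>j. h j x) J powr q)" (is ?le)
proof -
  define D where "D t x = L2_set (\<lambda>j. multiplier n (poisson_deriv t) (h j) x) J" for t x
  define H where "H x = L2_set (\<lambda>j. h j x) J" for x
  define \<rho> :: "real \<Rightarrow> real" where "\<rho> t = indicator {0<..T} t / t" for t
  have pc: "continuous_on S (\<lambda>s. f s powr r)" if "r > 0" "continuous_on S f" "\<And>s. s \<in> S \<Longrightarrow> f s \<ge> 0" for r :: real and f and S :: "real set"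
    using that by (intro continuous_on_powr' continuous_intros) auto
  have Dc: "continuous_on S (\<lambda>t. D t x)" for S x
    unfolding D_def L2_set_def multiplier_def poisson_deriv_def by (intro continuous_intros)
  have cont: "continuous_on {0..T} (\<lambda>t. t powr (q - 1) * D t x powr q)" for x
    using q by (intro continuous_on_mult pc Dc continuous_on_id) (auto simp: D_def)
  then have int: "(\<lambda>t. t powr (q - 1) * D t x powr q) integrable_on {0..T}" for x
    by (rule integrable_continuous_real)
  have eq: "t powr (q - 1) * mean n (\<lambda>x. D t x powr q) = (\<Sum>x\<in>cube n. t powr (q - 1) * D t x powr q) / 2 ^ n" for t
    by (simp add: mean_def sum_distrib_left)
  show ?int
    unfolding D_def[symmetric] eq by (intro integrable_on_divide integrable_sum int) simp
  have "(\<Sum>x\<in>cube n. \<integral>\<^sup>+t. ennreal (\<rho> t * L2_set (\<lambda>j. multiplier n (\<lambda>i. t / 2 * poisson_deriv t i) (h j) x) J powr q) \<partial>lborel)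
      \<le> ennreal (1 / 16 * (\<Sum>x\<in>cube n. L2_set (\<lambda>j. h j x) J powr q))"
  proof (rule interpolation_L2_Linf[OF q J])
    show "0 \<le> \<rho> t" for t by (auto simp: \<rho>_def indicator_def)
    show "\<rho> \<in> borel_measurable borel" unfolding \<rho>_def by measurable
    show "(\<lambda>t. t / 2 * poisson_deriv t k) \<in> borel_measurable borel" for k unfolding poisson_deriv_def by measurable
    show "L2_set (\<lambda>j. multiplier n (\<lambda>i. t / 2 * poisson_deriv t i) (k j) x) J \<le> B"
      if "\<rho> t \<noteq> 0" "x \<in> cube n" "\<And>y. y \<in> cube n \<Longrightarrow> L2_set (\<lambda>j. k j y) J \<le> B" for k :: "'j \<Rightarrow> (nat \<Rightarrow> real) \<Rightarrow> real" and t x B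
      using that by (intro scaled_poisson_deriv_contraction) (auto simp: \<rho>_def indicator_def split: if_splits)
    fix k :: nat
    define u where "u = sqrt (real k)"
    let ?F = "\<lambda>t. - (t * u / 8 + 1 / 16) * exp (- 2 * t * u)"
    have "((\<lambda>t. t / 4 * (u * exp (- t * u))\<^sup>2) has_integral (?F T - ?F 0)) {0..T}"
    proof (rule fundamental_theorem_of_calculus[OF T])
      fix t
      have "(?F has_field_derivative (t / 4 * (u\<^sup>2 * exp (- 2 * t * u)))) (at t)"
        by (auto intro!: derivative_eq_intros simp: field_simps power2_eq_square)
      also have "u\<^sup>2 * exp (- 2 * t * u) = (u * exp (- t * u))\<^sup>2"
        by (simp add: power_mult_distrib mult.assoc flip: exp_double)
      finally show "(?F has_vector_derivative t / 4 * (u * exp (- t * u))\<^sup>2) (at t within {0..T})"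
        by (auto simp: has_real_derivative_iff_has_vector_derivative[symmetric] intro: has_field_derivative_at_within)
    qed
    then have "(\<integral>\<^sup>+t. ennreal (indicator {0..T} t * (t / 4 * (u * exp (- t * u))\<^sup>2)) \<partial>lborel) = ennreal (?F T - ?F 0)"
      by (intro nn_integral_interval) auto
    moreover have "indicator {0..T} t * (t / 4 * (u * exp (- t * u))\<^sup>2) = \<rho> t * (t / 2 * poisson_deriv t k)\<^sup>2" for t
      by (auto simp: \<rho>_def indicator_def poisson_deriv_def u_def power2_eq_square)
    moreover have "?F T - ?F 0 \<le> 1 / 16"
    proof -
      have "0 \<le> (T * u / 8 + 1 / 16) * exp (- 2 * T * u)" using T by (simp add: u_def)
      then show ?thesis by (simp only: mult_minus_left) simp
    qed
    ultimately show "(\<integral>\<^sup>+t. ennreal (\<rho> t * (t / 2 * poisson_deriv t k)\<^sup>2) \<partial>lborel) \<le> ennreal (1 / 16)"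
      by (simp only: ennreal_leI)
  qed simp
  also have "(\<Sum>x\<in>cube n. \<integral>\<^sup>+t. ennreal (\<rho> t * L2_set (\<lambda>j. multiplier n (\<lambda>i. t / 2 * poisson_deriv t i) (h j) x) J powr q) \<partial>lborel)
     = (\<Sum>x\<in>cube n. ennreal (integral {0..T} (\<lambda>t. t powr (q - 1) * D t x powr q) / 2 powr q))"
  proof (intro sum.cong refl)
    fix x
    have "\<rho> t * L2_set (\<lambda>j. multiplier n (\<lambda>i. t / 2 * poisson_deriv t i) (h j) x) J powr q
        = indicator {0..T} t * (t powr (q - 1) * D t x powr q / 2 powr q)" for t
    proof (cases "t > 0")
      case True
      then have "t powr q = t * t powr (q - 1)" using powr_add[of t 1 "q - 1"] by simp
      then show ?thesis using True unfolding multiplier_symbol_scale L2_set_cmult D_def[symmetric]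
        by (simp add: powr_mult powr_divide \<rho>_def indicator_def)
    qed (auto simp: \<rho>_def indicator_def)
    then show "(\<integral>\<^sup>+t. ennreal (\<rho> t * L2_set (\<lambda>j. multiplier n (\<lambda>i. t / 2 * poisson_deriv t i) (h j) x) J powr q) \<partial>lborel)
       = ennreal (integral {0..T} (\<lambda>t. t powr (q - 1) * D t x powr q) / 2 powr q)"
      by (simp only:) (intro nn_integral_interval has_integral_divide integrable_integral int, simp)
  qed
  also have "\<dots> = ennreal (\<Sum>x\<in>cube n. integral {0..T} (\<lambda>t. t powr (q - 1) * D t x powr q) / 2 powr q)"
    by (rule sum_ennreal) (auto intro!: divide_nonneg_nonneg integral_nonneg int)
  finally have *: "(\<Sum>x\<in>cube n. integral {0..T} (\<lambda>t. t powr (q - 1) * D t x powr q) / 2 powr q) \<le> 1 / 16 * (\<Sum>x\<in>cube n. H x powr q)"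
    by (subst (asm) ennreal_le_iff) (auto simp: H_def intro!: sum_nonneg)
  have "integral {0..T} (\<lambda>t. t powr (q - 1) * mean n (\<lambda>x. D t x powr q)) = (\<Sum>x\<in>cube n. integral {0..T} (\<lambda>t. t powr (q - 1) * D t x powr q)) / 2 ^ n"
    unfolding eq by (simp add: integral_sum int)
  also have "\<dots> = 2 powr q * (\<Sum>x\<in>cube n. integral {0..T} (\<lambda>t. t powr (q - 1) * D t x powr q) / 2 powr q) / 2 ^ n"
    by (simp flip: sum_divide_distrib)
  also have "\<dots> \<le> 2 powr q * (1 / 16 * (\<Sum>x\<in>cube n. H x powr q)) / 2 ^ n"
    by (intro divide_right_mono mult_left_mono *) auto
  finally show ?le by (simp add: D_def H_def mean_def)
qed

section \<open>The pairing of a gradient with a vector field\<close>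

lemma powr_half_subadditive:
  fixes f :: "'k \<Rightarrow> real"
  assumes "0 \<le> r" "r \<le> 1" "finite K" "\<And>k. k \<in> K \<Longrightarrow> 0 \<le> f k"
  shows "(\<Sum>k\<in>K. f k) powr r \<le> (\<Sum>k\<in>K. f k powr r)"
  using assms(3,4)
proof (induction K rule: finite_induct)
  case (insert k K)
  have "(f k + sum f K) powr r \<le> f k powr r + sum f K powr r"
  proof (cases "f k + sum f K = 0")
    case False
    let ?s = "f k + sum f K"
    have nn: "0 \<le> f k" "0 \<le> sum f K" using insert by (auto intro: sum_nonneg)
    then have s: "?s > 0" using False by linarith
    have u: "u \<le> u powr r" if "0 \<le> u" "u \<le> 1" for u :: real
      using powr_mono'[of r 1 u] that assms by (cases "u = 0") auto
    have "1 = f k / ?s + sum f K / ?s" using s by (simp flip: add_divide_distrib)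
    also have "\<dots> \<le> (f k / ?s) powr r + (sum f K / ?s) powr r"
      by (intro add_mono u) (use nn s in auto)
    also have "\<dots> = (f k powr r + sum f K powr r) / ?s powr r"
      using nn s by (simp add: powr_divide add_divide_distrib)
    finally show ?thesis using s by (simp add: le_divide_eq)
  qed (auto simp: powr_def)
  also have "sum f K powr r \<le> (\<Sum>k\<in>K. f k powr r)" using insert by simp
  finally show ?case using insert by simp
qed simp

lemma conjugate_exponent:
  fixes p :: real assumes "1 < p" "p \<le> 2" defines "q \<equiv> p / (p - 1)"
  shows "q \<ge> 2" "1 / p + 1 / q = 1" "q * (p - 1) = p" "q / p = q - 1" "q \<le> 2 / (p - 1)"
proof -
  show "q \<le> 2 / (p - 1)" unfolding q_def using assms(1,2) by (intro divide_right_mono) auto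
  show "q \<ge> 2" "1 / p + 1 / q = 1" "q * (p - 1) = p" "q / p = q - 1"
    unfolding q_def using assms(1,2) by (auto simp: divide_simps)
qed

text \<open>
  The family \<open>g\<close> is a complex function in \<open>Lp\<close> and \<open>h\<close> a complex vector field in the dual space; the boolean index
  distinguishes real and imaginary part. The bound \<open>27\<close> is what a sum of three functions of norm at most \<open>1\<close> gives.
\<close>
locale poisson_pairing = poisson_flow n p G "UNIV :: bool set" g "{1..n} \<times> (UNIV :: bool set)" h
  for n p G and g :: "bool \<Rightarrow> (nat \<Rightarrow> real) \<Rightarrow> real" and h :: "nat \<times> bool \<Rightarrow> (nat \<Rightarrow> real) \<Rightarrow> real" +
  assumes mean_G_le: "mean n (\<lambda>x. G x powr p) \<le> 27"
    and hq: "mean n (\<lambda>x. L2_set (\<lambda>j. h j x) ({1..n} \<times> UNIV) powr (p / (p - 1))) \<le> 1"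
begin

definition pairing :: "real \<Rightarrow> (nat \<Rightarrow> real) \<Rightarrow> real" where
  "pairing t x = (\<Sum>(k, b)\<in>{1..n} \<times> UNIV. half_diff k (U t b) x * multiplier n (poisson_deriv t) (h (k, b)) x)"

definition D :: "real \<Rightarrow> (nat \<Rightarrow> real) \<Rightarrow> real" where
  "D t x = L2_set (\<lambda>j. multiplier n (poisson_deriv t) (h j) x) ({1..n} \<times> UNIV)"

definition jump_sq :: "real \<Rightarrow> nat \<Rightarrow> (nat \<Rightarrow> real) \<Rightarrow> real" where
  "jump_sq t k x = (\<Sum>b\<in>UNIV. (half_diff k (U t b) x)\<^sup>2)"

text \<open>
  Edges on which the majorant \<open>W\<close> does not more than double, and the others. The two kinds have different homogeneity: on small edges
  the weight \<open>max W W' powr (p - 2)\<close> of \<open>jumps\<close> is comparable to \<open>W powr (p - 2)\<close> at the base point, and the gradient is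
  controlled by its weighted square function. On large edges no such comparison is possible, and the gradient is
  controlled in the power \<open>p\<close>.
\<close>
definition small :: "real \<Rightarrow> (nat \<Rightarrow> real) \<Rightarrow> nat set" where
  "small t x = {k \<in> {1..n}. W t (flip k x) \<le> 2 * W t x}"

definition large :: "real \<Rightarrow> (nat \<Rightarrow> real) \<Rightarrow> nat set" where
  "large t x = {k \<in> {1..n}. 2 * W t x < W t (flip k x)}"

lemma jump_sq_nonneg: "jump_sq t k x \<ge> 0" by (simp add: jump_sq_def sum_nonneg)

lemma pairing_le: "pairing t x \<le> (sqrt (\<Sum>k\<in>small t x. jump_sq t k x) + sqrt (\<Sum>k\<in>large t x. jump_sq t k x)) * D t x"
proof -
  have "pairing t x \<le> L2_set (\<lambda>(k, b). half_diff k (U t b) x) ({1..n} \<times> UNIV) * D t x"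
  proof -
    have "pairing t x \<le> (\<Sum>j\<in>{1..n} \<times> UNIV. \<bar>(case j of (k, b) \<Rightarrow> half_diff k (U t b) x)\<bar> * \<bar>multiplier n (poisson_deriv t) (h j) x\<bar>)"
      unfolding pairing_def by (intro sum_mono) (auto simp flip: abs_mult)
    also have "\<dots> \<le> L2_set (\<lambda>(k, b). half_diff k (U t b) x) ({1..n} \<times> UNIV) * D t x"
      unfolding D_def by (rule L2_set_mult_ineq)
    finally show ?thesis .
  qed
  also have "L2_set (\<lambda>(k, b). half_diff k (U t b) x) ({1..n} \<times> UNIV) = sqrt (\<Sum>k\<in>{1..n}. jump_sq t k x)"
    unfolding L2_set_def jump_sq_def sum.cartesian_product by (simp add: case_prod_beta)
  also have "(\<Sum>k\<in>{1..n}. jump_sq t k x) = (\<Sum>k\<in>small t x. jump_sq t k x) + (\<Sum>k\<in>large t x. jump_sq t k x)"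
    by (subst sum.union_disjoint[symmetric]) (auto simp: small_def large_def intro!: sum.cong)
  also have "sqrt \<dots> \<le> sqrt (\<Sum>k\<in>small t x. jump_sq t k x) + sqrt (\<Sum>k\<in>large t x. jump_sq t k x)"
    by (intro sqrt_add_le_add_sqrt sum_nonneg jump_sq_nonneg)
  finally show ?thesis by (simp add: mult_right_mono D_def)
qed

lemma small_le:
  assumes t: "t \<ge> 0" and x: "x \<in> cube n"
  shows "(\<Sum>k\<in>small t x. jump_sq t k x) \<le> 2 * W t x powr (2 - p) * jumps t x"
proof -
  have w: "W t x > 0" by (rule W_pos[OF t x])
  have "(\<Sum>k\<in>small t x. jump_sq t k x) \<le> (\<Sum>k\<in>small t x. 2 * W t x powr (2 - p) *
       (max (W t x) (W t (flip k x)) powr (p - 2) * (jump_sq t k x + (half_diff k (W t) x)\<^sup>2)))"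
  proof (rule sum_mono)
    fix k assume k: "k \<in> small t x"
    let ?m = "max (W t x) (W t (flip k x))"
    have "?m \<le> 2 * W t x" using k w by (auto simp: small_def)
    then have "(2 * W t x) powr (p - 2) \<le> ?m powr (p - 2)"
      using p w by (intro powr_mono2') auto
    moreover have "(2 * W t x) powr (p - 2) = 2 powr (p - 2) * W t x powr (p - 2)"
      using w by (simp add: powr_mult)
    moreover have "1 / 2 \<le> (2 :: real) powr (p - 2)"
      using powr_mono[of "-1" "p - 2" 2] p by (simp add: powr_minus_divide)
    ultimately have "1 / 2 * W t x powr (p - 2) \<le> ?m powr (p - 2)"
      using mult_right_mono[of "1/2" "2 powr (p - 2)" "W t x powr (p - 2)"] by simp
    then have "2 * W t x powr (2 - p) * (1 / 2 * W t x powr (p - 2)) \<le> 2 * W t x powr (2 - p) * ?m powr (p - 2)"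
      by (intro mult_left_mono) auto
    moreover have "2 * W t x powr (2 - p) * (1 / 2 * W t x powr (p - 2)) = 1"
      using w by (simp flip: powr_add)
    ultimately have c: "1 \<le> 2 * W t x powr (2 - p) * ?m powr (p - 2)" by simp
    have "jump_sq t k x \<le> 1 * (jump_sq t k x + (half_diff k (W t) x)\<^sup>2)" by simp
    also have "\<dots> \<le> (2 * W t x powr (2 - p) * ?m powr (p - 2)) * (jump_sq t k x + (half_diff k (W t) x)\<^sup>2)"
      by (rule mult_right_mono[OF c]) (simp add: jump_sq_nonneg)
    finally show "jump_sq t k x \<le> 2 * W t x powr (2 - p) * (?m powr (p - 2) * (jump_sq t k x + (half_diff k (W t) x)\<^sup>2))"
      by (simp add: mult.assoc)
  qed
  also have "\<dots> \<le> (\<Sum>k\<in>{1..n}. 2 * W t x powr (2 - p) *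
       (max (W t x) (W t (flip k x)) powr (p - 2) * (jump_sq t k x + (half_diff k (W t) x)\<^sup>2)))"
    by (rule sum_mono2) (auto simp: small_def intro!: mult_nonneg_nonneg add_nonneg_nonneg jump_sq_nonneg)
  also have "\<dots> = 2 * W t x powr (2 - p) * jumps t x"
    unfolding jumps_def jump_sq_def by (simp only: sum_distrib_left)
  finally show ?thesis .
qed

text \<open>
  On a large edge the difference of \<open>W\<close> is comparable to its value at the far end, which dominates the difference of
  \<open>U\<close>. So \<open>U\<close> itself does not have to jump: the dissipation of \<open>W\<close> pays for the edge.
\<close>
lemma large_le:
  assumes t: "t \<ge> 0" and x: "x \<in> cube n"
  shows "sqrt (\<Sum>k\<in>large t x. jump_sq t k x) powr p \<le> 16 * jumps t x"
proof -
  have "sqrt (\<Sum>k\<in>large t x. jump_sq t k x) powr p = (\<Sum>k\<in>large t x. jump_sq t k x) powr (p / 2)"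
    by (simp add: powr_half_sqrt[symmetric] powr_powr sum_nonneg jump_sq_nonneg)
  also have "\<dots> \<le> (\<Sum>k\<in>large t x. jump_sq t k x powr (p / 2))"
    by (rule powr_half_subadditive) (use p in \<open>auto simp: jump_sq_nonneg large_def\<close>)
  also have "\<dots> \<le> (\<Sum>k\<in>large t x. 16 * (max (W t x) (W t (flip k x)) powr (p - 2) * (jump_sq t k x + (half_diff k (W t) x)\<^sup>2)))"
  proof (rule sum_mono)
    fix k assume k: "k \<in> large t x"
    let ?y = "flip k x"
    let ?M = "W t ?y"
    have y: "?y \<in> cube n" using k x flip_in_cube by (auto simp: large_def)
    have w: "W t x > 0" "?M > 0" using W_pos[OF t x] W_pos[OF t y] by auto
    have big: "2 * W t x < ?M" using k by (simp add: large_def)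
    have "sqrt (jump_sq t k x) = L2_set (\<lambda>b. (1/2) * (U t b x + (-1) * U t b ?y)) UNIV"
      unfolding jump_sq_def L2_set_def half_diff_def by (simp add: field_simps)
    also have "\<dots> = (1/2) * L2_set (\<lambda>b. U t b x + (-1) * U t b ?y) UNIV"
      by (subst L2_set_cmult) simp
    also have "\<dots> \<le> (1/2) * (L2_set (\<lambda>b. U t b x) UNIV + L2_set (\<lambda>b. (-1) * U t b ?y) UNIV)"
      by (intro mult_left_mono L2_set_triangle_ineq) simp
    also have "L2_set (\<lambda>b. (-1) * U t b ?y) UNIV = L2_set (\<lambda>b. U t b ?y) UNIV"
      by (subst L2_set_cmult) simp
    also have "(1/2) * (L2_set (\<lambda>b. U t b x) UNIV + L2_set (\<lambda>b. U t b ?y) UNIV) \<le> ?M"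
      using U_le_W[OF t x] U_le_W[OF t y] big w by simp
    finally have s: "sqrt (jump_sq t k x) \<le> ?M" .
    have "jump_sq t k x powr (p / 2) = sqrt (jump_sq t k x) powr p"
      by (simp add: powr_half_sqrt[symmetric] powr_powr jump_sq_nonneg)
    also have "\<dots> \<le> ?M powr p" using s p by (intro powr_mono2) (auto simp: jump_sq_nonneg)
    also have "\<dots> = ?M powr (p - 2) * ?M\<^sup>2"
      using w powr_add[of ?M "p - 2" 2] by (simp add: powr_numeral)
    also have "\<dots> \<le> ?M powr (p - 2) * (16 * (half_diff k (W t) x)\<^sup>2)"
    proof (rule mult_left_mono)
      have "?M / 4 \<le> - half_diff k (W t) x"
      proof -
        have "half_diff k (W t) x = W t x / 2 - ?M / 2" by (simp add: half_diff_def diff_divide_distrib)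
        then show ?thesis using big by linarith
      qed
      then have "(?M / 4)\<^sup>2 \<le> (- half_diff k (W t) x)\<^sup>2" using w by (intro power_mono) auto
      then show "?M\<^sup>2 \<le> 16 * (half_diff k (W t) x)\<^sup>2" by (simp add: power_divide)
    qed simp
    also have "\<dots> \<le> ?M powr (p - 2) * (16 * (jump_sq t k x + (half_diff k (W t) x)\<^sup>2))"
      by (intro mult_left_mono) (auto simp: jump_sq_nonneg)
    also have "?M = max (W t x) ?M" using big w by simp
    finally show "jump_sq t k x powr (p / 2) \<le> 16 * (max (W t x) ?M powr (p - 2) * (jump_sq t k x + (half_diff k (W t) x)\<^sup>2))"
      by (simp add: algebra_simps)
  qed
  also have "\<dots> \<le> (\<Sum>k\<in>{1..n}. 16 * (max (W t x) (W t (flip k x)) powr (p - 2) * (jump_sq t k x + (half_diff k (W t) x)\<^sup>2)))"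
    by (rule sum_mono2) (auto simp: large_def intro!: mult_nonneg_nonneg add_nonneg_nonneg jump_sq_nonneg)
  also have "\<dots> = 16 * jumps t x"
    unfolding jumps_def jump_sq_def by (simp only: sum_distrib_left)
  finally show ?thesis .
qed

definition q where "q = p / (p - 1)"

lemmas q_facts = conjugate_exponent[OF p, folded q_def]
lemmas h_norm_le_1 = hq[folded q_def]

lemma q_identities: "(1 - 2 / q) * q = q - 2" "- 2 * t / q * q = - 2 * t" "4 / p - 1 - (2 - 4 / q) = 1" "q > 0"
    "q * ((2 - p) / p) = q - 2" "p * (2 / q) = 2 * p - 2"
proof -
  show q0: "q > 0" using q_facts(1) by simp
  show "(1 - 2 / q) * q = q - 2" "- 2 * t / q * q = - 2 * t" using q0 by (auto simp: field_simps)
  have "4 / p + 4 / q = 4 * (1 / p + 1 / q)" by simp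
  then show "4 / p - 1 - (2 - 4 / q) = 1" unfolding q_facts(2) by simp
  have "q * ((2 - p) / p) = 2 * (q / p) - q" using p by (simp add: field_simps)
  then show "q * ((2 - p) / p) = q - 2" unfolding q_facts(4) by simp
  have "p * (2 / q) = 2 * (q * (p - 1)) / q" unfolding q_facts(3) by simp
  then show "p * (2 / q) = 2 * p - 2" using q0 by simp
qed

lemma D_nonneg: "D t x \<ge> 0" by (simp add: D_def)

lemma D_sq: "(D t x)\<^sup>2 = (\<Sum>j\<in>{1..n} \<times> UNIV. (dV t j x)\<^sup>2)"
  unfolding D_def L2_set_def dV_def by (simp add: sum_nonneg)

text \<open>
  Young's inequality with the exponents \<open>p\<close> and \<open>q\<close>. It splits \<open>t powr (2 / p)\<close> evenly and leaves the weight \<open>t\<close> of the dissipation, which is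
  exactly where the power \<open>1 / p\<close> of the Laplacian is needed.
\<close>
lemma large_part:
  assumes t: "t \<ge> 0" and x: "x \<in> cube n"
  shows "t powr (2 / p) * (sqrt (\<Sum>k\<in>large t x. jump_sq t k x) * D t x) \<le> 64 * t * jumps t x + (1 / 2 powr q) * (t powr (q - 1) * D t x powr q)"
proof -
  define L where "L = sqrt (\<Sum>k\<in>large t x. jump_sq t k x)"
  have L: "L \<ge> 0" unfolding L_def by (simp add: sum_nonneg jump_sq_nonneg)
  note q = q_facts
  have "t powr (2 / p) * (L * D t x) = (2 * t powr (1 / p) * L) * (t powr (1 / p) * D t x / 2)"
    using powr_add[of t "1 / p" "1 / p"] by (simp add: add_divide_distrib[symmetric])
  also have "\<dots> \<le> (2 * t powr (1 / p) * L) powr p / p + (t powr (1 / p) * D t x / 2) powr q / q"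
    by (rule Youngs_inequality) (use p q L D_nonneg in auto)
  also have "(2 * t powr (1 / p) * L) powr p = 2 powr p * (t * L powr p)"
    using t L p by (simp add: powr_mult powr_powr)
  also have "2 powr p * (t * L powr p) / p \<le> 4 * (t * (16 * jumps t x))"
  proof -
    have "2 powr p * (t * L powr p) / p \<le> 2 powr p * (t * L powr p) / 1"
      using p t by (intro divide_left_mono) auto
    also have "\<dots> \<le> 2 powr 2 * (t * L powr p)"
      using p t by (simp only: div_by_1) (intro mult_right_mono powr_mono, auto)
    also have "\<dots> \<le> 4 * (t * (16 * jumps t x))"
      using large_le[OF t x] t unfolding L_def by (intro mult_mono mult_left_mono) (auto simp: jumps_nonneg)
    finally show ?thesis .
  qed
  also have "(t powr (1 / p) * D t x / 2) powr q = t powr (q - 1) * D t x powr q / 2 powr q"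
    using t D_nonneg[of t x] q(4) p by (simp add: powr_mult powr_divide powr_powr)
  also have "t powr (q - 1) * D t x powr q / 2 powr q / q \<le> t powr (q - 1) * D t x powr q / 2 powr q / 1"
    using q(1) by (intro divide_left_mono) auto
  finally show ?thesis by (simp add: L_def)
qed

text \<open>
  The homogeneity of the small edges would ask for the weight \<open>t\<close>; for \<open>t \<le> 1\<close> it dominates \<open>t powr (2 / p)\<close>.
\<close>
lemma small_part_le_1:
  assumes t: "0 \<le> t" "t \<le> 1" and x: "x \<in> cube n"
  shows "t powr (2 / p) * (sqrt (\<Sum>k\<in>small t x. jump_sq t k x) * D t x) \<le> 2 * t * dissipation t x"
proof -
  let ?w = "W t x powr (2 - p)"
  have "sqrt (\<Sum>k\<in>small t x. jump_sq t k x) \<le> sqrt (2 * jumps t x * ?w)"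
    using small_le[OF t(1) x] by (simp add: mult_ac)
  then have "sqrt (\<Sum>k\<in>small t x. jump_sq t k x) * D t x \<le> sqrt (2 * jumps t x * ?w) * D t x"
    by (rule mult_right_mono) (rule D_nonneg)
  also have "\<dots> = sqrt (2 * jumps t x) * (sqrt ?w * D t x)" by (simp add: real_sqrt_mult)
  also have "\<dots> \<le> ((sqrt (2 * jumps t x))\<^sup>2 + (sqrt ?w * D t x)\<^sup>2) / 2"
    using sum_squares_bound[of "sqrt (2 * jumps t x)" "sqrt ?w * D t x"] by simp
  also have "\<dots> = jumps t x + ?w * (D t x)\<^sup>2 / 2"
    by (simp add: power_mult_distrib jumps_nonneg)
  also have "\<dots> \<le> 2 * dissipation t x"
    unfolding dissipation_def D_sq[symmetric] by (simp add: jumps_nonneg)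
  finally have 1: "sqrt (\<Sum>k\<in>small t x. jump_sq t k x) * D t x \<le> 2 * dissipation t x" .
  have 2: "t powr (2 / p) \<le> t"
    using powr_mono'[of 1 "2 / p" t] t p by (cases "t = 0") auto
  have "t powr (2 / p) * (sqrt (\<Sum>k\<in>small t x. jump_sq t k x) * D t x) \<le> t * (2 * dissipation t x)"
    using 1 2 t by - (rule mult_mono, auto intro!: mult_nonneg_nonneg D_nonneg sum_nonneg jump_sq_nonneg)
  then show ?thesis by simp
qed

lemma weighted_young:
  fixes w y :: real
  assumes "w > 0" "y \<ge> 0"
  shows "w powr (2 - p) * y\<^sup>2 \<le> w powr p + y powr q"
proof (cases "y = 0")
  case False
  have y: "y > 0" using False assms by simp
  have yq: "y powr q > 0" using y by simp
  show ?thesis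
  proof (cases "y powr q \<le> w powr p")
    case True
    have "y\<^sup>2 = (y powr q) powr (2 / q)"
      using y q_identities(4) by (simp add: powr_powr powr_numeral)
    also have "\<dots> \<le> (w powr p) powr (2 / q)" using True q_facts(1) by (intro powr_mono2) auto
    also have "\<dots> = w powr (2 * p - 2)" unfolding powr_powr q_identities(6) ..
    finally have "w powr (2 - p) * y\<^sup>2 \<le> w powr (2 - p) * w powr (2 * p - 2)" by (rule mult_left_mono) simp
    also have "\<dots> = w powr p" by (simp flip: powr_add)
    finally show ?thesis using yq by linarith
  next
    case False
    have "w powr (2 - p) = (w powr p) powr ((2 - p) / p)" using p by (simp add: powr_powr)
    also have "\<dots> \<le> (y powr q) powr ((2 - p) / p)" using False p by (intro powr_mono2) auto
    also have "\<dots> = y powr (q - 2)"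
      unfolding powr_powr q_identities(5) ..
    finally have "w powr (2 - p) * y\<^sup>2 \<le> y powr (q - 2) * y\<^sup>2" by (rule mult_right_mono) simp
    also have "\<dots> = y powr q" using y powr_add[of y "q - 2" 2] by (simp add: powr_numeral)
    finally show ?thesis using assms powr_ge_zero[of w p] by linarith
  qed
qed (use assms in simp)

text \<open>
  For large times the excess \<open>t powr (2 / p - 1)\<close> is paid by the exponential decay of \<open>D t\<close>. The number \<open>\<epsilon>\<close> bounds the operator
  norm of \<open>poisson_deriv t\<close> on \<open>Lq\<close>, and \<open>weighted_young\<close> is applied to \<open>D t x / \<epsilon>\<close>.
\<close>
lemma small_part_ge_1:
  assumes t: "t \<ge> 1" and x: "x \<in> cube n"
  defines "\<epsilon> \<equiv> (2 / t) powr (1 - 2 / q) * exp (- 2 * t / q)"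
  shows "t powr (2 / p) * (sqrt (\<Sum>k\<in>small t x. jump_sq t k x) * D t x) \<le>
     t * jumps t x + 2 * t * exp (- 4 * t / q) * (W t x powr p + D t x powr q / \<epsilon> powr q)"
proof -
  let ?w = "W t x powr (2 - p)"
  have t0: "t \<ge> 0" "t > 0" using t by auto
  have e: "\<epsilon> > 0" using t0 by (simp add: \<epsilon>_def)
  have "sqrt (\<Sum>k\<in>small t x. jump_sq t k x) \<le> sqrt (2 * jumps t x * ?w)"
    using small_le[OF t0(1) x] by (simp add: mult_ac)
  then have "sqrt (\<Sum>k\<in>small t x. jump_sq t k x) * D t x \<le> sqrt (2 * jumps t x * ?w) * D t x"
    by (rule mult_right_mono) (rule D_nonneg)
  then have "t powr (2 / p) * (sqrt (\<Sum>k\<in>small t x. jump_sq t k x) * D t x) \<le> t powr (2 / p) * (sqrt (2 * jumps t x * ?w) * D t x)"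
    by (rule mult_left_mono) simp
  also have pw: "t powr (2 / p) = sqrt t * t powr (2 / p - 1 / 2)"
    using t0 by (simp add: powr_half_sqrt[symmetric] flip: powr_add)
  also have "sqrt t * t powr (2 / p - 1 / 2) * (sqrt (2 * jumps t x * ?w) * D t x)
     = sqrt (2 * t * jumps t x) * (t powr (2 / p - 1 / 2) * sqrt ?w * D t x)"
    by (simp add: real_sqrt_mult)
  also have "\<dots> \<le> ((sqrt (2 * t * jumps t x))\<^sup>2 + (t powr (2 / p - 1 / 2) * sqrt ?w * D t x)\<^sup>2) / 2"
    using sum_squares_bound[of "sqrt (2 * t * jumps t x)" "t powr (2 / p - 1 / 2) * sqrt ?w * D t x"] by simp
  also have "\<dots> = t * jumps t x + (t powr (2 / p - 1 / 2))\<^sup>2 * (?w * (D t x)\<^sup>2) / 2"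
    using t0 by (simp add: power_mult_distrib jumps_nonneg)
  also have "?w * (D t x)\<^sup>2 = \<epsilon>\<^sup>2 * (?w * (D t x / \<epsilon>)\<^sup>2)" using e by (simp add: power_divide)
  also have "(t powr (2 / p - 1 / 2))\<^sup>2 * (\<epsilon>\<^sup>2 * (?w * (D t x / \<epsilon>)\<^sup>2)) / 2
      \<le> (2 * t * exp (- 4 * t / q)) * (W t x powr p + (D t x / \<epsilon>) powr q)"
  proof -
    have a: "(t powr (2 / p - 1 / 2))\<^sup>2 = t powr (4 / p - 1)"
      using t0 by (simp add: power2_eq_square flip: powr_add)
    have b: "\<epsilon>\<^sup>2 = (2 / t) powr (2 - 4 / q) * exp (- 4 * t / q)"
    proof -
      have "(exp (- 2 * t / q))\<^sup>2 = exp (- 4 * t / q)" using exp_double[of "- 2 * t / q", symmetric] by (simp only: ) simp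
      moreover have "((2 / t) powr (1 - 2 / q))\<^sup>2 = (2 / t) powr (2 - 4 / q)"
        by (simp add: power2_eq_square flip: powr_add)
      ultimately show ?thesis by (simp add: \<epsilon>_def power_mult_distrib)
    qed
    have c: "t powr (4 / p - 1) * (2 / t) powr (2 - 4 / q) \<le> 4 * t"
    proof -
      note ex = q_identities(3)
      have "t powr (4 / p - 1) * (2 / t) powr (2 - 4 / q) = 2 powr (2 - 4 / q) * t powr (4 / p - 1 - (2 - 4 / q))"
      proof -
        have "t powr u * (2 / t) powr v = 2 powr v * t powr (u - v)" for u v
          using t0 by (simp add: powr_divide powr_diff)
        then show ?thesis .
      qed
      also have "\<dots> \<le> 2 powr 2 * t"
        unfolding ex using t0 q_facts(1) by (intro mult_mono powr_mono) auto
      finally show ?thesis by simp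
    qed
    have "(t powr (2 / p - 1 / 2))\<^sup>2 * \<epsilon>\<^sup>2 / 2 \<le> 2 * t * exp (- 4 * t / q)"
      unfolding a b using mult_right_mono[OF c, of "exp (- 4 * t / q)"] by simp
    then have "(t powr (2 / p - 1 / 2))\<^sup>2 * \<epsilon>\<^sup>2 / 2 * (?w * (D t x / \<epsilon>)\<^sup>2) \<le> 2 * t * exp (- 4 * t / q) * (W t x powr p + (D t x / \<epsilon>) powr q)"
      by (intro mult_mono weighted_young W_pos[OF t0(1) x]) (use e t0 in \<open>auto simp: D_nonneg\<close>)
    then show ?thesis by (simp add: mult_ac)
  qed
  also have "(D t x / \<epsilon>) powr q = D t x powr q / \<epsilon> powr q" using e by (simp add: powr_divide D_nonneg)
  finally show ?thesis unfolding pw by simp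
qed

lemma mean_D_le:
  assumes t: "t \<ge> 1"
  defines "\<epsilon> \<equiv> (2 / t) powr (1 - 2 / q) * exp (- 2 * t / q)"
  shows "mean n (\<lambda>x. W t x powr p + D t x powr q / \<epsilon> powr q) \<le> 28"
proof -
  have e: "\<epsilon> powr q > 0" using t by (simp add: \<epsilon>_def)
  have eq: "\<epsilon> powr q = (2 / t) powr (q - 2) * exp (- 2 * t)"
  proof -
    have "\<epsilon> powr q = (2 / t) powr ((1 - 2 / q) * q) * exp (- 2 * t / q) powr q"
      by (simp only: \<epsilon>_def powr_mult powr_powr)
    also have "exp (- 2 * t / q) powr q = exp (- 2 * t / q * q)"
      by (simp add: powr_def mult.commute)
    finally show ?thesis unfolding q_identities(1,2) .
  qed
  have "mean n (\<lambda>x. D t x powr q) \<le> \<epsilon> powr q * mean n (\<lambda>x. L2_set (\<lambda>j. h j x) ({1..n} \<times> UNIV) powr q)"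
    unfolding D_def eq by (rule mean_poisson_deriv_powr_le) (use t q_facts in auto)
  also have "\<dots> \<le> \<epsilon> powr q * 1" using h_norm_le_1 e by (intro mult_left_mono) auto
  finally have "mean n (\<lambda>x. D t x powr q) / \<epsilon> powr q \<le> 1" using e by simp
  moreover have "mean n (\<lambda>x. W t x powr p) \<le> 27"
    using mean_poisson_powr_le[of t n G p] one_le_G p t mean_G_le unfolding W_def by force
  ultimately show ?thesis using mean_cmult[of n "1 / \<epsilon> powr q" "\<lambda>x. D t x powr q"] by (simp add: mean_add)
qed

lemma pairing_bound:
  assumes t: "t \<ge> 0"
  shows "t powr (2 / p) * mean n (pairing t) \<le> 67 * (t * mean n (dissipation t))
     + 1 / 2 powr q * (t powr (q - 1) * mean n (\<lambda>x. D t x powr q)) + 56 * (t * exp (- 4 * t / q))"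
proof -
  have 0: "t powr (2 / p) * pairing t x \<le> t powr (2 / p) * (sqrt (\<Sum>k\<in>small t x. jump_sq t k x) * D t x)
     + (64 * (t * dissipation t x) + 1 / 2 powr q * (t powr (q - 1) * D t x powr q))" if x: "x \<in> cube n" for x
  proof -
    have "t powr (2 / p) * pairing t x \<le> t powr (2 / p) * ((sqrt (\<Sum>k\<in>small t x. jump_sq t k x) + sqrt (\<Sum>k\<in>large t x. jump_sq t k x)) * D t x)"
      by (rule mult_left_mono[OF pairing_le]) simp
    also have "\<dots> = t powr (2 / p) * (sqrt (\<Sum>k\<in>small t x. jump_sq t k x) * D t x) + t powr (2 / p) * (sqrt (\<Sum>k\<in>large t x. jump_sq t k x) * D t x)"
      by (simp add: algebra_simps)
    also note large_part[OF t x]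
    also have "64 * t * jumps t x \<le> 64 * (t * dissipation t x)"
    proof -
      have "jumps t x \<le> dissipation t x" unfolding dissipation_def by (simp add: sum_nonneg)
      then show ?thesis using t by (simp add: mult_left_mono)
    qed
    finally show ?thesis by simp
  qed
  let ?R = "\<lambda>x. 64 * (t * dissipation t x) + 1 / 2 powr q * (t powr (q - 1) * D t x powr q)"
  have dn: "mean n (dissipation t) \<ge> 0" by (intro mean_nonneg dissipation_nonneg)
  show ?thesis
  proof (cases "t \<le> 1")
    case True
    have "t powr (2 / p) * pairing t x \<le> 2 * (t * dissipation t x) + ?R x" if x: "x \<in> cube n" for x
      using 0[OF x] small_part_le_1[OF t True x] by simp
    then have "mean n (\<lambda>x. t powr (2 / p) * pairing t x) \<le> mean n (\<lambda>x. 2 * (t * dissipation t x) + ?R x)"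
      by (rule mean_mono)
    then have "t powr (2 / p) * mean n (pairing t) \<le> 2 * (t * mean n (dissipation t)) + (64 * (t * mean n (dissipation t))
       + 1 / 2 powr q * (t powr (q - 1) * mean n (\<lambda>x. D t x powr q)))"
      by (simp only: mean_add mean_cmult)
    moreover have "t * mean n (dissipation t) \<ge> 0" "t * exp (- 4 * t / q) \<ge> 0" using t dn by auto
    ultimately show ?thesis by linarith
  next
    case False
    then have t1: "t \<ge> 1" by simp
    define \<epsilon> where "\<epsilon> = (2 / t) powr (1 - 2 / q) * exp (- 2 * t / q)"
    have "t powr (2 / p) * pairing t x \<le> (t * dissipation t x + 2 * t * exp (- 4 * t / q) * (W t x powr p + D t x powr q / \<epsilon> powr q)) + ?R x" if x: "x \<in> cube n" for x
    proof -
      have "jumps t x \<le> dissipation t x" unfolding dissipation_def by (simp add: sum_nonneg)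
      then have "t * jumps t x \<le> t * dissipation t x" using t by (rule mult_left_mono)
      then show ?thesis using 0[OF x] small_part_ge_1[OF t1 x, folded \<epsilon>_def] by linarith
    qed
    then have "mean n (\<lambda>x. t powr (2 / p) * pairing t x) \<le> mean n (\<lambda>x. (t * dissipation t x + 2 * t * exp (- 4 * t / q) * (W t x powr p + D t x powr q / \<epsilon> powr q)) + ?R x)"
      by (rule mean_mono)
    then have "t powr (2 / p) * mean n (pairing t) \<le> t * mean n (dissipation t) + 2 * t * exp (- 4 * t / q) * mean n (\<lambda>x. W t x powr p + D t x powr q / \<epsilon> powr q) + (64 * (t * mean n (dissipation t))
       + 1 / 2 powr q * (t powr (q - 1) * mean n (\<lambda>x. D t x powr q)))"
      unfolding mean_add[of n "\<lambda>x. t * dissipation t x + 2 * t * exp (- 4 * t / q) * (W t x powr p + D t x powr q / \<epsilon> powr q)"]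
        mean_add[of n "\<lambda>x. t * dissipation t x"] mean_add[of n "\<lambda>x. 64 * (t * dissipation t x)"] mean_cmult .
    moreover have "2 * t * exp (- 4 * t / q) * mean n (\<lambda>x. W t x powr p + D t x powr q / \<epsilon> powr q) \<le> 2 * t * exp (- 4 * t / q) * 28"
      using mean_D_le[OF t1] t by (intro mult_left_mono) (auto simp: \<epsilon>_def)
    moreover have "t * mean n (dissipation t) \<ge> 0" using t dn by auto
    ultimately show ?thesis by linarith
  qed
qed

text \<open>
  The decay rate \<open>4 / q\<close> is of size \<open>p - 1\<close>; this integral is the source of the factor \<open>1 / (p - 1) ^ 2\<close>.
\<close>
lemma exp_tail_integral:
  assumes T: "T \<ge> 0"
  shows "(\<lambda>t. t * exp (- 4 * t / q)) integrable_on {0..T}" "integral {0..T} (\<lambda>t. t * exp (- 4 * t / q)) \<le> q\<^sup>2 / 16"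
proof -
  define c where "c = 4 / q"
  have c: "c > 0" using q_identities(4) by (simp add: c_def)
  let ?F = "\<lambda>t. - (t / c + 1 / c\<^sup>2) * exp (- c * t)"
  have "((\<lambda>t. t * exp (- c * t)) has_integral (?F T - ?F 0)) {0..T}"
  proof (rule fundamental_theorem_of_calculus[OF T])
    fix t
    have "(?F has_field_derivative (t * exp (- c * t))) (at t)"
      using c by (auto intro!: derivative_eq_intros simp: field_simps power2_eq_square)
    then show "(?F has_vector_derivative t * exp (- c * t)) (at t within {0..T})"
      by (auto simp: has_real_derivative_iff_has_vector_derivative[symmetric] intro: has_field_derivative_at_within)
  qed
  moreover have "- c * t = - 4 * t / q" for t by (simp add: c_def)
  ultimately have hi: "((\<lambda>t. t * exp (- 4 * t / q)) has_integral (?F T - ?F 0)) {0..T}" by simp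
  then show "(\<lambda>t. t * exp (- 4 * t / q)) integrable_on {0..T}" by (rule has_integral_integrable)
  have "0 \<le> (T / c + 1 / c\<^sup>2) * exp (- c * T)" using c T by simp
  then have "?F T - ?F 0 \<le> 1 / c\<^sup>2" by (simp only: mult_minus_left) simp
  then show "integral {0..T} (\<lambda>t. t * exp (- 4 * t / q)) \<le> q\<^sup>2 / 16"
    using integral_unique[OF hi] by (simp add: c_def power_divide)
qed

lemma pairing_continuous: "continuous_on S (\<lambda>t. pairing t x)"
  unfolding pairing_def half_diff_def multiplier_def U_def poisson_def poisson_deriv_def case_prod_beta
  by (intro continuous_intros) auto

theorem pairing_integral_bound:
  assumes T: "T \<ge> 0"
  shows "integral {0..T} (\<lambda>t. t powr (2 / p) * mean n (pairing t)) \<le> 30000 / (p - 1)\<^sup>2"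
proof -
  let ?a = "\<lambda>t. t * mean n (dissipation t)"
  let ?b = "\<lambda>t. t powr (q - 1) * mean n (\<lambda>x. D t x powr q)"
  let ?c = "\<lambda>t. t * exp (- 4 * t / q)"
  have ia: "?a integrable_on {0..T}" unfolding mean_def
    by (intro integrable_continuous_real continuous_intros dissipation_continuous) auto
  have ib: "?b integrable_on {0..T}" "integral {0..T} ?b \<le> 2 powr q / 16 * 1"
  proof -
    note I = integral_poisson_deriv_powr_le[OF T q_facts(1), of "{1..n} \<times> UNIV" n h, folded D_def]
    show "?b integrable_on {0..T}" using I(1) by simp
    have "integral {0..T} ?b \<le> 2 powr q / 16 * mean n (\<lambda>x. L2_set (\<lambda>j. h j x) ({1..n} \<times> UNIV) powr q)"
      using I(2) by simp
    also have "\<dots> \<le> 2 powr q / 16 * 1" by (rule mult_left_mono[OF h_norm_le_1]) simp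
    finally show "integral {0..T} ?b \<le> 2 powr q / 16 * 1" .
  qed
  note ic = exp_tail_integral[OF T]
  have cont: "continuous_on {0..T} (\<lambda>t. t powr (2 / p))"
    using p by (intro continuous_on_powr' continuous_intros) auto
  have "(\<lambda>t. t powr (2 / p) * mean n (pairing t)) integrable_on {0..T}"
    unfolding mean_def by (intro integrable_continuous_real continuous_intros cont pairing_continuous) auto
  moreover have hR: "((\<lambda>t. 67 * ?a t + 1 / 2 powr q * ?b t + 56 * ?c t) has_integral
      (67 * integral {0..T} ?a + 1 / 2 powr q * integral {0..T} ?b + 56 * integral {0..T} ?c)) {0..T}"
    by (intro has_integral_add has_integral_mult_right integrable_integral ia ib ic)
  ultimately have "integral {0..T} (\<lambda>t. t powr (2 / p) * mean n (pairing t)) \<le> 67 * integral {0..T} ?a + 1 / 2 powr q * integral {0..T} ?b + 56 * integral {0..T} ?c"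
    by (rule has_integral_le[OF integrable_integral]) (simp only: pairing_bound atLeastAtMost_iff)
  also have "\<dots> \<le> 67 * (324 / (p - 1)\<^sup>2) + 1 / (p - 1)\<^sup>2 + 56 * (1 / 4 / (p - 1)\<^sup>2)"
  proof (intro add_mono mult_left_mono)
    have p1: "0 < p - 1" "p - 1 \<le> 1" using p by auto
    then have p2: "(p - 1)\<^sup>2 \<le> p - 1" "0 < (p - 1)\<^sup>2" "(p - 1)\<^sup>2 \<le> 1" by (auto simp: power2_eq_square mult_le_one mult_left_le)
    have "integral {0..T} ?a \<le> 12 / (p - 1) * 27"
      using dissipation_integral[OF T] mult_left_mono[OF mean_G_le, of "12 / (p - 1)"] p1 by simp
    also have "\<dots> = 324 / (p - 1)" by simp
    also have "\<dots> \<le> 324 / (p - 1)\<^sup>2" using p2 p1 by (intro divide_left_mono) auto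
    finally show "integral {0..T} ?a \<le> 324 / (p - 1)\<^sup>2" .
    have "1 / 2 powr q * integral {0..T} ?b \<le> 1 / 2 powr q * (2 powr q / 16 * 1)"
      by (rule mult_left_mono[OF ib(2)]) simp
    also have "\<dots> \<le> 1 / 1" by simp
    also have "\<dots> \<le> 1 / (p - 1)\<^sup>2" using p2 by (intro divide_left_mono) auto
    finally show "1 / 2 powr q * integral {0..T} ?b \<le> 1 / (p - 1)\<^sup>2" .
    have "q\<^sup>2 \<le> (2 / (p - 1))\<^sup>2" using q_facts(1,5) by (intro power_mono) auto
    then show "integral {0..T} ?c \<le> 1 / 4 / (p - 1)\<^sup>2" using ic(2) by (simp add: power_divide)
  qed auto
  also have "\<dots> = (67 * 324 + 1 + 56 / 4) / (p - 1)\<^sup>2" by (simp add: add_divide_distrib)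
  also have "\<dots> \<le> 30000 / (p - 1)\<^sup>2" by (intro divide_right_mono) auto
  finally show ?thesis .
qed

end

section \<open>The gradient estimate\<close>

text \<open>
  The Mellin transform that represents the power \<open>- 2 / p\<close> of \<open>u = sqrt k\<close>: substituting \<open>r = t * u\<close>, the integral of
  \<open>t powr (2 / p) * u * exp (- 2 * t * u)\<close> over \<open>0 \<le> t \<le> s\<close> is \<open>u powr (- 2 / p) * mellin p (s * u)\<close>.
\<close>
definition mellin :: "real \<Rightarrow> real \<Rightarrow> real" where
  "mellin p s = integral {0..s} (\<lambda>r. r powr (2 / p) * exp (- (2 * r)))"

lemma mellin_integrand_continuous:
  fixes a b p :: real
  assumes "p > 0" "a \<ge> 0"
  shows "continuous_on {a..b} (\<lambda>r. r powr (2 / p) * exp (- (2 * r)))"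
  by (intro continuous_on_mult continuous_on_powr' continuous_intros) (use assms in auto)

lemma mellin_mono:
  assumes "p > 0" "0 \<le> s" "s \<le> s'"
  shows "mellin p s \<le> mellin p s'"
  unfolding mellin_def
  by (rule integral_subset_le) (use assms in \<open>auto intro!: integrable_continuous_real mellin_integrand_continuous\<close>)

lemma mellin_le_2:
  assumes p: "1 < p" "p \<le> 2" and s: "s \<ge> 0"
  shows "mellin p s \<le> 2"
proof -
  have A: "((\<lambda>r. 2 * exp (- r)) has_integral ((- 2 * exp (- s)) - (- 2 * exp (- 0)))) {0..s}"
    by (rule fundamental_theorem_of_calculus[OF s])
       (auto intro!: derivative_eq_intros simp: has_real_derivative_iff_has_vector_derivative[symmetric])
  have B: "((\<lambda>r. r powr (2 / p) * exp (- (2 * r))) has_integral mellin p s) {0..s}"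
    unfolding mellin_def using p by (intro integrable_integral integrable_continuous_real mellin_integrand_continuous) auto
  have C: "r powr (2 / p) * exp (- (2 * r)) \<le> 2 * exp (- r)" if r: "r \<in> {0..s}" for r
  proof -
    have "r powr (2 / p) \<le> 2 * exp r"
    proof (cases "r \<le> 1")
      case True
      then have "r powr (2 / p) \<le> 1" using r p by (intro powr_le1) auto
      moreover have "1 \<le> exp r" using r by simp
      ultimately show ?thesis by linarith
    next
      case False
      then have "r powr (2 / p) \<le> r powr 2" using p by (intro powr_mono) (auto simp: field_simps)
      also have "\<dots> = r\<^sup>2" using False by (simp add: powr_numeral)
      also have "\<dots> \<le> 2 * exp r" using exp_lower_Taylor_quadratic[of r] r by simp
      finally show ?thesis .
    qed
    then have "r powr (2 / p) * exp (- (2 * r)) \<le> 2 * exp r * exp (- (2 * r))" by (rule mult_right_mono) simp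
    then show ?thesis by (simp add: mult.assoc flip: exp_add)
  qed
  have "mellin p s \<le> (- 2 * exp (- s)) - (- 2 * exp (- 0))"
    by (rule has_integral_le[OF B A C])
  also have "\<dots> \<le> 2" by simp
  finally show ?thesis .
qed

lemma mellin_limit:
  assumes p: "1 < p" "p \<le> 2"
  obtains K where "K \<ge> exp (- 4)" "(mellin p \<longlongrightarrow> K) at_top"
proof
  define K where "K = (SUP s\<in>{0..}. mellin p s)"
  have bdd: "bdd_above (mellin p ` {0..})" using mellin_le_2[OF p] by (auto intro!: bdd_aboveI)
  have up: "mellin p s \<le> K" if "s \<ge> 0" for s
    unfolding K_def by (rule cSUP_upper[OF _ bdd]) (use that in auto)
  have "exp (- 4) = integral {1..2::real} (\<lambda>r. exp (- 4 :: real))" by simp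
  also have "\<dots> \<le> integral {1..2} (\<lambda>r. r powr (2 / p) * exp (- (2 * r)))"
  proof (rule integral_le)
    fix r :: real assume r: "r \<in> {1..2}"
    have "1 * exp (- 4) \<le> r powr (2 / p) * exp (- (2 * r))"
      using r p by (intro mult_mono ge_one_powr_ge_zero) auto
    then show "exp (- 4) \<le> r powr (2 / p) * exp (- (2 * r))" by simp
  qed (use p in \<open>auto intro!: integrable_continuous_real mellin_integrand_continuous\<close>)
  also have "\<dots> \<le> mellin p 2"
    unfolding mellin_def by (rule integral_subset_le) (use p in \<open>auto intro!: integrable_continuous_real mellin_integrand_continuous\<close>)
  also have "\<dots> \<le> K" by (rule up) simp
  finally show "exp (- 4) \<le> K" .
  show "(mellin p \<longlongrightarrow> K) at_top"
  proof (rule order_tendstoI)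
    fix a assume "a < K"
    then obtain s where s: "s \<ge> 0" "a < mellin p s"
      unfolding K_def using less_cSUP_iff[OF _ bdd, of a] by auto
    show "\<forall>\<^sub>F s in at_top. a < mellin p s"
      using eventually_ge_at_top[of s]
    proof eventually_elim
      case (elim u)
      then show ?case using s mellin_mono[of p s u] p by simp
    qed
  next
    fix a assume "K < a"
    show "\<forall>\<^sub>F s in at_top. mellin p s < a"
      using eventually_ge_at_top[of 0]
    proof eventually_elim
      case (elim u)
      then show ?case using up[of u] \<open>K < a\<close> by simp
    qed
  qed
qed

lemma mellin_scale:
  assumes p: "p > 0" and T: "T \<ge> 0" and u: "u > 0"
  shows "((\<lambda>t. t powr (2 / p) * (u powr (2 / p) * (u * exp (- 2 * t * u)))) has_integral mellin p (T * u)) {0..T}"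
proof -
  have "((\<lambda>t. u *\<^sub>R ((t * u) powr (2 / p) * exp (- (2 * (t * u))))) has_integral integral {0 * u..T * u} (\<lambda>r. r powr (2 / p) * exp (- (2 * r)))) {0..T}"
  proof (rule has_integral_substitution[where c = 0 and d = "T * u"])
    show "continuous_on {0..T * u} (\<lambda>r. r powr (2 / p) * exp (- (2 * r)))"
      using p by (intro mellin_integrand_continuous) auto
    show "((\<lambda>t. t * u) has_field_derivative u) (at x within {0..T})" for x
      by (auto intro!: derivative_eq_intros)
  qed (use T u in \<open>auto intro!: mult_right_mono\<close>)
  then have "((\<lambda>t. u *\<^sub>R ((t * u) powr (2 / p) * exp (- (2 * (t * u))))) has_integral mellin p (T * u)) {0..T}"
    by (simp add: mellin_def)
  then show ?thesis
    by (rule has_integral_eq[rotated]) (use u in \<open>auto simp: powr_mult mult_ac\<close>)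
qed

context poisson_pairing
begin

lemma mean_pairing:
  "mean n (pairing t) = (\<Sum>(k, b)\<in>{1..n} \<times> UNIV. \<Sum>A\<in>Pow {1..n}.
     if k \<in> A then walsh_coeff n (g b) A * walsh_coeff n (h (k, b)) A * (sqrt (real (card A)) * exp (- 2 * t * sqrt (real (card A)))) else 0)"
proof -
  have "mean n (pairing t) = (\<Sum>(k, b)\<in>{1..n} \<times> UNIV. mean n (\<lambda>x. half_diff k (U t b) x * multiplier n (poisson_deriv t) (h (k, b)) x))"
    unfolding pairing_def[abs_def] mean_sum by (simp add: case_prod_beta)
  also have "\<dots> = (\<Sum>(k, b)\<in>{1..n} \<times> UNIV. \<Sum>A\<in>Pow {1..n}.
     if k \<in> A then walsh_coeff n (g b) A * walsh_coeff n (h (k, b)) A * (sqrt (real (card A)) * exp (- 2 * t * sqrt (real (card A)))) else 0)"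
  proof (intro sum.cong refl, clarify)
    fix k b assume k: "k \<in> {1..n}"
    show "mean n (\<lambda>x. half_diff k (U t b) x * multiplier n (poisson_deriv t) (h (k, b)) x) =
      (\<Sum>A\<in>Pow {1..n}. if k \<in> A then walsh_coeff n (g b) A * walsh_coeff n (h (k, b)) A * (sqrt (real (card A)) * exp (- 2 * t * sqrt (real (card A)))) else 0)"
      unfolding parseval
    proof (intro sum.cong refl)
      fix A assume A: "A \<in> Pow {1..n}"
      have "exp (- t * sqrt (real (card A))) * exp (- t * sqrt (real (card A))) = exp (- 2 * t * sqrt (real (card A)))"
        by (simp flip: exp_add)
      then show "walsh_coeff n (half_diff k (U t b)) A * walsh_coeff n (multiplier n (poisson_deriv t) (h (k, b))) A =
         (if k \<in> A then walsh_coeff n (g b) A * walsh_coeff n (h (k, b)) A * (sqrt (real (card A)) * exp (- 2 * t * sqrt (real (card A)))) else 0)"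
        using A k by (simp add: walsh_coeff_half_diff walsh_coeff_multiplier U_def poisson_def poisson_deriv_def)
    qed
  qed
  finally show ?thesis .
qed

text \<open>
  If \<open>g\<close> is the multiple \<open>c\<close> of the Laplacian of \<open>f\<close> to the power \<open>1 / p\<close>, then its symbol cancels against the Mellin
  transform, and as \<open>T\<close> grows the pairing of the flows converges to \<open>K * c\<close> times the pairing of the gradient of \<open>f\<close> with \<open>h\<close>.
\<close>
lemma pairing_limit:
  assumes f: "\<And>b A. A \<subseteq> {1..n} \<Longrightarrow> walsh_coeff n (g b) A = real (card A) powr (1 / p) * c * walsh_coeff n (f b) A"
    and K: "(mellin p \<longlongrightarrow> K) at_top"
  shows "K * c * mean n (\<lambda>x. \<Sum>(k, b)\<in>{1..n} \<times> UNIV. half_diff k (f b) x * h (k, b) x) \<le> 30000 / (p - 1)\<^sup>2"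
proof -
  define E where "E k b A = walsh_coeff n (f b) A * walsh_coeff n (h (k, b)) A" for k b A
  have int: "integral {0..T} (\<lambda>t. t powr (2 / p) * mean n (pairing t)) =
     (\<Sum>(k, b)\<in>{1..n} \<times> UNIV. \<Sum>A\<in>Pow {1..n}. if k \<in> A then c * E k b A * mellin p (T * sqrt (real (card A))) else 0)"
    if T: "T \<ge> 0" for T
  proof (rule integral_unique)
    have "((\<lambda>t. \<Sum>(k, b)\<in>{1..n} \<times> UNIV. \<Sum>A\<in>Pow {1..n}. if k \<in> A then
       c * E k b A * (t powr (2 / p) * (sqrt (real (card A)) powr (2 / p) * (sqrt (real (card A)) * exp (- 2 * t * sqrt (real (card A)))))) else 0)
      has_integral (\<Sum>(k, b)\<in>{1..n} \<times> UNIV. \<Sum>A\<in>Pow {1..n}. if k \<in> A then c * E k b A * mellin p (T * sqrt (real (card A))) else 0)) {0..T}"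
      unfolding case_prod_beta
    proof (intro has_integral_sum)
      fix j :: "nat \<times> bool" and A assume A: "A \<in> Pow {1..n}"
      show "((\<lambda>t. if fst j \<in> A then c * E (fst j) (snd j) A * (t powr (2 / p) * (sqrt (real (card A)) powr (2 / p) * (sqrt (real (card A)) * exp (- 2 * t * sqrt (real (card A)))))) else 0)
        has_integral (if fst j \<in> A then c * E (fst j) (snd j) A * mellin p (T * sqrt (real (card A))) else 0)) {0..T}"
      proof (cases "fst j \<in> A")
        case True
        then have "card A > 0" using A finite_subset by (auto simp: card_gt_0_iff)
        then show ?thesis using True p T by (simp only: if_True) (intro has_integral_mult_right mellin_scale, auto)
      qed simp
    qed auto
    moreover have "t powr (2 / p) * mean n (pairing t) = (\<Sum>(k, b)\<in>{1..n} \<times> UNIV. \<Sum>A\<in>Pow {1..n}. if k \<in> A then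
       c * E k b A * (t powr (2 / p) * (sqrt (real (card A)) powr (2 / p) * (sqrt (real (card A)) * exp (- 2 * t * sqrt (real (card A)))))) else 0)" for t
    proof -
      have s: "sqrt (real m) powr (2 / p) = real m powr (1 / p)" for m :: nat
        by (simp add: powr_half_sqrt[symmetric] powr_powr)
      show ?thesis
        unfolding mean_pairing sum_distrib_left case_prod_beta s
        by (intro sum.cong refl) (auto simp: f E_def)
    qed
    ultimately show "((\<lambda>t. t powr (2 / p) * mean n (pairing t)) has_integral (\<Sum>(k, b)\<in>{1..n} \<times> UNIV. \<Sum>A\<in>Pow {1..n}. if k \<in> A then c * E k b A * mellin p (T * sqrt (real (card A))) else 0)) {0..T}"
      by (simp only:)
  qed
  have "((\<lambda>T. \<Sum>(k, b)\<in>{1..n} \<times> UNIV. \<Sum>A\<in>Pow {1..n}. if k \<in> A then c * E k b A * mellin p (T * sqrt (real (card A))) else 0)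
     \<longlongrightarrow> (\<Sum>(k, b)\<in>{1..n} \<times> UNIV. \<Sum>A\<in>Pow {1..n}. if k \<in> A then c * E k b A * K else 0)) at_top"
    unfolding case_prod_beta
  proof (intro tendsto_sum)
    fix j :: "nat \<times> bool" and A assume A: "A \<in> Pow {1..n}"
    show "((\<lambda>T. if fst j \<in> A then c * E (fst j) (snd j) A * mellin p (T * sqrt (real (card A))) else 0)
      \<longlongrightarrow> (if fst j \<in> A then c * E (fst j) (snd j) A * K else 0)) at_top"
    proof (cases "fst j \<in> A")
      case True
      then have "card A > 0" using A finite_subset by (auto simp: card_gt_0_iff)
      then have "filterlim (\<lambda>T. T * sqrt (real (card A))) at_top at_top"
        by (intro filterlim_at_top_mult_tendsto_pos[OF tendsto_const] filterlim_ident) auto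
      then have "((\<lambda>T. mellin p (T * sqrt (real (card A)))) \<longlongrightarrow> K) at_top"
        by (rule filterlim_compose[OF K])
      then show ?thesis using True by (simp only: if_True) (intro tendsto_mult tendsto_const)
    qed simp
  qed
  moreover have "\<forall>\<^sub>F T in at_top. (\<Sum>(k, b)\<in>{1..n} \<times> UNIV. \<Sum>A\<in>Pow {1..n}. if k \<in> A then c * E k b A * mellin p (T * sqrt (real (card A))) else 0) \<le> 30000 / (p - 1)\<^sup>2"
    using eventually_ge_at_top[of 0]
  proof eventually_elim
    case (elim T)
    then show ?case using pairing_integral_bound[OF elim] int[OF elim] by simp
  qed
  ultimately have "(\<Sum>(k, b)\<in>{1..n} \<times> UNIV. \<Sum>A\<in>Pow {1..n}. if k \<in> A then c * E k b A * K else 0) \<le> 30000 / (p - 1)\<^sup>2"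
    by (rule tendsto_upperbound) simp
  moreover have "K * c * mean n (\<lambda>x. \<Sum>(k, b)\<in>{1..n} \<times> UNIV. half_diff k (f b) x * h (k, b) x)
     = (\<Sum>(k, b)\<in>{1..n} \<times> UNIV. \<Sum>A\<in>Pow {1..n}. if k \<in> A then c * E k b A * K else 0)"
    unfolding case_prod_beta mean_sum parseval sum_distrib_left
    by (intro sum.cong refl) (auto simp: walsh_coeff_half_diff E_def)
  ultimately show ?thesis by simp
qed

end

lemma Lp_norm_cube: "Lp_norm p (cube_measure n) f = mean n (\<lambda>x. norm (f x) powr p) powr (1 / p)"
  unfolding Lp_norm_def cube_measure_def mean_def
  by (subst integral_uniform_count_measure) (simp_all add: card_cube)

definition part :: "bool \<Rightarrow> complex \<Rightarrow> real" where "part b z = (if b then Re z else Im z)"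

lemma fourier_coeff_part: "part b (fourier_coeff n f (A :: nat set)) = walsh_coeff n (\<lambda>x. part b (f x)) A"
proof -
  have "fourier_coeff n f A = (\<Sum>x\<in>cube n. f x * walsh A x) / 2 ^ n"
    unfolding fourier_coeff_def cube_measure_def uniform_count_measure_def
    by (subst lebesgue_integral_point_measure_finite) (simp_all add: card_cube scaleR_conv_of_real sum_divide_distrib)
  also have "\<dots> = (\<Sum>x\<in>cube n. f x * complex_of_real (real_walsh A x)) / complex_of_real (2 ^ n)"
    by (simp add: walsh_def real_walsh_def)
  finally show ?thesis
    unfolding walsh_coeff_def mean_def part_def by (simp add: Re_divide_of_real Im_divide_of_real)
qed

lemma laplacian_powr_part:
  "part b (laplacian_powr n (complex_of_real r) f x) = multiplier n (\<lambda>k. real k powr r) (\<lambda>x. part b (f x)) x"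
proof -
  have "laplacian_powr n (complex_of_real r) f x =
     (\<Sum>A\<in>Pow {1..n} - {{}}. complex_of_real (real (card A) powr r * real_walsh A x) * fourier_coeff n f A)"
    unfolding laplacian_powr_def
  proof (intro sum.cong refl)
    fix A :: "nat set"
    have "of_nat (card A) powr complex_of_real r = complex_of_real (real (card A) powr r)"
      using powr_of_real[of "real (card A)" r] by simp
    then show "of_nat (card A) powr complex_of_real r * fourier_coeff n f A * walsh A x =
         complex_of_real (real (card A) powr r * real_walsh A x) * fourier_coeff n f A"
      by (simp add: walsh_def real_walsh_def)
  qed
  then have "part b (laplacian_powr n (complex_of_real r) f x) =
     (\<Sum>A\<in>Pow {1..n} - {{}}. real (card A) powr r * real_walsh A x * part b (fourier_coeff n f A))"
    unfolding part_def by simp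
  also have "\<dots> = (\<Sum>A\<in>Pow {1..n}. real (card A) powr r * real_walsh A x * part b (fourier_coeff n f A))"
    by (rule sum.mono_neutral_left) auto
  finally show ?thesis by (simp add: multiplier_def fourier_coeff_part mult_ac)
qed

lemma norm_part: "cmod z = L2_set (\<lambda>b. part b z) UNIV"
  by (simp add: cmod_def L2_set_def part_def UNIV_bool add.commute)

lemma partial_diff_part: "part b (partial_diff j f x) = half_diff j (\<lambda>x. part b (f x)) x"
  by (simp add: part_def partial_diff_def half_diff_def)

lemma gradient_part:
  "sqrt (\<Sum>j=1..n. (cmod (partial_diff j f x))\<^sup>2) = L2_set (\<lambda>(k, b). half_diff k (\<lambda>x. part b (f x)) x) ({1..n} \<times> UNIV)"
proof -
  have "(cmod (partial_diff j f x))\<^sup>2 = (\<Sum>b\<in>UNIV. (half_diff j (\<lambda>x. part b (f x)) x)\<^sup>2)" for j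
    unfolding norm_part partial_diff_part L2_set_def by (simp add: sum_nonneg)
  then show ?thesis unfolding L2_set_def by (simp add: sum.cartesian_product case_prod_beta)
qed

text \<open>
  Normalise by \<open>M\<close> and \<open>N\<close> and take for \<open>h\<close> the norming functional \<open>S powr (p - 2) * D f / N powr (p - 1)\<close> of the gradient. It
  satisfies \<open>|h| = (S / N) powr (p - 1)\<close>, so that \<open>S / N\<close> is the natural summand for \<open>h\<close> in the majorant \<open>G\<close>. Only an upper bound of the norm of the
  right-hand side is assumed, so that the case of vanishing norm is covered by a limit.
\<close>
lemma gradient_estimate:
  fixes f :: "(nat \<Rightarrow> real) \<Rightarrow> complex"
  assumes p: "1 < p" "p \<le> 2"
    and M: "M > 0" "mean n (\<lambda>x. cmod (laplacian_powr n (complex_of_real (1 / p)) f x) powr p) \<le> M powr p"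
    and N: "N > 0" "mean n (\<lambda>x. sqrt (\<Sum>j=1..n. (cmod (partial_diff j f x))\<^sup>2) powr p) = N powr p"
  shows "N \<le> 30000 * exp 4 / (p - 1)\<^sup>2 * M"
proof -
  define F where "F b x = part b (f x)" for b x
  define g where "g b x = (1 / M) * multiplier n (\<lambda>k. real k powr (1 / p)) (F b) x" for b x
  define S where "S x = L2_set (\<lambda>(k, b). half_diff k (F b) x) ({1..n} \<times> UNIV)" for x
  define h where "h j x = (S x powr (p - 2) / N powr (p - 1)) * (case j of (k, b) \<Rightarrow> half_diff k (F b) x)" for j x
  define gn where "gn x = L2_set (\<lambda>b. g b x) UNIV" for x
  define G where "G x = 1 + gn x + S x / N" for x
  have S0: "S x \<ge> 0" for x by (simp add: S_def)
  have gn0: "gn x \<ge> 0" for x by (simp add: gn_def)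
  have gn: "gn x = cmod (laplacian_powr n (complex_of_real (1 / p)) f x) / M" for x
    unfolding gn_def g_def L2_set_cmult norm_part laplacian_powr_part F_def using M(1) by simp
  have SN: "mean n (\<lambda>x. S x powr p) = N powr p" using N(2) unfolding gradient_part S_def F_def .
  have mS: "mean n (\<lambda>x. (S x / N) powr p) = 1"
  proof -
    have "(S x / N) powr p = 1 / N powr p * S x powr p" for x using N(1) S0[of x] by (simp add: powr_divide)
    then have "mean n (\<lambda>x. (S x / N) powr p) = 1 / N powr p * N powr p" by (simp only: mean_cmult SN)
    then show ?thesis using N(1) by simp
  qed
  have mg: "mean n (\<lambda>x. gn x powr p) \<le> 1"
  proof -
    have "gn x powr p = 1 / M powr p * cmod (laplacian_powr n (complex_of_real (1 / p)) f x) powr p" for x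
      unfolding gn using M(1) by (simp add: powr_divide)
    then have "mean n (\<lambda>x. gn x powr p) = 1 / M powr p * mean n (\<lambda>x. cmod (laplacian_powr n (complex_of_real (1 / p)) f x) powr p)"
      by (simp only: mean_cmult)
    also have "\<dots> \<le> 1 / M powr p * M powr p" by (rule mult_left_mono[OF M(2)]) simp
    finally show ?thesis using M(1) by simp
  qed
  have hn: "L2_set (\<lambda>j. h j x) ({1..n} \<times> UNIV) = (S x / N) powr (p - 1)" for x
  proof -
    have "L2_set (\<lambda>j. h j x) ({1..n} \<times> UNIV) = S x powr (p - 2) / N powr (p - 1) * S x"
      unfolding h_def L2_set_cmult S_def by simp
    also have "S x powr (p - 2) / N powr (p - 1) * S x = (S x / N) powr (p - 1)"
      using S0[of x] N(1) powr_add[of "S x" "p - 2" 1] by (cases "S x = 0") (auto simp: powr_divide)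
    finally show ?thesis .
  qed
  have mG: "mean n (\<lambda>x. G x powr p) \<le> 27"
  proof -
    have "G x powr p \<le> 9 * (1 + gn x powr p + (S x / N) powr p)" for x
    proof -
      define m where "m = max 1 (max (gn x) (S x / N))"
      have "G x \<le> 3 * m" unfolding G_def m_def by linarith
      then have "G x powr p \<le> (3 * m) powr p"
        using p gn0[of x] S0[of x] N(1) by (intro powr_mono2) (auto simp: G_def)
      also have "\<dots> = 3 powr p * m powr p" by (simp add: powr_mult)
      also have "\<dots> \<le> 3 powr 2 * (1 + gn x powr p + (S x / N) powr p)"
      proof (intro mult_mono powr_mono)
        have "m = 1 \<or> m = gn x \<or> m = S x / N" unfolding m_def by linarith
        then show "m powr p \<le> 1 + gn x powr p + (S x / N) powr p"
          using powr_ge_zero[of "gn x" p] powr_ge_zero[of "S x / N" p] by (auto simp del: powr_ge_zero)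
      qed (use p in auto)
      finally show ?thesis by simp
    qed
    then have "mean n (\<lambda>x. G x powr p) \<le> mean n (\<lambda>x. 9 * (1 + gn x powr p + (S x / N) powr p))"
      by (intro mean_mono)
    also have "\<dots> = 9 * (1 + mean n (\<lambda>x. gn x powr p) + mean n (\<lambda>x. (S x / N) powr p))"
      by (simp only: mean_cmult mean_add mean_const)
    finally show ?thesis using mg mS by simp
  qed
  interpret poisson_pairing n p G g h
  proof
    show "mean n (\<lambda>x. G x powr p) \<le> 27" by (rule mG)
    have "((S x / N) powr (p - 1)) powr (p / (p - 1)) = (S x / N) powr p" for x
      using p by (simp add: powr_powr)
    then show "mean n (\<lambda>x. L2_set (\<lambda>j. h j x) ({1..n} \<times> UNIV) powr (p / (p - 1))) \<le> 1"
      unfolding hn using mS by simp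
    fix x
    show "1 \<le> G x" "L2_set (\<lambda>i. g i x) UNIV \<le> G x"
      using gn0[of x] S0[of x] N(1) by (auto simp: G_def gn_def[symmetric])
    show "L2_set (\<lambda>j. h j x) ({1..n} \<times> UNIV) \<le> G x powr (p - 1)"
      unfolding hn using gn0[of x] S0[of x] N(1) p by (intro powr_mono2) (auto simp: G_def)
  qed (use p in auto)
  obtain K where K: "K \<ge> exp (- 4)" "(mellin p \<longlongrightarrow> K) at_top" by (rule mellin_limit[OF p])
  have "K * (1 / M) * mean n (\<lambda>x. \<Sum>(k, b)\<in>{1..n} \<times> UNIV. half_diff k (F b) x * h (k, b) x) \<le> 30000 / (p - 1)\<^sup>2"
  proof (rule pairing_limit[OF _ K(2)])
    fix b A assume A: "A \<subseteq> {1..n}"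
    have "walsh_coeff n (g b) A = (1 / M) * walsh_coeff n (multiplier n (\<lambda>k. real k powr (1 / p)) (F b)) A"
      unfolding walsh_coeff_def g_def mean_cmult[symmetric] by (simp add: mult.assoc)
    then show "walsh_coeff n (g b) A = real (card A) powr (1 / p) * (1 / M) * walsh_coeff n (F b) A"
      using A by (simp add: walsh_coeff_multiplier)
  qed
  moreover have "mean n (\<lambda>x. \<Sum>(k, b)\<in>{1..n} \<times> UNIV. half_diff k (F b) x * h (k, b) x) = N"
  proof -
    have "(\<Sum>(k, b)\<in>{1..n} \<times> UNIV. half_diff k (F b) x * h (k, b) x) = 1 / N powr (p - 1) * S x powr p" for x
    proof -
      have "(\<Sum>(k, b)\<in>{1..n} \<times> UNIV. half_diff k (F b) x * h (k, b) x) =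
          S x powr (p - 2) / N powr (p - 1) * (\<Sum>(k, b)\<in>{1..n} \<times> UNIV. (half_diff k (F b) x)\<^sup>2)"
        unfolding h_def sum_distrib_left case_prod_beta by (intro sum.cong refl) (simp add: power2_eq_square)
      also have "(\<Sum>(k, b)\<in>{1..n} \<times> UNIV. (half_diff k (F b) x)\<^sup>2) = (S x)\<^sup>2"
        unfolding S_def L2_set_def by (simp add: sum_nonneg case_prod_beta)
      also have "S x powr (p - 2) / N powr (p - 1) * (S x)\<^sup>2 = 1 / N powr (p - 1) * S x powr p"
        using S0[of x] powr_add[of "S x" "p - 2" 2] by (cases "S x = 0") (auto simp: powr_numeral)
      finally show ?thesis .
    qed
    then have "mean n (\<lambda>x. \<Sum>(k, b)\<in>{1..n} \<times> UNIV. half_diff k (F b) x * h (k, b) x) = 1 / N powr (p - 1) * N powr p"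
      by (simp only: mean_cmult SN)
    also have "\<dots> = N" using N(1) powr_add[of N "p - 1" 1] by simp
    finally show ?thesis .
  qed
  ultimately have "K * (N / M) \<le> 30000 / (p - 1)\<^sup>2" by simp
  moreover have "exp (- 4) * (N / M) \<le> K * (N / M)" using K(1) M(1) N(1) by (intro mult_right_mono) auto
  ultimately have "exp (- 4) * (N / M) \<le> 30000 / (p - 1)\<^sup>2" by linarith
  then have "exp 4 * M * (exp (- 4) * (N / M)) \<le> exp 4 * M * (30000 / (p - 1)\<^sup>2)"
    using M(1) by (intro mult_left_mono) auto
  moreover have "exp 4 * M * (exp (- 4) * (N / M)) = N" using M(1) by (simp add: exp_minus)
  ultimately show ?thesis by (simp add: mult_ac)
qed

theorem theorem1p2:
  shows "\<exists>c::real. c > 0 \<and>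
    (\<forall>p::real. \<forall>n::nat. \<forall>f::(nat \<Rightarrow> real) \<Rightarrow> complex.
       1 < p \<longrightarrow> p \<le> 2 \<longrightarrow> 1 \<le> n \<longrightarrow>
       Lp_norm p (cube_measure n) (\<lambda>x. sqrt (\<Sum>j=1..n. (cmod (partial_diff j f x))\<^sup>2))
         \<le> c * (p - 1) powr (-2) *
           Lp_norm p (cube_measure n) (laplacian_powr n (complex_of_real (1 / p)) f))"
proof (intro exI[of _ "30000 * exp 4"] conjI allI impI)
  fix p :: real and n :: nat and f :: "(nat \<Rightarrow> real) \<Rightarrow> complex"
  assume p: "1 < p" "p \<le> 2"
  define N where "N = Lp_norm p (cube_measure n) (\<lambda>x. sqrt (\<Sum>j=1..n. (cmod (partial_diff j f x))\<^sup>2))"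
  define M where "M = Lp_norm p (cube_measure n) (laplacian_powr n (complex_of_real (1 / p)) f)"
  define c where "c = 30000 * exp 4 / (p - 1)\<^sup>2"
  have c: "c > 0" using p by (simp add: c_def)
  have nonneg: "mean n (\<lambda>x. norm (u x) powr p) \<ge> 0" for u :: "(nat \<Rightarrow> real) \<Rightarrow> 'z :: real_normed_vector"
    by (rule mean_nonneg) simp
  have Np: "N powr p = mean n (\<lambda>x. sqrt (\<Sum>j=1..n. (cmod (partial_diff j f x))\<^sup>2) powr p)"
    unfolding N_def Lp_norm_cube using p nonneg[of "\<lambda>x. sqrt (\<Sum>j=1..n. (cmod (partial_diff j f x))\<^sup>2)"]
    by (simp add: powr_powr sum_nonneg)
  have Mp: "M powr p = mean n (\<lambda>x. cmod (laplacian_powr n (complex_of_real (1 / p)) f x) powr p)"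
    unfolding M_def Lp_norm_cube using p nonneg[of "laplacian_powr n (complex_of_real (1 / p)) f"]
    by (simp add: powr_powr)
  have N0: "N \<ge> 0" "M \<ge> 0" by (simp_all add: N_def M_def Lp_norm_def)
  have "N \<le> c * M + e" if e: "e > 0" for e
  proof (cases "N = 0")
    case False
    \<comment> \<open>M may vanish; M + e / c does not\<close>
    have M': "M + e / c > 0" "M \<le> M + e / c" using N0 c e by (auto intro!: add_nonneg_pos)
    have "N \<le> c * (M + e / c)"
      unfolding c_def[symmetric]
      by (rule gradient_estimate[OF p M'(1) _ _ Np[symmetric], folded c_def])
         (use False N0 M' p Mp powr_mono2[of p M "M + e / c"] in auto)
    then show ?thesis using c by (simp add: algebra_simps)
  qed (use N0 c e in auto)
  then have "N \<le> c * M" by (rule field_le_epsilon)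
  moreover have "(p - 1) powr (- 2) = 1 / (p - 1)\<^sup>2"
    using p by (simp add: powr_minus_divide powr_numeral)
  ultimately show "N \<le> 30000 * exp 4 * (p - 1) powr (- 2) * M" by (simp add: c_def)
qed simp

end
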